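(* Let $l>0$, let $\lambda(\alpha)$, $U(x;\alpha)$ ($\alpha>0$) be the Korman solution family of \[ (\mathrm{P}_\lambda)\qquad u''+\lambda|x|^l e^u=0,\ x\in(-1,1),\qquad u(-1)=u(1)=0 \] and let $\alpha_*>0$ be the turning parameter, all as defined in the context. Then there exist constants $\alpha_1,\alpha_2,\alpha_3$ such that $\alpha_*<\alpha_1\le\alpha_2\le\alpha_3$ and the following (i)--(vii) hold: (i) if $0<\alpha<\alpha_*$, then $m(\alpha)=0$ and $U(x;\alpha)$ is nondegenerate; (ii) if $\alpha=\alpha_*$, then $m(\alpha)=0$ and $U(x;\alpha)$ is degenerate; (iii) if $\alpha_*<\alpha<\alpha_1$, then $m(\alpha)=1$ and $U(x;\alpha)$ is nondegenerate; (iv) if $\alpha=\alpha_1$, then $m(\alpha)=1$ and $U(x;\alpha)$ is degenerate; (v) if $\alpha=\alpha_2$, then $m(\alpha)=1$, $U(x;\alpha)$ is degenerate, and the point $(\lambda(\alpha_2),U(x;\alpha_2))$ is a non-even bifurcation point, that is, for each $\varepsilon>0$ there exists $(\lambda,u)$ such that $u$ is a positive non-even solution of $(\mathrm{P}_\lambda)$ and $|\lambda-\lambda(\alpha_2)|+\|u-U(\,\cdot\,;\alpha_2)\|_\infty<\varepsilon$; (vi) if $\alpha=\alpha_3$, then $m(\alpha)=1$ and $U(x;\alpha)$ is degenerate; (vii) if $\alpha>\alpha_3$, then $m(\alpha)=2$ and $U(x;\alpha)$ is nondegenerate. Moreover, for every $\lambda$ with $0<\lambda<\lambda(\alpha_3)$,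 problem $(\mathrm{P}_\lambda)$ has a positive non-even solution $u=u_\lambda$, and these satisfy $\lim_{\lambda\to+0}\|u_\lambda\|_\infty=\infty$.
   Context: Solutions are classical; here $\lambda>0$. A solution is positive if $u(x)>0$ on $(-1,1)$, and even if $u(-x)=u(x)$. $\|v\|_\infty=\sup_{x\in[-1,1]}|v(x)|$. Korman solution: let $w$ be the unique solution of $w''+|x|^l e^w=0$ for $x>0$, $w(0)=w'(0)=0$. Then $w,w',w''<0$ on $(0,\infty)$ and $w(x)\to-\infty$ as $x\to\infty$; let $\eta:[0,\infty)\to[0,\infty)$ be the inverse function of $-w$. For $\alpha>0$ set $\lambda(\alpha)=[\eta(\alpha)]^{l+2}e^{-\alpha}$ and $U(x;\alpha)=w(\eta(\alpha)|x|)+\alpha$, $x\in[-1,1]$. Then $U(\,\cdot\,;\alpha)$ is a positive even solution of $(\mathrm{P}_{\lambda(\alpha)})$ with $\|U(\,\cdot\,;\alpha)\|_\infty=\alpha$. The number $\alpha_*>0$ is the unique one such that $\lambda'(\alpha)>0$ for $0<\alpha<\alpha_*$, $\lambda'(\alpha_* )=0$, and $\lambda'(\alpha)<0$ for $\alpha>\alpha_*$. The Morse index $m(\alpha)$ of $U(x;\alpha)$ is the number of negative eigenvalues $\mu$ of \[ \phi''+\lambda(\alpha)|x|^l e^{U(x;\alpha)}\phi+\mu\phi=0,\ x\in(-1,1),\qquad \phi(-1)=\phi(1)=0. \] $U(x;\alpha)$ is degenerate if $\mu=0$ is an eigenvalue of this problem, and nondegenerate otherwise. *)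

theory Defs
  imports Complex_Main "HOL-Library.FuncSet" "HOL-Library.Extended_Nat"
begin

text \<open>The Dirichlet problem \<open>u'' + f(x, u) = 0\<close> on \<open>(-1,1)\<close>, \<open>u(-1) = u(1) = 0\<close>, in the classical
  sense. For \<open>f\<close> continuous, as below, \<open>u\<close> is automatically twice continuously differentiable.\<close>

definition dirichlet_solution :: "(real \<Rightarrow> real \<Rightarrow> real) \<Rightarrow> (real \<Rightarrow> real) \<Rightarrow> bool" where
  "dirichlet_solution f u \<longleftrightarrow>
     continuous_on {-1..1} u \<and> u (-1) = 0 \<and> u 1 = 0 \<and>
     (\<exists>u'. \<forall>x\<in>{-1<..<1}.
        (u has_real_derivative u' x) (at x) \<and>
        (u' has_real_derivative - f x (u x)) (at x))"

definition liouville_solution :: "real \<Rightarrow> real \<Rightarrow> (real \<Rightarrow> real) \<Rightarrow> bool" where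
  "liouville_solution l lam u \<longleftrightarrow> dirichlet_solution (\<lambda>x y. lam * \<bar>x\<bar> powr l * exp y) u"

definition positive_fun :: "(real \<Rightarrow> real) \<Rightarrow> bool" where
  "positive_fun u \<longleftrightarrow> (\<forall>x\<in>{-1<..<1}. u x > 0)"

definition even_fun :: "(real \<Rightarrow> real) \<Rightarrow> bool" where
  "even_fun u \<longleftrightarrow> (\<forall>x\<in>{-1..1}. u (-x) = u x)"

definition sup_norm :: "(real \<Rightarrow> real) \<Rightarrow> real" where
  "sup_norm v = (SUP x\<in>{-1..1}. \<bar>v x\<bar>)"

definition positive_noneven_solution :: "real \<Rightarrow> real \<Rightarrow> (real \<Rightarrow> real) \<Rightarrow> bool" where
  "positive_noneven_solution l lam u \<longleftrightarrow>
     lam > 0 \<and> liouville_solution l lam u \<and> positive_fun u \<and> \<not> even_fun u"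

definition korman_ivp :: "real \<Rightarrow> (real \<Rightarrow> real) \<Rightarrow> bool" where
  "korman_ivp l w \<longleftrightarrow>
     (\<exists>w'. (\<forall>x\<ge>0. (w has_real_derivative w' x) (at x within {0..})) \<and>
           (\<forall>x>0. (w' has_real_derivative - (x powr l * exp (w x))) (at x)) \<and>
           w 0 = 0 \<and> w' 0 = 0)"

text \<open>The solution lives on \<open>[0,\<infinity>)\<close>; \<open>extensional\<close> only fixes the irrelevant values at negative
  arguments, so that the definite description denotes.\<close>

definition korman_w :: "real \<Rightarrow> real \<Rightarrow> real" where
  "korman_w l = (THE w. w \<in> extensional {0..} \<and> korman_ivp l w)"

definition korman_eta :: "real \<Rightarrow> real \<Rightarrow> real" where
  "korman_eta l = the_inv_into {0..} (\<lambda>x. - korman_w l x)"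

definition korman_lambda :: "real \<Rightarrow> real \<Rightarrow> real" where
  "korman_lambda l \<alpha> = korman_eta l \<alpha> powr (l + 2) * exp (- \<alpha>)"

definition korman_U :: "real \<Rightarrow> real \<Rightarrow> real \<Rightarrow> real" where
  "korman_U l \<alpha> x = korman_w l (korman_eta l \<alpha> * \<bar>x\<bar>) + \<alpha>"

definition turning_parameter :: "real \<Rightarrow> real" where
  "turning_parameter l = (THE a. a > 0 \<and>
     (\<forall>\<alpha>. 0 < \<alpha> \<and> \<alpha> < a \<longrightarrow> (\<exists>D>0. (korman_lambda l has_real_derivative D) (at \<alpha>))) \<and>
     (korman_lambda l has_real_derivative 0) (at a) \<and>
     (\<forall>\<alpha>>a. \<exists>D<0. (korman_lambda l has_real_derivative D) (at \<alpha>)))"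

text \<open>Real \<open>\<mu>\<close> and real eigenfunctions suffice, the problem being self-adjoint.\<close>

definition linearized_eigenvalue :: "real \<Rightarrow> real \<Rightarrow> real \<Rightarrow> bool" where
  "linearized_eigenvalue l \<alpha> \<mu> \<longleftrightarrow>
     (\<exists>\<phi>. dirichlet_solution
             (\<lambda>x y. korman_lambda l \<alpha> * \<bar>x\<bar> powr l * exp (korman_U l \<alpha> x) * y + \<mu> * y) \<phi> \<and>
          (\<exists>x\<in>{-1..1}. \<phi> x \<noteq> 0))"

text \<open>The eigenvalues are simple, so counting distinct ones agrees with counting multiplicities.
  The value is an \<open>enat\<close> because \<open>card\<close> of an infinite set would be \<open>0\<close>.\<close>

definition morse_index :: "real \<Rightarrow> real \<Rightarrow> enat" where
  "morse_index l \<alpha> =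
     (let N = {\<mu>. \<mu> < 0 \<and> linearized_eigenvalue l \<alpha> \<mu>}
      in if finite N then enat (card N) else \<infinity>)"

definition degenerate :: "real \<Rightarrow> real \<Rightarrow> bool" where
  "degenerate l \<alpha> \<longleftrightarrow> linearized_eigenvalue l \<alpha> 0"

definition noneven_bifurcation_point :: "real \<Rightarrow> real \<Rightarrow> bool" where
  "noneven_bifurcation_point l \<alpha> \<longleftrightarrow>
     (\<forall>\<epsilon>>0. \<exists>lam u. positive_noneven_solution l lam u \<and>
        \<bar>lam - korman_lambda l \<alpha>\<bar> + sup_norm (\<lambda>x. u x - korman_U l \<alpha> x) < \<epsilon>)"

end

theory Submission
  imports Defs "HOL-Analysis.Analysis"
begin

text \<open>
  Put \<open>\<alpha> = - w \<eta>\<close> and rescale by \<open>\<eta>\<close>: all linearized problems become \<open>y'' + (V + \<nu>) y = 0\<close> on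
  \<open>(-\<eta>, \<eta>)\<close> with one fixed even potential \<open>V t = \<bar>t\<bar>\<^sup>l exp (w t)\<close>. For \<open>\<nu> = 0\<close> the even solution
  is explicit, \<open>v t = 1 + t w' t / (l + 2)\<close>; it has a single positive zero \<open>\<tau>\<close>, and \<open>\<lambda>'(\<alpha>)\<close> has the sign of
  \<open>v \<eta>\<close>. The odd solution \<open>z\<close> also has a single positive zero \<open>\<zeta> > \<tau>\<close>. Sturm comparison
  then gives the Morse index \<open>[\<tau> < \<eta>] + [\<zeta> < \<eta>]\<close>, so \<open>\<alpha>1 = \<alpha>2 = \<alpha>3 = - w \<zeta>\<close> works.

  Non-even solutions come from shooting from \<open>-1\<close> with slope \<open>s\<close>: at an even solution the derivative
  of the right end value with respect to \<open>s\<close> is \<open>2 v \<eta> z \<eta> / \<eta>\<close>. For \<open>lam < \<Lambda> \<zeta>\<close> it is positive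
  at both even solutions, so the end value vanishes in between; at \<open>\<eta> = \<zeta>\<close> it changes sign,
  which gives the bifurcation.
\<close>

section \<open>Initial value problems\<close>

text \<open>No spectral or bifurcation theorem enters. Since \<open>V\<close> is even,
  eigenfunctions split into even and odd solutions of initial value problems at 0, and a single
  positive zero at \<open>\<nu> = 0\<close> leaves room for at most one negative
  \<open>\<nu>\<close> per parity. The delicate point is \<open>\<zeta>\<close>, because
  \<open>z\<close>, unlike \<open>v\<close>, comes with no formula. That it is the only positive
  zero and lies beyond \<open>\<tau>\<close> follows from the constant Wronskian of \<open>v\<close>
  and \<open>z\<close>, which makes \<open>z / v\<close> increase wherever \<open>v\<close> does not
  vanish; that it exists follows by comparing \<open>z\<close> with \<open>- w'\<close>, whose
  growth has to be bounded. Intermediate values suffice for non-even solutions because an even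
  solution is determined by its slope at -1, which strictly increases with \<open>\<eta>\<close>,
  while \<open>\<Lambda>\<close> has just two monotone branches: a zero of the end value off this
  curve is automatically non-even. The weight vanishes at 0 and need not be differentiable there.
  All equations therefore live on the whole line with \<open>\<bar>t\<bar> powr l\<close>, and the
  point 0 gets separate treatment.\<close>

lemma antiderivative_UNIV_exists:
  fixes h :: "real \<Rightarrow> 'a::banach"
  assumes "continuous_on UNIV h"
  shows "\<exists>H. H a = 0 \<and> (\<forall>t. (H has_vector_derivative h t) (at t))"
proof -
  \<comment> \<open>An integral over \<open>{x..y}\<close> with \<open>y < x\<close> is 0, so this
    difference is the oriented integral from \<open>a\<close> to \<open>t\<close>.\<close>
  define H where "H t = integral {a..t} h - integral {t..a} h" for t
  have cont: "continuous_on S h" for S using assms continuous_on_subset by blast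
  have "(H has_vector_derivative h t) (at t)" for t
  proof -
    define c d where "c = min a t - 1" and "d = max a t + 1"
    have int: "h integrable_on {x..y}" for x y
      using cont by (rule integrable_continuous_real)
    have H: "H u = integral {c..u} h - integral {c..a} h" if "u \<in> {c<..<d}" for u
    proof (cases "a \<le> u")
      case True
      have "integral {c..a} h + integral {a..u} h = integral {c..u} h"
        using True by (intro Henstock_Kurzweil_Integration.integral_combine int) (auto simp: c_def)
      moreover have "integral {u..a} h = 0" using True by (cases "u = a") auto
      ultimately show ?thesis by (simp add: H_def algebra_simps)
    next
      case False
      have "integral {c..u} h + integral {u..a} h = integral {c..a} h"
        using False that by (intro Henstock_Kurzweil_Integration.integral_combine int) (auto simp: c_def)
      moreover have "integral {a..u} h = 0" using False by simp
      ultimately show ?thesis by (simp add: H_def algebra_simps)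
    qed
    have t: "t \<in> {c<..<d}" by (auto simp: c_def d_def)
    have "((\<lambda>u. integral {c..u} h) has_vector_derivative h t) (at t within {c..d})"
      using t by (intro integral_has_vector_derivative cont) auto
    then have "((\<lambda>u. integral {c..u} h) has_vector_derivative h t) (at t)"
      using t by (metis at_within_Icc_at greaterThanLessThan_iff)
    then have "((\<lambda>u. integral {c..u} h - integral {c..a} h) has_vector_derivative h t) (at t)"
      by (auto intro!: derivative_eq_intros)
    then show ?thesis
      by (rule has_vector_derivative_transform_within_open[OF _ open_greaterThanLessThan t]) (simp add: H)
  qed
  moreover have "H a = 0" by (simp add: H_def)
  ultimately show ?thesis by blast
qed

lemma norm_le_of_derivative_bound_symmetric:
  fixes H :: "real \<Rightarrow> 'a::real_normed_vector"
  assumes H: "\<And>t. (H has_vector_derivative h t) (at t)" "H 0 = 0"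
    and C: "\<And>t. (C has_real_derivative c t) (at t)" "C 0 = 0"
    and le: "\<And>t. norm (h t) \<le> c \<bar>t\<bar>"
  shows "norm (H x) \<le> C \<bar>x\<bar>"
proof -
  have *: "norm (G y) \<le> C y" if "y \<ge> 0" and G: "\<And>t. (G has_vector_derivative k t) (at t)" "G 0 = 0"
    and k: "\<And>t. norm (k t) \<le> c \<bar>t\<bar>" for G k y
  proof (cases "y = 0")
    case True then show ?thesis using G C by simp
  next
    case False
    have cG: "continuous_on {0..y} G"
      using G(1) by (meson continuous_at_imp_continuous_on has_vector_derivative_continuous)
    have cC: "continuous_on {0..y} C"
      using C(1) by (meson continuous_at_imp_continuous_on DERIV_isCont)
    have "norm (G y - G 0) \<le> C y - C 0"
    proof (rule differentiable_bound_general[OF _ cG cC])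
      show "(G has_vector_derivative k t) (at t)" for t by (rule G)
      show "(C has_vector_derivative c t) (at t)" for t
        using C(1) by (simp add: has_real_derivative_iff_has_vector_derivative)
      show "norm (k t) \<le> c t" if "0 < t" for t using k[of t] that by simp
    qed (use that False in auto)
    then show ?thesis using G C by simp
  qed
  show ?thesis
  proof (cases "x \<ge> 0")
    case True then show ?thesis using *[OF True H le] by simp
  next
    case False
    have "((\<lambda>t. H (- t)) has_vector_derivative - h (- t)) (at t)" for t
      using vector_diff_chain_at[of "\<lambda>x. - x" "-1" t H "h (-t)"] H(1)[of "-t"]
        has_vector_derivative_minus[OF has_vector_derivative_id, of "at t"] by (simp add: o_def)
    from *[OF _ this, of "-x"] False H(2) le show ?thesis by (auto simp: le[of "- _", simplified])
  qed
qed

text \<open>Picard iteration in a weighted sup norm: \<open>y = y0 + E v\<close> with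
  \<open>v\<close> bounded continuous and \<open>E\<close> the exponential of an integral of the
  Lipschitz bound. The weight makes the integral operator a contraction on the whole line at once,
  so no local solutions have to be glued; \<open>bnd\<close> keeps its values bounded after division
  by \<open>E\<close>.\<close>

lemma ivp_exists_at_zero:
  fixes f :: "real \<Rightarrow> 'a::banach \<Rightarrow> 'a" and g :: "real \<Rightarrow> real"
  assumes cont: "continuous_on UNIV (\<lambda>(t, y). f t y)"
    and cg: "continuous_on UNIV g"
    and lip: "\<And>t y z. norm (f t y - f t z) \<le> g t * norm (y - z)"
    and bnd: "\<And>t. norm (f t y0) \<le> g t"
  shows "\<exists>y. y 0 = y0 \<and> (\<forall>t. (y has_vector_derivative f t (y t)) (at t))"
proof -
  \<comment> \<open>Symmetrized, so that one bound in \<open>\<bar>t\<bar>\<close> serves both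
    half-lines.\<close>
  define G where "G t = g t + g (- t)" for t
  have g0: "g t \<ge> 0" for t using bnd[of t] norm_ge_zero order_trans by blast
  have cG: "continuous_on UNIV (\<lambda>t. 2 * G t)"
    unfolding G_def
    by (intro continuous_intros continuous_on_compose2[OF cg] ) auto
  obtain K where K0: "K 0 = 0" and K: "\<And>t. (K has_real_derivative 2 * G t) (at t)"
    using antiderivative_UNIV_exists[OF cG, of 0] by (auto simp: has_real_derivative_iff_has_vector_derivative)
  have gG: "g t \<le> G \<bar>t\<bar>" for t using g0 by (cases "t \<ge> 0") (auto simp: G_def)
  have G0: "G t \<ge> 0" for t using g0 by (auto simp: G_def)
  have Kpos: "K t \<ge> 0" if "t \<ge> 0" for t
    using DERIV_nonneg_imp_nondecreasing[OF that, of K] K K0 G0 by (metis mult_nonneg_nonneg zero_le_numeral)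
  have cK: "continuous_on UNIV (\<lambda>t. K \<bar>t\<bar>)"
    by (rule continuous_on_compose2[OF DERIV_continuous_on[of UNIV K, OF has_field_derivative_at_within[OF K]]
          continuous_on_rabs[OF continuous_on_id]]) simp
  define E where "E t = exp (K \<bar>t\<bar>)" for t
  have cE: "continuous_on UNIV E" unfolding E_def by (intro continuous_intros cK)
  have E1: "E t \<ge> 1" for t unfolding E_def using Kpos[of "\<bar>t\<bar>"] by simp
  have Epos: "E t > 0" for t unfolding E_def by simp
  \<comment> \<open>Antiderivative of \<open>G exp K\<close>; the 2 in the derivative of
    \<open>K\<close> becomes the contraction factor 1/2.\<close>
  define C where "C t = (exp (K t) - 1) / 2" for t
  have C: "((\<lambda>t. b * C t) has_real_derivative b * (G t * exp (K t))) (at t)" for b t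
    unfolding C_def by (auto intro!: derivative_eq_intros K)
  have C0: "b * C 0 = 0" for b by (simp add: C_def K0)
  have CE: "C \<bar>t\<bar> \<le> E t / 2" for t by (simp add: C_def E_def)
  define h where "h v t = f t (y0 + E t *\<^sub>R apply_bcontfun v t)" for v t
  have ch: "continuous_on UNIV (h v)" for v
  proof -
    have "continuous_on UNIV (\<lambda>t. (t, y0 + E t *\<^sub>R apply_bcontfun v t))"
      by (intro continuous_intros cE continuous_on_apply_bcontfun)
    from continuous_on_compose2[OF cont this] show ?thesis by (simp add: h_def[abs_def])
  qed
  obtain J where J0: "\<And>v. J v 0 = 0" and J: "\<And>v t. (J v has_vector_derivative h v t) (at t)"
    using antiderivative_UNIV_exists[OF ch, of 0] by metis
  have Jb: "norm (J v x) \<le> (1 + norm v) * (E x / 2)" for v x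
  proof -
    have "norm (J v x) \<le> (1 + norm v) * C \<bar>x\<bar>"
    proof (rule norm_le_of_derivative_bound_symmetric[OF J J0 C C0])
      fix t
      have "norm (h v t) \<le> norm (f t y0) + norm (h v t - f t y0)"
        using norm_triangle_ineq[of "f t y0" "h v t - f t y0"] by simp
      also have "\<dots> \<le> g t + g t * (E t * norm v)"
        unfolding h_def
        by (intro add_mono bnd order_trans[OF lip] mult_left_mono g0)
           (use Epos[of t] norm_bounded in \<open>auto intro!: mult_left_mono\<close>)
      also have "\<dots> \<le> g t * E t * (1 + norm v)"
        using mult_right_mono[OF E1[of t] g0[of t]] by (simp add: algebra_simps)
      also have "\<dots> \<le> G \<bar>t\<bar> * E t * (1 + norm v)"
        using gG[of t] Epos[of t] by (intro mult_right_mono) auto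
      finally show "norm (h v t) \<le> (1 + norm v) * (G \<bar>t\<bar> * exp (K \<bar>t\<bar>))"
        by (simp add: E_def mult_ac)
    qed
    also have "\<dots> \<le> (1 + norm v) * (E x / 2)" by (intro mult_left_mono CE) auto
    finally show ?thesis .
  qed
  have Jd: "norm (J v x - J u x) \<le> dist v u * (E x / 2)" for v u x
  proof -
    have "norm (J v x - J u x) \<le> dist v u * C \<bar>x\<bar>"
    proof (rule norm_le_of_derivative_bound_symmetric[of "\<lambda>x. J v x - J u x" "\<lambda>x. h v x - h u x", OF _ _ C C0])
      show "((\<lambda>x. J v x - J u x) has_vector_derivative h v t - h u t) (at t)" for t
        by (intro derivative_intros J)
      fix t
      have "norm (h v t - h u t) \<le> g t * norm (E t *\<^sub>R (apply_bcontfun v t - apply_bcontfun u t))"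
        unfolding h_def by (rule order_trans[OF lip]) (simp add: algebra_simps)
      also have "\<dots> = g t * E t * dist (apply_bcontfun v t) (apply_bcontfun u t)"
        using Epos[of t] by (simp add: dist_norm)
      also have "\<dots> \<le> G \<bar>t\<bar> * E t * dist v u"
        using gG[of t] Epos[of t] G0 by (intro mult_mono dist_bounded) auto
      finally show "norm (h v t - h u t) \<le> dist v u * (G \<bar>t\<bar> * exp (K \<bar>t\<bar>))"
        by (simp add: E_def mult_ac)
    qed (simp add: J0)
    also have "\<dots> \<le> dist v u * (E x / 2)" by (intro mult_left_mono CE) auto
    finally show ?thesis .
  qed
  define \<Phi> where "\<Phi> v = Bcontfun (\<lambda>x. (1 / E x) *\<^sub>R J v x)" for v
  have mem: "(\<lambda>x. (1 / E x) *\<^sub>R J v x) \<in> bcontfun" for v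
  proof (rule bcontfun_normI)
    show "continuous_on UNIV (\<lambda>x. (1 / E x) *\<^sub>R J v x)"
      using Epos J by (intro continuous_intros cE) (auto simp: less_imp_neq[THEN not_sym]
        intro!: continuous_at_imp_continuous_on has_vector_derivative_continuous)
    show "norm ((1 / E x) *\<^sub>R J v x) \<le> (1 + norm v) / 2" for x
      using Jb[of v x] Epos[of x] by (simp add: field_simps)
  qed
  have ap: "apply_bcontfun (\<Phi> v) x = (1 / E x) *\<^sub>R J v x" for v x
    unfolding \<Phi>_def by (simp add: Bcontfun_inverse mem)
  have "dist (\<Phi> v) (\<Phi> u) \<le> 1/2 * dist v u" for v u
  proof (rule dist_bound)
    fix x
    have "norm ((1 / E x) *\<^sub>R J v x - (1 / E x) *\<^sub>R J u x) = norm ((1 / E x) *\<^sub>R (J v x - J u x))"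
      by (simp add: algebra_simps)
    also have "\<dots> = norm (J v x - J u x) / E x"
      using Epos[of x] by simp
    also have "\<dots> \<le> 1/2 * dist v u"
      using Jd[of v x u] Epos[of x] by (simp add: field_simps)
    finally show "dist (apply_bcontfun (\<Phi> v) x) (apply_bcontfun (\<Phi> u) x) \<le> 1/2 * dist v u"
      by (simp add: ap dist_norm)
  qed
  then have "\<exists>!v. \<Phi> v = v"
    by (intro banach_fix_type[of "1/2"]) auto
  then obtain v where v: "\<Phi> v = v" by blast
  define y where "y t = y0 + J v t" for t
  have "E t *\<^sub>R apply_bcontfun v t = J v t" for t
    using ap[of v t] Epos[of t] by (simp add: v)
  then have "h v t = f t (y t)" for t by (simp add: h_def y_def)
  then have "(y has_vector_derivative f t (y t)) (at t)" for t
    unfolding y_def using J[of v t] by (auto intro!: derivative_eq_intros simp: y_def)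
  moreover have "y 0 = y0" by (simp add: y_def J0)
  ultimately show ?thesis by blast
qed

theorem ivp_exists:
  fixes f :: "real \<Rightarrow> 'a::banach \<Rightarrow> 'a" and g :: "real \<Rightarrow> real"
  assumes cont: "continuous_on UNIV (\<lambda>(t, y). f t y)"
    and cg: "continuous_on UNIV g"
    and lip: "\<And>t y z. norm (f t y - f t z) \<le> g t * norm (y - z)"
  shows "\<exists>y. y a = y0 \<and> (\<forall>t. (y has_vector_derivative f t (y t)) (at t))"
proof -
  define F where "F t y = f (t + a) y" for t y
  \<comment> \<open>The second summand supplies the bound at the initial value that
    \<open>ivp_exists_at_zero\<close> asks for; a larger Lipschitz bound is harmless.\<close>
  define k where "k t = \<bar>g (t + a)\<bar> + norm (F t y0)" for t
  have cF: "continuous_on UNIV (\<lambda>(t, y). F t y)"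
    using continuous_on_compose2[OF cont, of UNIV "\<lambda>x. (fst x + a, snd x)"]
    by (simp add: F_def case_prod_unfold continuous_on_fst continuous_on_snd continuous_on_add continuous_on_Pair)
  have "continuous_on UNIV (\<lambda>t. (\<lambda>(t, y). F t y) (t, y0))"
    by (rule continuous_on_compose2[OF cF]) (auto intro!: continuous_intros)
  then have ck: "continuous_on UNIV k"
    unfolding k_def by (intro continuous_intros continuous_on_compose2[OF cg]) auto
  have "norm (F t y - F t z) \<le> k t * norm (y - z)" for t y z
    unfolding F_def by (rule order_trans[OF lip mult_right_mono]) (auto simp: k_def add.commute[of "\<bar>_\<bar>"] intro: add_increasing)
  moreover have "norm (F t y0) \<le> k t" for t by (simp add: k_def)
  ultimately obtain y where y: "y 0 = y0" "\<And>t. (y has_vector_derivative F t (y t)) (at t)"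
    using ivp_exists_at_zero[OF cF ck] by blast
  have "((\<lambda>t. y (t - a)) has_vector_derivative f t (y (t - a))) (at t)" for t
    using vector_diff_chain_at[of "\<lambda>t. t - a" 1 t y "F (t - a) (y (t - a))"] y(2)[of "t - a"]
      has_vector_derivative_diff_const[of "\<lambda>t. t" a 1 "at t", THEN iffD2] has_vector_derivative_id
    by (simp add: o_def F_def)
  then show ?thesis using y(1) by (intro exI[of _ "\<lambda>t. y (t - a)"]) auto
qed

theorem second_order_ivp_exists:
  fixes f :: "real \<Rightarrow> real \<Rightarrow> real" and g :: "real \<Rightarrow> real"
  assumes cont: "continuous_on UNIV (\<lambda>(t, y). f t y)"
    and cg: "continuous_on UNIV g"
    and lip: "\<And>t y z. \<bar>f t y - f t z\<bar> \<le> g t * \<bar>y - z\<bar>"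
  obtains u u' where "u a = A" "u' a = B"
    "\<And>t. (u has_real_derivative u' t) (at t)"
    "\<And>t. (u' has_real_derivative f t (u t)) (at t)"
proof -
  define F where "F t Y = (snd Y, f t (fst Y))" for t and Y :: "real \<times> real"
  have "continuous_on UNIV (\<lambda>Y. (\<lambda>(t, y). f t y) (fst Y, fst (snd Y)))"
    by (rule continuous_on_compose2[OF cont]) (intro continuous_intros, simp)
  then have cF: "continuous_on UNIV (\<lambda>(t, Y). F t Y)"
    unfolding F_def case_prod_unfold by (intro continuous_intros) simp
  have "norm (F t Y - F t Z) \<le> (1 + \<bar>g t\<bar>) * norm (Y - Z)" for t Y Z
  proof -
    have "norm (F t Y - F t Z) \<le> \<bar>snd (Y - Z)\<bar> + \<bar>f t (fst Y) - f t (fst Z)\<bar>"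
      using norm_Pair_le[of "snd (Y - Z)" "f t (fst Y) - f t (fst Z)"] by (simp add: F_def)
    also have "\<dots> \<le> \<bar>snd (Y - Z)\<bar> + \<bar>g t\<bar> * \<bar>fst (Y - Z)\<bar>"
      using order_trans[OF lip[of t "fst Y" "fst Z"] mult_right_mono[OF abs_ge_self]] by simp
    also have "\<dots> \<le> norm (Y - Z) + \<bar>g t\<bar> * norm (Y - Z)"
      using norm_fst_le[of "fst (Y - Z)" "snd (Y - Z)"] norm_snd_le[of "snd (Y - Z)" "fst (Y - Z)"]
      by (intro add_mono mult_left_mono) (simp_all only: prod.collapse real_norm_def abs_ge_zero)
    finally show ?thesis by (simp add: algebra_simps)
  qed
  then obtain y where y: "y a = (A, B)" "\<And>t. (y has_vector_derivative F t (y t)) (at t)"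
    using ivp_exists[OF cF, of "\<lambda>t. 1 + \<bar>g t\<bar>" a "(A, B)"] continuous_on_add[OF continuous_on_const continuous_on_rabs[OF cg]]
    by metis
  have "((\<lambda>t. fst (y t)) has_vector_derivative fst (F t (y t))) (at t)"
       "((\<lambda>t. snd (y t)) has_vector_derivative snd (F t (y t))) (at t)" for t
    by (rule bounded_linear.has_vector_derivative[OF bounded_linear_fst y(2)]
             bounded_linear.has_vector_derivative[OF bounded_linear_snd y(2)])+
  then show ?thesis
    using that[of "\<lambda>t. fst (y t)" "\<lambda>t. snd (y t)"] y(1)
    by (auto simp: F_def has_real_derivative_iff_has_vector_derivative)
qed

section \<open>Gronwall estimates for second order equations\<close>

lemma continuous_on_Icc_bounded:
  fixes f :: "real \<Rightarrow> real"
  assumes "continuous_on {a..b} f"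
  obtains M where "M \<ge> 0" "\<And>x. x \<in> {a..b} \<Longrightarrow> \<bar>f x\<bar> \<le> M"
proof -
  have "bounded (f ` {a..b})"
    using assms by (simp add: compact_continuous_image compact_imp_bounded)
  then obtain M where "\<forall>y\<in>f ` {a..b}. norm y \<le> M" by (auto simp: bounded_iff)
  then show ?thesis using that[of "max M 0"] by (metis image_eqI max.cobounded2 max.coboundedI1 real_norm_def)
qed

text \<open>The energy \<open>E = d^2 + p^2\<close> satisfies
  \<open>E' \<le> (2 + L) * E + \<epsilon>^2\<close>, by the inequality between arithmetic and
  geometric mean; the exponential factor turns this into monotonicity of \<open>\<Phi>\<close>. The
  inhomogeneity \<open>\<epsilon>\<close> later carries changes of parameters.\<close>

lemma second_order_gronwall_forward:
  fixes d p r :: "real \<Rightarrow> real"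
  assumes ab: "a \<le> b" and L: "L \<ge> 0"
    and d: "\<And>x. x \<in> {a..b} \<Longrightarrow> (d has_real_derivative p x) (at x)"
    and p: "\<And>x. x \<in> {a..b} \<Longrightarrow> (p has_real_derivative r x) (at x)"
    and r: "\<And>x. x \<in> {a..b} \<Longrightarrow> \<bar>r x\<bar> \<le> L * \<bar>d x\<bar> + \<epsilon>"
  shows "(d b)\<^sup>2 + (p b)\<^sup>2 \<le> ((d a)\<^sup>2 + (p a)\<^sup>2 + \<epsilon>\<^sup>2 * (b - a)) * exp ((2 + L) * (b - a))"
proof -
  define E where "E x = (d x)\<^sup>2 + (p x)\<^sup>2" for x
  define \<Phi> where "\<Phi> x = E x * exp (- (2 + L) * (x - a)) - \<epsilon>\<^sup>2 * (x - a)" for x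
  have "\<exists>y. (\<Phi> has_real_derivative y) (at x) \<and> y \<le> 0" if "a \<le> x" "x \<le> b" for x
  proof (intro exI conjI)
    have x: "x \<in> {a..b}" using that by simp
    let ?e = "exp (- (2 + L) * (x - a))"
    show "(\<Phi> has_real_derivative
        (2 * d x * p x + 2 * p x * r x - (2 + L) * E x) * ?e - \<epsilon>\<^sup>2) (at x)"
      unfolding \<Phi>_def E_def
      by (rule derivative_eq_intros d[OF x] p[OF x] refl | simp)+ (simp add: algebra_simps)
    have "2 * p x * r x \<le> 2 * \<bar>p x\<bar> * (L * \<bar>d x\<bar> + \<epsilon>)"
    proof -
      have "2 * p x * r x \<le> 2 * \<bar>p x\<bar> * \<bar>r x\<bar>"
        using abs_ge_self[of "p x * r x"] by (simp add: abs_mult)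
      also have "\<dots> \<le> 2 * \<bar>p x\<bar> * (L * \<bar>d x\<bar> + \<epsilon>)"
        by (intro mult_left_mono r x) auto
      finally show ?thesis .
    qed
    moreover have "2 * \<bar>p x\<bar> * \<epsilon> \<le> (p x)\<^sup>2 + \<epsilon>\<^sup>2"
      using zero_le_power2[of "\<bar>p x\<bar> - \<epsilon>"] by (simp add: power2_diff)
    moreover have dp: "2 * \<bar>d x\<bar> * \<bar>p x\<bar> \<le> E x"
      using zero_le_power2[of "\<bar>p x\<bar> - \<bar>d x\<bar>"] by (simp add: power2_diff E_def algebra_simps)
    moreover have "L * (2 * \<bar>d x\<bar> * \<bar>p x\<bar>) \<le> L * E x"
      by (intro mult_left_mono dp L)
    moreover have "2 * d x * p x \<le> 2 * \<bar>d x\<bar> * \<bar>p x\<bar>"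
      using abs_ge_self[of "d x * p x"] by (simp add: abs_mult)
    moreover have "(p x)\<^sup>2 \<le> E x" by (simp add: E_def)
    ultimately have "2 * d x * p x + 2 * p x * r x - (2 + L) * E x \<le> \<epsilon>\<^sup>2"
      by (simp add: algebra_simps)
    then have "(2 * d x * p x + 2 * p x * r x - (2 + L) * E x) * ?e \<le> \<epsilon>\<^sup>2 * ?e"
      by (intro mult_right_mono) auto
    also have "\<dots> \<le> \<epsilon>\<^sup>2 * 1"
      using that L by (intro mult_left_mono) (auto simp: mult_nonneg_nonneg mult_nonpos_nonneg)
    finally show "(2 * d x * p x + 2 * p x * r x - (2 + L) * E x) * ?e - \<epsilon>\<^sup>2 \<le> 0" by simp
  qed
  from DERIV_nonpos_imp_nonincreasing[OF ab this]
  have "E b * exp (- (2 + L) * (b - a)) \<le> E a + \<epsilon>\<^sup>2 * (b - a)" by (simp add: \<Phi>_def)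
  then have "E b * exp (- (2 + L) * (b - a)) * exp ((2 + L) * (b - a)) \<le> (E a + \<epsilon>\<^sup>2 * (b - a)) * exp ((2 + L) * (b - a))"
    by (intro mult_right_mono) auto
  moreover have "exp (- (2 + L) * (b - a)) * exp ((2 + L) * (b - a)) = 1"
    by (simp add: exp_add[symmetric] algebra_simps)
  ultimately show ?thesis by (simp only: E_def mult.assoc mult_1_right)
qed

lemma second_order_gronwall:
  fixes d p r :: "real \<Rightarrow> real"
  assumes L: "L \<ge> 0"
    and d: "\<And>x. x \<in> closed_segment a b \<Longrightarrow> (d has_real_derivative p x) (at x)"
    and p: "\<And>x. x \<in> closed_segment a b \<Longrightarrow> (p has_real_derivative r x) (at x)"
    and r: "\<And>x. x \<in> closed_segment a b \<Longrightarrow> \<bar>r x\<bar> \<le> L * \<bar>d x\<bar> + \<epsilon>"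
  shows "(d b)\<^sup>2 + (p b)\<^sup>2 \<le> ((d a)\<^sup>2 + (p a)\<^sup>2 + \<epsilon>\<^sup>2 * \<bar>b - a\<bar>) * exp ((2 + L) * \<bar>b - a\<bar>)"
proof (cases "a \<le> b")
  case True
  then show ?thesis
    using second_order_gronwall_forward[OF True L, of d p r \<epsilon>] d p r
    by (simp add: closed_segment_eq_real_ivl)
next
  case False
  have "((\<lambda>x. d (- x)) has_real_derivative - p (- x)) (at x)"
       "((\<lambda>x. - p (- x)) has_real_derivative r (- x)) (at x)"
       "\<bar>r (- x)\<bar> \<le> L * \<bar>d (- x)\<bar> + \<epsilon>" if "x \<in> {- a..- b}" for x
  proof -
    have x: "- x \<in> closed_segment a b" using that False by (auto simp: closed_segment_eq_real_ivl)
    show "((\<lambda>x. d (- x)) has_real_derivative - p (- x)) (at x)"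
      using d[OF x] by (simp only: DERIV_mirror)
    show "((\<lambda>x. - p (- x)) has_real_derivative r (- x)) (at x)"
      using DERIV_minus[OF p[OF x, unfolded DERIV_mirror]] by simp
    show "\<bar>r (- x)\<bar> \<le> L * \<bar>d (- x)\<bar> + \<epsilon>" by (rule r[OF x])
  qed
  from second_order_gronwall_forward[OF _ L this, of "- a" "- b"] False show ?thesis by simp
qed

lemma second_order_zero:
  fixes d p r :: "real \<Rightarrow> real"
  assumes "\<And>x. x \<in> closed_segment a b \<Longrightarrow> (d has_real_derivative p x) (at x)"
    and "\<And>x. x \<in> closed_segment a b \<Longrightarrow> (p has_real_derivative r x) (at x)"
    and "\<And>x. x \<in> closed_segment a b \<Longrightarrow> \<bar>r x\<bar> \<le> L * \<bar>d x\<bar>"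
    and "L \<ge> 0" "d a = 0" "p a = 0"
  shows "d b = 0" "p b = 0"
proof -
  have "(d b)\<^sup>2 + (p b)\<^sup>2 \<le> 0"
    using second_order_gronwall[of L a b d p r 0] assms by auto
  then show "d b = 0" "p b = 0" by (auto simp: sum_power2_le_zero_iff)
qed

section \<open>Linear equations and Sturm comparison\<close>

text \<open>Derivatives are two-sided at every point of \<open>S\<close>, so on a closed interval
  the solution must extend past the end points. Dirichlet functions are therefore handled on the
  open interval.\<close>

definition solves_linear :: "(real \<Rightarrow> real) \<Rightarrow> (real \<Rightarrow> real) \<Rightarrow> (real \<Rightarrow> real) \<Rightarrow> real set \<Rightarrow> bool" where
  "solves_linear q y y' S \<longleftrightarrow>
     (\<forall>x\<in>S. (y has_real_derivative y' x) (at x) \<and> (y' has_real_derivative - (q x * y x)) (at x))"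

lemma solves_linear_subset: "solves_linear q y y' S \<Longrightarrow> T \<subseteq> S \<Longrightarrow> solves_linear q y y' T"
  by (auto simp: solves_linear_def)

lemma solves_linearD:
  assumes "solves_linear q y y' S" "x \<in> S"
  shows "(y has_real_derivative y' x) (at x)" "(y' has_real_derivative - (q x * y x)) (at x)"
  using assms by (auto simp: solves_linear_def)

lemma solves_linear_continuous:
  assumes "solves_linear q y y' S"
  shows "continuous_on S y" "continuous_on S y'"
  using assms by (auto intro!: continuous_at_imp_continuous_on DERIV_isCont dest: solves_linearD)

lemma solves_linear_lincomb:
  assumes "solves_linear q y y' S" "solves_linear q z z' S"
  shows "solves_linear q (\<lambda>x. a * y x + b * z x) (\<lambda>x. a * y' x + b * z' x) S"
  unfolding solves_linear_def
  by (auto intro!: derivative_eq_intros solves_linearD[OF assms(1)] solves_linearD[OF assms(2)] simp: algebra_simps)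

lemma solves_linear_scale:
  assumes "solves_linear q y y' ((\<lambda>x. c * x) ` S)"
  shows "solves_linear (\<lambda>x. c\<^sup>2 * q (c * x)) (\<lambda>x. y (c * x)) (\<lambda>x. c * y' (c * x)) S"
  unfolding solves_linear_def
proof (intro ballI conjI)
  fix x assume x: "x \<in> S"
  have c: "((\<lambda>x. c * x) has_real_derivative c) (at x)" by (auto intro!: derivative_eq_intros)
  note y = solves_linearD[OF assms imageI[OF x]]
  show "((\<lambda>x. y (c * x)) has_real_derivative c * y' (c * x)) (at x)"
    using DERIV_chain2[OF y(1) c] by (simp add: mult.commute)
  show "((\<lambda>x. c * y' (c * x)) has_real_derivative - (c\<^sup>2 * q (c * x) * y (c * x))) (at x)"
    using DERIV_cmult[OF DERIV_chain2[OF y(2) c], of c] by (simp add: power2_eq_square mult_ac)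
qed

lemma solves_linear_zero:
  assumes sol: "solves_linear q y y' (closed_segment a b)"
    and cq: "continuous_on UNIV q" and "y a = 0" "y' a = 0"
  shows "y b = 0" "y' b = 0"
proof -
  obtain M where M: "M \<ge> 0" "\<And>x. x \<in> closed_segment a b \<Longrightarrow> \<bar>q x\<bar> \<le> M"
    using continuous_on_Icc_bounded[of "min a b" "max a b" q] continuous_on_subset[OF cq]
    by (metis closed_segment_eq_real_ivl max_def min_def nle_le subset_UNIV)
  have "\<bar>- (q x * y x)\<bar> \<le> M * \<bar>y x\<bar>" if "x \<in> closed_segment a b" for x
    using M(2)[OF that] by (simp add: abs_mult mult_right_mono)
  from second_order_zero[OF solves_linearD[OF sol] this M(1) assms(3,4)]
  show "y b = 0" "y' b = 0" by auto
qed

lemma solves_linear_unique: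
  assumes y: "solves_linear q y y' (closed_segment a b)" and z: "solves_linear q z z' (closed_segment a b)"
    and cq: "continuous_on UNIV q" and eq: "y a = z a" "y' a = z' a"
  shows "y b = z b" "y' b = z' b"
  using solves_linear_zero[OF solves_linear_lincomb[OF y z, of 1 "-1"] cq] eq by auto

definition linear_ivp :: "(real \<Rightarrow> real) \<Rightarrow> real \<Rightarrow> real \<Rightarrow> (real \<Rightarrow> real) \<times> (real \<Rightarrow> real)" where
  "linear_ivp q A B = (SOME Y. solves_linear q (fst Y) (snd Y) UNIV \<and> fst Y 0 = A \<and> snd Y 0 = B)"

lemma linear_ivp:
  assumes "continuous_on UNIV q"
  shows "solves_linear q (fst (linear_ivp q A B)) (snd (linear_ivp q A B)) UNIV"
    and "fst (linear_ivp q A B) 0 = A" "snd (linear_ivp q A B) 0 = B"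
proof -
  have "continuous_on UNIV (\<lambda>x. q (fst x))"
    by (rule continuous_on_compose2[OF assms continuous_on_fst[OF continuous_on_id]]) simp
  then have "continuous_on UNIV (\<lambda>(t, y). - (q t * y))"
    unfolding case_prod_unfold by (intro continuous_intros) auto
  then obtain u u' where u: "u 0 = A" "u' 0 = B"
    "\<And>t. (u has_real_derivative u' t) (at t)"
    "\<And>t. (u' has_real_derivative - (q t * u t)) (at t)"
    by (rule second_order_ivp_exists[OF _ continuous_on_rabs[OF assms], where A = A and B = B and a = 0])
       (auto simp: abs_mult[symmetric] algebra_simps)
  then have "\<exists>Y. solves_linear q (fst Y) (snd Y) UNIV \<and> fst Y 0 = A \<and> snd Y 0 = B"
    by (intro exI[of _ "(u, u')"]) (simp add: solves_linear_def)
  from someI_ex[OF this]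
  show "solves_linear q (fst (linear_ivp q A B)) (snd (linear_ivp q A B)) UNIV"
    and "fst (linear_ivp q A B) 0 = A" "snd (linear_ivp q A B) 0 = B"
    by (auto simp: linear_ivp_def)
qed

text \<open>The conditions on \<open>A\<close> and \<open>B\<close> cover the even data (1, 0) and
  the odd data (0, 1) at once; for \<open>A = 0\<close> positivity comes from the slope.\<close>

lemma pos_near_zero:
  fixes y y' :: "real \<Rightarrow> real"
  assumes y: "(y has_real_derivative B) (at 0)" and A: "y 0 = A" "A \<ge> 0" "B \<ge> 0" "A + B > 0"
  obtains \<delta> where "\<delta> > 0" "\<And>t. 0 < t \<Longrightarrow> t < \<delta> \<Longrightarrow> y t > 0"
proof (cases "A = 0")
  case True
  then obtain \<delta> where "\<delta> > 0" "\<forall>h>0. h < \<delta> \<longrightarrow> y 0 < y (0 + h)"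
    using DERIV_pos_inc_right[OF y] A by auto
  then show ?thesis using that[of \<delta>] A True by auto
next
  case False
  then have "y 0 > 0" using A by simp
  then obtain \<delta> where "\<delta> > 0" "\<forall>t. dist t 0 < \<delta> \<longrightarrow> y t > 0"
    using DERIV_isCont[OF y] order_tendstoD(1)[of y "y 0" "at 0" 0]
    by (auto simp: isCont_def eventually_at) (metis \<open>y 0 > 0\<close> dist_commute)
  then show ?thesis using that[of \<delta>] by (auto simp: dist_real_def)
qed

lemma pos_until_nonzero:
  fixes y :: "real \<Rightarrow> real"
  assumes cont: "continuous_on {0..b} y" and \<delta>: "\<delta> > 0" "\<And>t. 0 < t \<Longrightarrow> t < \<delta> \<Longrightarrow> y t > 0"
    and nz: "\<And>t. 0 < t \<Longrightarrow> t < c \<Longrightarrow> y t \<noteq> 0" and t: "0 < t" "t < c" "t \<le> b"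
  shows "y t > 0"
proof (rule ccontr)
  assume "\<not> y t > 0"
  then have yt: "y t \<le> 0" by simp
  define s where "s = min (\<delta> / 2) t"
  have s: "0 < s" "s < \<delta>" "s \<le> t" using \<delta> t by (auto simp: s_def)
  have "\<exists>x\<ge>s. x \<le> t \<and> y x = 0"
    by (rule IVT2'[of y t 0 s]) (use yt \<delta>(2)[OF s(1,2)] s t continuous_on_subset[OF cont, of "{s..t}"] in auto)
  then show False using nz s t by force
qed

lemma first_zero:
  fixes y :: "real \<Rightarrow> real"
  assumes cont: "continuous_on {0..b} y" and \<delta>: "\<delta> > 0" "\<And>t. 0 < t \<Longrightarrow> t < \<delta> \<Longrightarrow> y t > 0"
    and b: "0 < b" "y b = 0"
  obtains c where "0 < c" "c \<le> b" "y c = 0" "\<And>t. 0 < t \<Longrightarrow> t < c \<Longrightarrow> y t > 0"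
proof -
  \<comment> \<open>All zeros in \<open>(0, b]\<close> lie in \<open>[\<delta>, b]\<close>. Starting
    at \<open>\<delta>\<close> excludes 0, a zero of odd solutions, and makes the set
    compact.\<close>
  define S where "S = {t \<in> {\<delta>..b}. y t \<in> {0}}"
  have db: "\<delta> \<le> b" using \<delta>(2)[of b] b by force
  have "closed S" unfolding S_def
    by (rule continuous_closed_preimage[simplified vimage_def Int_def, simplified])
       (use continuous_on_subset[OF cont, of "{\<delta>..b}"] \<delta> in auto)
  then have "compact S"
    unfolding compact_eq_bounded_closed
    by (auto intro: bounded_subset[OF bounded_closed_interval[of \<delta> b]] simp: S_def)
  moreover have "b \<in> S" using b db by (simp add: S_def)
  ultimately obtain c where c: "c \<in> S" "\<And>t. t \<in> S \<Longrightarrow> c \<le> t"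
    using compact_attains_inf[of S] by blast
  have "y t \<noteq> 0" if "0 < t" "t < c" for t
    using that c(1) c(2)[of t] \<delta>(2)[of t] by (cases "t < \<delta>") (auto simp: S_def)
  then have "y t > 0" if "0 < t" "t < c" for t
    using pos_until_nonzero[OF cont \<delta>, of c t] that c(1) by (auto simp: S_def)
  then show ?thesis using that[of c] c \<delta> by (auto simp: S_def)
qed

text \<open>If \<open>y2\<close> had no zero, the Wronskian \<open>y1 y2' - y1' y2\<close> would
  start at 0, because the data agree, and end negative at the first zero \<open>c\<close> of
  \<open>y1\<close>; but there it equals \<open>- y1' c * y2 c\<close>, which is
  nonnegative.\<close>

lemma sturm_comparison:
  assumes y1: "solves_linear q1 y1 y1' {0..b}" and y2: "solves_linear q2 y2 y2' {0..b}"
    and data: "y1 0 = A" "y1' 0 = B" "y2 0 = A" "y2' 0 = B" "A \<ge> 0" "B \<ge> 0" "A + B > 0"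
    and less: "\<And>t. 0 < t \<Longrightarrow> t < b \<Longrightarrow> q1 t < q2 t"
    and b: "0 < b" "y1 b = 0"
  obtains t where "0 < t" "t < b" "y2 t = 0"
proof (rule ccontr)
  assume "\<not> thesis"
  then have nz: "\<And>t. 0 < t \<Longrightarrow> t < b \<Longrightarrow> y2 t \<noteq> 0" using that by blast
  have z: "0 \<in> {0..b}" using b by simp
  have d: "(y1 has_real_derivative B) (at 0)" "(y2 has_real_derivative B) (at 0)"
    using solves_linearD(1)[OF y1 z] solves_linearD(1)[OF y2 z] data by auto
  obtain \<delta>1 where \<delta>1: "\<delta>1 > 0" "\<And>t. 0 < t \<Longrightarrow> t < \<delta>1 \<Longrightarrow> y1 t > 0"
    using pos_near_zero[OF d(1)] data by metis
  obtain \<delta>2 where \<delta>2: "\<delta>2 > 0" "\<And>t. 0 < t \<Longrightarrow> t < \<delta>2 \<Longrightarrow> y2 t > 0"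
    using pos_near_zero[OF d(2)] data by metis
  obtain c where c: "0 < c" "c \<le> b" "y1 c = 0" "\<And>t. 0 < t \<Longrightarrow> t < c \<Longrightarrow> y1 t > 0"
    using first_zero[OF solves_linear_continuous(1)[OF y1] \<delta>1 b] by metis
  have y2pos: "y2 t > 0" if "0 < t" "t < b" for t
    using pos_until_nonzero[OF solves_linear_continuous(1)[OF y2] \<delta>2 nz that] that by auto
  have y2c: "y2 c \<ge> 0"
  proof (rule ccontr)
    assume "\<not> y2 c \<ge> 0"
    moreover have "y2 (c / 2) > 0" using y2pos c by auto
    moreover have "continuous_on {c/2..c} y2"
      using c by (intro continuous_on_subset[OF solves_linear_continuous(1)[OF y2]]) auto
    ultimately obtain x where "c/2 \<le> x" "x \<le> c" "y2 x = 0"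
      using IVT2'[of y2 c 0 "c/2"] c by auto
    with \<open>\<not> y2 c \<ge> 0\<close> nz[of x] c show False by (cases "x = c") auto
  qed
  have cb: "c \<in> {0..b}" using c by auto
  have y1c: "y1' c \<le> 0"
  proof (rule ccontr)
    assume "\<not> y1' c \<le> 0"
    then obtain e where e: "e > 0" "\<forall>h>0. h < e \<longrightarrow> y1 (c - h) < y1 c"
      using DERIV_pos_inc_left[OF solves_linearD(1)[OF y1 cb]] by auto
    define h where "h = min (e/2) (c/2)"
    have "0 < h" "h < e" "h < c" using e c by (auto simp: h_def)
    then show False using e(2)[rule_format, of h] c(3) c(4)[of "c - h"] by auto
  qed
  define W where "W t = y1 t * y2' t - y1' t * y2 t" for t
  have W: "(W has_real_derivative (q1 t - q2 t) * y1 t * y2 t) (at t)" if "t \<in> {0..b}" for t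
    unfolding W_def using solves_linearD[OF y1 that] solves_linearD[OF y2 that]
    by (auto intro!: derivative_eq_intros simp: algebra_simps)
  obtain x where x: "0 < x" "x < c" "W c - W 0 = (c - 0) * ((q1 x - q2 x) * y1 x * y2 x)"
    using MVT2[OF c(1), of W "\<lambda>t. (q1 t - q2 t) * y1 t * y2 t"] W c by force
  have "(q1 x - q2 x) * (y1 x * y2 x) < 0"
    using less[of x] c(4)[OF x(1,2)] y2pos[of x] x c by (intro mult_neg_pos) auto
  from mult_pos_neg[OF c(1) this] have "W c < W 0" using x(3) by (simp add: mult.assoc)
  moreover have "W 0 = 0" by (simp add: W_def data)
  moreover have "W c \<ge> 0" using y1c y2c c by (simp add: W_def mult_nonpos_nonneg)
  ultimately show False by simp
qed

section \<open>Dependence of zeros on the spectral parameter\<close>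

lemma continuous_add_const: "continuous_on UNIV q \<Longrightarrow> continuous_on UNIV (\<lambda>t. q t + \<nu>)" for q :: "real \<Rightarrow> real"
  by (intro continuous_intros)

context
  fixes q :: "real \<Rightarrow> real" and A B :: real
  assumes cq: "continuous_on UNIV q" and AB: "A \<ge> 0" "B \<ge> 0" "A + B > 0"
begin

private definition "Y \<nu> = fst (linear_ivp (\<lambda>t. q t + \<nu>) A B)"
private definition "Y' \<nu> = snd (linear_ivp (\<lambda>t. q t + \<nu>) A B)"

private lemma Y: "solves_linear (\<lambda>t. q t + \<nu>) (Y \<nu>) (Y' \<nu>) S" "Y \<nu> 0 = A" "Y' \<nu> 0 = B"
  using linear_ivp[OF continuous_add_const[OF cq], of \<nu> A B]
  by (auto simp: Y_def Y'_def intro: solves_linear_subset)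

private lemma Y_comparison:
  assumes "\<nu>1 < \<nu>2" "0 < \<eta>" "Y \<nu>1 \<eta> = 0"
  obtains t where "0 < t" "t < \<eta>" "Y \<nu>2 t = 0"
  by (rule sturm_comparison[OF Y(1)[of \<nu>1] Y(1)[of \<nu>2], where b = \<eta> and A = A and B = B])
    (use assms AB in \<open>auto simp: Y\<close>)

text \<open>A zero at \<open>\<eta>\<close> for \<open>\<nu> < 0\<close> would force one of the
  solution for parameter 0 strictly before \<open>\<eta>\<close>. Only the open interval is
  inspected, so the degenerate case, where \<open>\<eta>\<close> itself is that zero, is
  included.\<close>

lemma no_zero_of_smaller_parameter:
  assumes "\<nu> < 0" "0 < \<eta>" "\<And>t. 0 < t \<Longrightarrow> t < \<eta> \<Longrightarrow> fst (linear_ivp q A B) t \<noteq> 0"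
  shows "fst (linear_ivp (\<lambda>t. q t + \<nu>) A B) \<eta> \<noteq> 0"
  using Y_comparison[of \<nu> 0 \<eta>] assms by (auto simp: Y_def)

text \<open>If two parameters \<open>\<nu>1 < \<nu>2 < 0\<close> had a zero at \<open>\<eta>\<close>, comparison would push a zero \<open>t2\<close> of the second
  solution beyond \<open>\<tau>\<close>; Picone's identity on \<open>[t2, \<eta>]\<close> then gives a common zero of that solution
  and its derivative.\<close>

lemma zero_parameter_unique:
  assumes \<nu>: "\<nu>1 < \<nu>2" "\<nu>2 < 0" and "0 < \<eta>"
    and nz: "\<And>t. 0 < t \<Longrightarrow> t \<le> \<eta> \<Longrightarrow> t \<noteq> \<tau> \<Longrightarrow> fst (linear_ivp q A B) t \<noteq> 0"
    and z1: "fst (linear_ivp (\<lambda>t. q t + \<nu>1) A B) \<eta> = 0"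
    and z2: "fst (linear_ivp (\<lambda>t. q t + \<nu>2) A B) \<eta> = 0"
  shows False
proof -
  obtain t2 where t2: "0 < t2" "t2 < \<eta>" "Y \<nu>2 t2 = 0"
    using Y_comparison[OF \<nu>(1) \<open>0 < \<eta>\<close>] z1 by (auto simp: Y_def)
  obtain t0 where t0: "0 < t0" "t0 < t2" "Y 0 t0 = 0"
    using Y_comparison[OF \<nu>(2) t2(1,3)] by blast
  have nz': "Y 0 t \<noteq> 0" if "0 < t" "t \<le> \<eta>" "t \<noteq> \<tau>" for t
    using nz[OF that] by (simp add: Y_def)
  have "t0 = \<tau>" using nz'[of t0] t0 t2 by auto
  then have u: "Y 0 t \<noteq> 0" if "t2 \<le> t" "t \<le> \<eta>" for t
    using nz'[of t] t0 t2 that by auto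
  note dy = solves_linearD[OF Y(1)[of \<nu>2 UNIV], simplified]
  note du = solves_linearD[OF Y(1)[of 0 UNIV], simplified]
  \<comment> \<open>The zero \<open>t0 = \<tau>\<close> lies before \<open>t2\<close>, so division
    by \<open>Y 0\<close> is allowed on \<open>[t2, \<eta>]\<close>. As \<open>\<nu>2 < 0\<close>,
    the derivative of \<open>R\<close> is a sum of two nonnegative terms, while \<open>R\<close>
    vanishes with \<open>Y \<nu>2\<close> at both ends.\<close>
  define W where "W t = Y' \<nu>2 t * Y 0 t - Y \<nu>2 t * Y' 0 t" for t
  define R where "R t = Y \<nu>2 t * W t / Y 0 t" for t
  have dR: "(R has_real_derivative (W t / Y 0 t)\<^sup>2 - \<nu>2 * (Y \<nu>2 t)\<^sup>2) (at t)" if "t2 \<le> t" "t \<le> \<eta>" for t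
    unfolding R_def W_def
    by (rule derivative_eq_intros dy du u[OF that] refl)+
       (use u[OF that] in \<open>simp add: field_simps power2_eq_square\<close>)
  obtain x where x: "t2 < x" "x < \<eta>" "R \<eta> - R t2 = (\<eta> - t2) * ((W x / Y 0 x)\<^sup>2 - \<nu>2 * (Y \<nu>2 x)\<^sup>2)"
    using MVT2[OF t2(2) dR] by blast
  have "R \<eta> = 0" "R t2 = 0" using z2 t2 by (auto simp: R_def Y_def)
  then have "(W x / Y 0 x)\<^sup>2 + (- \<nu>2) * (Y \<nu>2 x)\<^sup>2 = 0" using x by auto
  moreover have "(- \<nu>2) * (Y \<nu>2 x)\<^sup>2 \<ge> 0" using \<nu>(2) by (intro mult_nonneg_nonneg) auto
  ultimately have *: "(W x / Y 0 x)\<^sup>2 = 0" "(- \<nu>2) * (Y \<nu>2 x)\<^sup>2 = 0"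
    using zero_le_power2[of "W x / Y 0 x"] by linarith+
  then have y0: "Y \<nu>2 x = 0" using \<nu>(2) by simp
  then have y1: "Y' \<nu>2 x = 0" using *(1) u[of x] x by (simp add: W_def)
  have "Y \<nu>2 0 = 0" "Y' \<nu>2 0 = 0"
    using solves_linear_zero[OF Y(1) continuous_add_const[OF cq] y0 y1, of 0] by auto
  then show False using AB Y(2,3)[of \<nu>2] by linarith
qed

private lemma Y_continuous:
  assumes "0 < \<eta>"
  shows "isCont (\<lambda>\<nu>. Y \<nu> \<eta>) \<nu>0"
proof -
  obtain L0 where L0: "L0 \<ge> 0" "\<And>x. x \<in> {0..\<eta>} \<Longrightarrow> \<bar>q x\<bar> \<le> L0"
    using continuous_on_Icc_bounded[of 0 \<eta> q] continuous_on_subset[OF cq] by (metis subset_UNIV)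
  obtain M where M: "M \<ge> 0" "\<And>x. x \<in> {0..\<eta>} \<Longrightarrow> \<bar>Y \<nu>0 x\<bar> \<le> M"
    using continuous_on_Icc_bounded[of 0 \<eta> "Y \<nu>0"] solves_linear_continuous(1)[OF Y(1)] by metis
  \<comment> \<open>Bounds \<open>\<bar>q x + \<nu>\<bar>\<close> whenever
    \<open>\<bar>\<nu> - \<nu>0\<bar> < 1\<close>; the change of parameter enters Gronwall as an
    inhomogeneity of size \<open>\<bar>\<nu> - \<nu>0\<bar> * M\<close>.\<close>
  define L where "L = L0 + \<bar>\<nu>0\<bar> + 1"
  define C where "C = sqrt (M\<^sup>2 * \<eta> * exp ((2 + L) * \<eta>))"
  have bound: "\<bar>Y \<nu> \<eta> - Y \<nu>0 \<eta>\<bar> \<le> C * \<bar>\<nu> - \<nu>0\<bar>" if "\<bar>\<nu> - \<nu>0\<bar> < 1" for \<nu>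
  proof -
    note dy = solves_linearD[OF Y(1)[of \<nu> UNIV], simplified]
    note du = solves_linearD[OF Y(1)[of \<nu>0 UNIV], simplified]
    have "(Y \<nu> \<eta> - Y \<nu>0 \<eta>)\<^sup>2 + (Y' \<nu> \<eta> - Y' \<nu>0 \<eta>)\<^sup>2
        \<le> ((Y \<nu> 0 - Y \<nu>0 0)\<^sup>2 + (Y' \<nu> 0 - Y' \<nu>0 0)\<^sup>2 + (\<bar>\<nu> - \<nu>0\<bar> * M)\<^sup>2 * (\<eta> - 0)) * exp ((2 + L) * (\<eta> - 0))"
    proof (rule second_order_gronwall_forward[of 0 \<eta> L "\<lambda>x. Y \<nu> x - Y \<nu>0 x" "\<lambda>x. Y' \<nu> x - Y' \<nu>0 x"
          "\<lambda>x. - ((q x + \<nu>) * Y \<nu> x) + (q x + \<nu>0) * Y \<nu>0 x"])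
      fix x assume x: "x \<in> {0..\<eta>}"
      show "((\<lambda>x. Y \<nu> x - Y \<nu>0 x) has_real_derivative Y' \<nu> x - Y' \<nu>0 x) (at x)"
        by (intro derivative_intros dy du)
      show "((\<lambda>x. Y' \<nu> x - Y' \<nu>0 x) has_real_derivative - ((q x + \<nu>) * Y \<nu> x) + (q x + \<nu>0) * Y \<nu>0 x) (at x)"
        using DERIV_diff[OF dy(2)[of x] du(2)[of x]] by simp
      have "- ((q x + \<nu>) * Y \<nu> x) + (q x + \<nu>0) * Y \<nu>0 x
          = - ((q x + \<nu>) * (Y \<nu> x - Y \<nu>0 x)) - (\<nu> - \<nu>0) * Y \<nu>0 x"
        by (simp add: algebra_simps)
      also have "\<bar>\<dots>\<bar> \<le> \<bar>q x + \<nu>\<bar> * \<bar>Y \<nu> x - Y \<nu>0 x\<bar> + \<bar>\<nu> - \<nu>0\<bar> * \<bar>Y \<nu>0 x\<bar>"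
        unfolding abs_mult[symmetric] by linarith
      also have "\<dots> \<le> L * \<bar>Y \<nu> x - Y \<nu>0 x\<bar> + \<bar>\<nu> - \<nu>0\<bar> * M"
        using L0(2)[OF x] M(2)[OF x] that unfolding L_def
        by (intro add_mono mult_right_mono mult_left_mono) auto
      finally show "\<bar>- ((q x + \<nu>) * Y \<nu> x) + (q x + \<nu>0) * Y \<nu>0 x\<bar>
          \<le> L * \<bar>Y \<nu> x - Y \<nu>0 x\<bar> + \<bar>\<nu> - \<nu>0\<bar> * M" .
    qed (use assms L0 in \<open>auto simp: L_def\<close>)
    also have "\<dots> = (C * \<bar>\<nu> - \<nu>0\<bar>)\<^sup>2"
      using assms by (simp add: Y C_def power_mult_distrib)
    finally have "(Y \<nu> \<eta> - Y \<nu>0 \<eta>)\<^sup>2 \<le> (C * \<bar>\<nu> - \<nu>0\<bar>)\<^sup>2"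
      using zero_le_power2[of "Y' \<nu> \<eta> - Y' \<nu>0 \<eta>"] by linarith
    then show ?thesis
      using assms by (subst (asm) abs_le_square_iff[symmetric]) (simp add: abs_mult C_def)
  qed
  have "((\<lambda>\<nu>. Y \<nu> \<eta> - Y \<nu>0 \<eta>) \<longlongrightarrow> 0) (at \<nu>0)"
  proof (rule Lim_null_comparison)
    show "\<forall>\<^sub>F \<nu> in at \<nu>0. norm (Y \<nu> \<eta> - Y \<nu>0 \<eta>) \<le> C * \<bar>\<nu> - \<nu>0\<bar>"
      using bound by (auto simp: eventually_at dist_real_def intro!: exI[of _ 1])
    show "((\<lambda>\<nu>. C * \<bar>\<nu> - \<nu>0\<bar>) \<longlongrightarrow> 0) (at \<nu>0)"
      by (auto intro!: tendsto_eq_intros)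
  qed
  then show ?thesis by (simp add: isCont_def LIM_zero_iff)
qed

text \<open>Intermediate values in the parameter. For \<open>\<nu>\<close> so negative that
  \<open>q + \<nu> < 0\<close>, comparison with \<open>A + B * t\<close>, a solution for potential
  0, shows that the solution keeps its positive sign; for parameter 0 the end value is
  negative.\<close>

lemma zero_parameter_exists:
  assumes "0 < \<eta>" "fst (linear_ivp q A B) \<eta> < 0"
  shows "\<exists>\<nu><0. fst (linear_ivp (\<lambda>t. q t + \<nu>) A B) \<eta> = 0"
proof -
  obtain L0 where L0: "L0 \<ge> 0" "\<And>x. x \<in> {0..\<eta>} \<Longrightarrow> \<bar>q x\<bar> \<le> L0"
    using continuous_on_Icc_bounded[of 0 \<eta> q] continuous_on_subset[OF cq] by (metis subset_UNIV)
  define \<nu>0 where "\<nu>0 = - (L0 + 1)"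
  have nz: "Y \<nu>0 t \<noteq> 0" if t: "0 < t" "t \<le> \<eta>" for t
  proof
    assume z: "Y \<nu>0 t = 0"
    have "solves_linear (\<lambda>_. 0) (\<lambda>t. A + B * t) (\<lambda>_. B) {0..t}"
      unfolding solves_linear_def by (auto intro!: derivative_eq_intros)
    from sturm_comparison[OF Y(1) this Y(2,3) _ _ AB _ t(1) z]
    obtain s where s: "0 < s" "A + B * s = 0"
    proof (atomize_elim, goal_cases)
      case 1
      have "q x + \<nu>0 < 0" if "0 < x" "x < t" for x
        using L0(2)[of x] that t by (auto simp: \<nu>0_def)
      with 1 show ?case by auto
    qed
    then show False using AB by (metis add.right_neutral add_nonneg_eq_0_iff less_le mult_eq_0_iff mult_nonneg_nonneg)
  qed
  note Y0 = solves_linearD(1)[OF Y(1)[of \<nu>0 UNIV], of 0, simplified Y, simplified]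
  obtain \<delta> where \<delta>: "\<delta> > 0" "\<And>t. 0 < t \<Longrightarrow> t < \<delta> \<Longrightarrow> Y \<nu>0 t > 0"
    using pos_near_zero[OF Y0 Y(2) AB] by blast
  have "Y \<nu>0 \<eta> \<ge> 0"
  proof (rule ccontr)
    assume "\<not> Y \<nu>0 \<eta> \<ge> 0"
    moreover define s where "s = min (\<delta>/2) \<eta>"
    moreover have "0 < s" "s < \<delta>" "s \<le> \<eta>" using \<delta> assms by (auto simp: s_def)
    ultimately obtain x where "s \<le> x" "x \<le> \<eta>" "Y \<nu>0 x = 0"
      using IVT2'[of "Y \<nu>0" \<eta> 0 s] \<delta>(2)[of s] solves_linear_continuous(1)[OF Y(1)] by fastforce
    then show False using nz \<open>0 < s\<close> by auto
  qed
  moreover have "Y 0 \<eta> \<le> 0" using assms by (simp add: Y_def)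
  moreover have "continuous_on {\<nu>0..0} (\<lambda>\<nu>. Y \<nu> \<eta>)"
    using Y_continuous[OF assms(1)] by (intro continuous_at_imp_continuous_on) auto
  ultimately obtain \<nu> where \<nu>: "\<nu>0 \<le> \<nu>" "\<nu> \<le> 0" "Y \<nu> \<eta> = 0"
    using IVT2'[of "\<lambda>\<nu>. Y \<nu> \<eta>" 0 0 \<nu>0] L0 by (auto simp: \<nu>0_def)
  have "\<nu> \<noteq> 0" using \<nu> assms by (auto simp: Y_def)
  then show ?thesis using \<nu> by (intro exI[of _ \<nu>]) (auto simp: Y_def)
qed

end

section \<open>The Korman solution and its linearization\<close>

lemma exp_min_lipschitz:
  fixes x y M :: real
  shows "\<bar>exp (min x M) - exp (min y M)\<bar> \<le> exp M * \<bar>x - y\<bar>"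
proof -
  have *: "exp a - exp b \<le> exp M * (a - b)" if ba: "b \<le> a" "a \<le> M" for a b
  proof (cases "a = b")
    case False
    then obtain c where "b < c" "c < a" "exp a - exp b = (a - b) * exp c"
      using MVT2[of b a exp exp, OF _ DERIV_exp] ba by force
    then show ?thesis using ba by (simp add: mult.commute mult_right_mono)
  qed simp
  have "\<bar>exp (min x M) - exp (min y M)\<bar> \<le> exp M * \<bar>min x M - min y M\<bar>"
    using *[of "min x M" "min y M"] *[of "min y M" "min x M"]
    by (cases "min x M \<le> min y M") (auto simp: abs_if not_le algebra_simps)
  also have "\<dots> \<le> exp M * \<bar>x - y\<bar>" by (intro mult_left_mono) (auto simp: min_def)
  finally show ?thesis .
qed

lemma exp_lipschitz: "x \<le> M \<Longrightarrow> y \<le> M \<Longrightarrow> \<bar>exp x - exp y\<bar> \<le> exp M * \<bar>x - y\<bar>" for x y M :: real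
  using exp_min_lipschitz[of x M y] by (simp add: min_def)

text \<open>The weight \<open>\<bar>t\<bar> powr l\<close> vanishes at 0, so derivatives such as
  that of \<open>w'\<close> have one exceptional zero; the interval is split there.\<close>

lemma strict_decreasing_if_DERIV_neg_except_zero:
  fixes f :: "real \<Rightarrow> real"
  assumes f: "\<And>x. (f has_real_derivative f' x) (at x)" and neg: "\<And>x. x \<noteq> 0 \<Longrightarrow> f' x < 0"
    and ab: "a < b"
  shows "f b < f a"
proof -
  have *: "f b < f a" if ab: "a < b" "\<And>x. a < x \<Longrightarrow> x < b \<Longrightarrow> x \<noteq> 0" for a b
  proof -
    obtain x where "a < x" "x < b" "f b - f a = (b - a) * f' x"
      using MVT2[of a b f f', OF ab(1) f] by blast
    then show ?thesis using neg[of x] ab mult_pos_neg[of "b - a" "f' x"] by auto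
  qed
  show ?thesis
  proof (cases "a < 0 \<and> 0 < b")
    case True
    then show ?thesis using *[of a 0] *[of 0 b] by force
  next
    case False
    then show ?thesis using *[OF ab] by force
  qed
qed

lemma continuous_on_abs_powr: "l > 0 \<Longrightarrow> continuous_on S (\<lambda>t. \<bar>t\<bar> powr l)" for l :: real
  by (intro continuous_on_powr' continuous_intros) auto

lemma abs_powr_le_1: "x \<in> {-1..1} \<Longrightarrow> l > 0 \<Longrightarrow> \<bar>x\<bar> powr l \<le> 1" for x l :: real
  by (rule powr_le1) auto

text \<open>Truncating the exponential makes the equation globally Lipschitz; concavity keeps the solutions
  of interest below the truncation level.\<close>

lemma truncated_liouville_exists:
  fixes l lam M :: real
  assumes "l > 0" "lam \<ge> 0"
  obtains u u' where "u a = A" "u' a = B"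
    "\<And>t. (u has_real_derivative u' t) (at t)"
    "\<And>t. (u' has_real_derivative - (lam * \<bar>t\<bar> powr l * exp (min (u t) M))) (at t)"
proof -
  have "continuous_on UNIV (\<lambda>x::real\<times>real. \<bar>fst x\<bar> powr l)"
    by (rule continuous_on_compose2[OF continuous_on_abs_powr[OF assms(1), of UNIV] continuous_on_fst[OF continuous_on_id]]) simp
  then have c: "continuous_on UNIV (\<lambda>(t, y). - (lam * \<bar>t\<bar> powr l * exp (min y M)))"
    unfolding case_prod_unfold
    by (intro continuous_on_minus continuous_on_mult continuous_on_exp continuous_on_min continuous_on_snd
        continuous_on_const continuous_on_id)
  have g: "continuous_on UNIV (\<lambda>t. lam * \<bar>t\<bar> powr l * exp M)"
    using assms by (intro continuous_intros continuous_on_abs_powr)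
  have lip: "\<bar>- (lam * \<bar>t\<bar> powr l * exp (min y M)) - - (lam * \<bar>t\<bar> powr l * exp (min z M))\<bar>
      \<le> lam * \<bar>t\<bar> powr l * exp M * \<bar>y - z\<bar>" for t y z
  proof -
    have "\<bar>- (lam * \<bar>t\<bar> powr l * exp (min y M)) - - (lam * \<bar>t\<bar> powr l * exp (min z M))\<bar>
        = \<bar>lam * \<bar>t\<bar> powr l * (exp (min z M) - exp (min y M))\<bar>"
      by (simp add: algebra_simps)
    also have "\<dots> = lam * \<bar>t\<bar> powr l * \<bar>exp (min y M) - exp (min z M)\<bar>"
      using assms by (simp add: abs_mult abs_minus_commute)
    also have "\<dots> \<le> lam * \<bar>t\<bar> powr l * (exp M * \<bar>y - z\<bar>)"
      using assms by (intro mult_left_mono exp_min_lipschitz) auto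
    finally show ?thesis by (simp add: mult.assoc)
  qed
  show ?thesis
    by (rule second_order_ivp_exists[OF c g lip, where a = a and A = A and B = B]) (use that in blast)
qed

text \<open>\<open>w\<close> is taken on the whole line with the even weight, so that all
  derivatives are two-sided; \<open>korman_w_eq\<close> ties it to \<open>korman_w\<close> on the
  half-line.\<close>

locale korman =
  fixes l :: real and w w' :: "real \<Rightarrow> real"
  assumes l_pos: "l > 0"
    and w_0: "w 0 = 0" and w'_0: "w' 0 = 0"
    and DERIV_w: "\<And>t. (w has_real_derivative w' t) (at t)"
    and DERIV_w': "\<And>t. (w' has_real_derivative - (\<bar>t\<bar> powr l * exp (w t))) (at t)"

text \<open>Truncation at level 0 is invisible: \<open>w'\<close> strictly decreases and
  \<open>w' 0 = 0\<close>, hence \<open>w \<le> 0\<close> everywhere.\<close>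

lemma korman_exists:
  fixes l :: real
  assumes "l > 0"
  obtains w w' where "korman l w w'"
proof -
  obtain w w' :: "real \<Rightarrow> real" where w: "w 0 = 0" "w' 0 = 0"
    "\<And>t. (w has_real_derivative w' t) (at t)"
    "\<And>t. (w' has_real_derivative - (1 * \<bar>t\<bar> powr l * exp (min (w t) 0))) (at t)"
    using truncated_liouville_exists[OF assms, of 1 0 0 0 0] by (metis zero_le_one)
  have dec: "w' b < w' a" if "a < b" for a b
    by (rule strict_decreasing_if_DERIV_neg_except_zero[OF w(4) _ that]) simp
  have "w t \<le> 0" for t
  proof (cases t "0::real" rule: linorder_cases)
    case equal then show ?thesis using w by simp
  next
    case less
    then obtain x where "t < x" "x < 0" "w 0 - w t = (0 - t) * w' x"
      using MVT2[of t 0 w w'] w by blast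
    then show ?thesis using dec[of x 0] w mult_nonneg_nonneg[of "0 - t" "w' x"] by auto
  next
    case greater
    then obtain x where "0 < x" "x < t" "w t - w 0 = (t - 0) * w' x"
      using MVT2[of 0 t w w'] w by blast
    then show ?thesis using dec[of 0 x] w mult_nonneg_nonpos[of "t - 0" "w' x"] by auto
  qed
  then show ?thesis using w assms by (intro that[of w w']) (unfold_locales, auto simp: min_def)
qed

context korman
begin

definition V :: "real \<Rightarrow> real" where
  "V t = \<bar>t\<bar> powr l * exp (w t)"

lemma DERIV_w'_V: "(w' has_real_derivative - V t) (at t)"
  using DERIV_w' by (simp add: V_def)

lemma isCont_w: "isCont w t" and isCont_w': "isCont w' t"
  using DERIV_w DERIV_w' by (auto intro: DERIV_isCont)

lemma continuous_on_w: "continuous_on S w" and continuous_on_w': "continuous_on S w'"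
  by (auto intro!: continuous_at_imp_continuous_on isCont_w isCont_w')

lemma V_pos: "t \<noteq> 0 \<Longrightarrow> V t > 0"
  by (simp add: V_def)

lemma V_0: "V 0 = 0"
  by (simp add: V_def)

lemma continuous_on_V: "continuous_on S V"
  unfolding V_def by (intro continuous_intros continuous_on_abs_powr l_pos continuous_on_w)

lemma w'_less: "a < b \<Longrightarrow> w' b < w' a"
  using strict_decreasing_if_DERIV_neg_except_zero[OF DERIV_w'_V] V_pos by force

lemma w'_neg: "t > 0 \<Longrightarrow> w' t < 0" and w'_pos: "t < 0 \<Longrightarrow> w' t > 0"
  using w'_less[of 0 t] w'_less[of t 0] w'_0 by auto

lemma w_less: "0 \<le> a \<Longrightarrow> a < b \<Longrightarrow> w b < w a"
proof -
  assume ab: "0 \<le> a" "a < b"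
  then obtain x where "a < x" "x < b" "w b - w a = (b - a) * w' x"
    using MVT2[of a b w w'] DERIV_w by blast
  then show ?thesis using w'_neg[of x] mult_pos_neg[of "b - a" "w' x"] ab by auto
qed

lemma w_neg: "t > 0 \<Longrightarrow> w t < 0"
  using w_less[of 0 t] w_0 by auto

lemma w_le_0: "w t \<le> 0"
proof (cases "t < 0")
  case True
  then obtain x where "t < x" "x < 0" "w 0 - w t = (0 - t) * w' x"
    using MVT2[of t 0 w w'] DERIV_w by blast
  then show ?thesis using w'_pos[of x] mult_pos_pos[of "0 - t" "w' x"] w_0 by auto
next
  case False
  then show ?thesis using w_neg[of t] w_0 by (cases "t = 0") auto
qed

text \<open>Uniqueness applied to \<open>w (- t) - w t\<close>, which has zero data at 0; below 0
  the exponential has Lipschitz constant 1.\<close>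

lemma w_minus: "w (- t) = w t" and w'_minus: "w' (- t) = - w' t"
proof -
  have d: "((\<lambda>x. w (- x) - w x) has_real_derivative (- w' (- x) - w' x)) (at x)" for x
    using DERIV_diff[OF DERIV_w[of "- x", unfolded DERIV_mirror] DERIV_w[of x]] .
  have p: "((\<lambda>x. - w' (- x) - w' x) has_real_derivative (- V (- x) + V x)) (at x)" for x
    using DERIV_diff[OF DERIV_minus[OF DERIV_w'_V[of "- x", unfolded DERIV_mirror]] DERIV_w'_V[of x]] by simp
  obtain C where C: "C \<ge> 0" "\<And>x. x \<in> {-\<bar>t\<bar>..\<bar>t\<bar>} \<Longrightarrow> \<bar>\<bar>x\<bar> powr l\<bar> \<le> C"
    using continuous_on_Icc_bounded[OF continuous_on_abs_powr[OF l_pos]] by metis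
  have r: "\<bar>- V (- x) + V x\<bar> \<le> C * \<bar>w (- x) - w x\<bar>" if "x \<in> closed_segment 0 t" for x
  proof -
    have "\<bar>- V (- x) + V x\<bar> = \<bar>\<bar>x\<bar> powr l * (exp (w x) - exp (w (- x)))\<bar>"
      by (simp add: V_def algebra_simps)
    also have "\<dots> = \<bar>x\<bar> powr l * \<bar>exp (w (- x)) - exp (w x)\<bar>"
      by (simp add: abs_mult abs_minus_commute)
    also have "\<dots> \<le> C * (exp 0 * \<bar>w (- x) - w x\<bar>)"
      using C(2)[of x] that C(1)
      by (intro mult_mono exp_lipschitz w_le_0) (auto simp: closed_segment_eq_real_ivl split: if_splits)
    finally show ?thesis by simp
  qed
  have "w (- t) - w t = 0" "- w' (- t) - w' t = 0"
    using second_order_zero[OF d p r C(1)] w_0 w'_0 by auto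
  then show "w (- t) = w t" "w' (- t) = - w' t" by auto
qed

lemma w_abs: "w \<bar>t\<bar> = w t"
  using w_minus by (cases "t \<ge> 0") auto

lemma V_minus: "V (- t) = V t"
  by (simp add: V_def w_minus)

text \<open>\<open>korman_ivp\<close> asks for the equation only at \<open>x > 0\<close> and for a
  one-sided derivative at 0, so continuity of \<open>u'\<close> at 0 is not given. The limit 0 of
  \<open>u'\<close> is recovered first; then Gronwall runs from \<open>e\<close> to
  \<open>x\<close>, and \<open>e\<close> tends to 0.\<close>

lemma korman_ivp_unique:
  assumes "korman_ivp l u" "x \<ge> 0"
  shows "u x = w x"
proof (cases "x = 0")
  case True
  then show ?thesis using assms w_0 by (auto simp: korman_ivp_def)
next
  case False
  then have x: "x > 0" using assms by simp
  obtain u' where du0: "\<And>x. x \<ge> 0 \<Longrightarrow> (u has_real_derivative u' x) (at x within {0..})"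
    and du': "\<And>x. x > 0 \<Longrightarrow> (u' has_real_derivative - (x powr l * exp (u x))) (at x)"
    and u0: "u 0 = 0" "u' 0 = 0"
    using assms by (auto simp: korman_ivp_def)
  have du: "(u has_real_derivative u' x) (at x)" if "x > 0" for x
    using du0[of x] that at_within_interior[of x "{0..}"] by (simp add: interior_real_atLeast)
  have cu: "continuous_on {0..x} u"
    using du0 by (meson DERIV_continuous_on atLeastAtMost_iff atLeast_iff continuous_on_subset subsetI)
  obtain M where M: "M \<ge> 0" "\<And>t. t \<in> {0..x} \<Longrightarrow> \<bar>u t\<bar> \<le> M"
    using continuous_on_Icc_bounded[OF cu] by blast
  define K where "K = x powr l * exp M"
  have K: "\<bar>t powr l * exp (u t)\<bar> \<le> K" if "0 < t" "t \<le> x" for t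
    using M(2)[of t] that l_pos unfolding K_def abs_mult by (intro mult_mono) (auto intro: powr_mono2)
  \<comment> \<open>\<open>u e / e\<close> is a value \<open>u' z\<close> with \<open>z\<close> in
    \<open>(0, e)\<close>, and the second derivative is bounded by \<open>K\<close>. The quotient
    itself tends to the one-sided derivative 0.\<close>
  have u'_near: "\<bar>u' e - u e / e\<bar> \<le> K * e" if e: "0 < e" "e < x" for e
  proof -
    have "\<exists>m z. 0 < z \<and> z < e \<and> (u has_real_derivative m) (at z) \<and> u e - u 0 = (e - 0) * m"
      using e du by (intro MVT continuous_on_subset[OF cu]) (auto simp: real_differentiable_def)
    then obtain z where z: "0 < z" "z < e" "u e = e * u' z"
      using du u0 DERIV_unique by fastforce
    obtain y where y: "z < y" "y < e" "u' e - u' z = (e - z) * - (y powr l * exp (u y))"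
      using MVT2[of z e u' "\<lambda>x. - (x powr l * exp (u x))"] du' z by force
    have "\<bar>u' e - u' z\<bar> = (e - z) * \<bar>y powr l * exp (u y)\<bar>"
      using y z by (simp add: abs_mult)
    also have "\<dots> \<le> e * K" using z y e by (intro mult_mono K) auto
    finally show ?thesis using z e by (simp add: mult.commute)
  qed
  have "((\<lambda>e. u e / e) \<longlongrightarrow> 0) (at_right 0)"
    using du0[of 0] u0 by (simp add: has_field_derivative_iff at_within_Ici_at_right)
  moreover have "((\<lambda>e. u' e - u e / e) \<longlongrightarrow> 0) (at_right 0)"
  proof (rule Lim_null_comparison)
    show "\<forall>\<^sub>F e in at_right 0. norm (u' e - u e / e) \<le> K * e"
      using u'_near x by (auto simp: eventually_at_right_field)
    show "((\<lambda>e. K * e) \<longlongrightarrow> 0) (at_right 0)" by (auto intro!: tendsto_eq_intros)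
  qed
  ultimately have lim_u': "(u' \<longlongrightarrow> 0) (at_right 0)"
    using tendsto_add[of "\<lambda>e. u' e - u e / e" 0 "at_right 0" "\<lambda>e. u e / e" 0] by simp
  have lim_u: "(u \<longlongrightarrow> 0) (at_right 0)"
    using DERIV_continuous[OF du0[of 0]] u0 by (simp add: continuous_within at_within_Ici_at_right)
  have lim_w: "(w \<longlongrightarrow> 0) (at_right 0)" "(w' \<longlongrightarrow> 0) (at_right 0)"
    using isCont_w[of 0] isCont_w'[of 0] w_0 w'_0
    by (auto simp: isCont_def intro: filterlim_mono[OF _ order_refl at_le])
  define E where "E e = (u e - w e)\<^sup>2 + (u' e - w' e)\<^sup>2" for e
  have "E x \<le> E e * exp ((2 + K) * x)" if e: "0 < e" "e < x" for e
  proof -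
    have "(u x - w x)\<^sup>2 + (u' x - w' x)\<^sup>2 \<le> ((u e - w e)\<^sup>2 + (u' e - w' e)\<^sup>2 + 0\<^sup>2 * (x - e)) * exp ((2 + K) * (x - e))"
    proof (rule second_order_gronwall_forward[of e x K "\<lambda>x. u x - w x" "\<lambda>x. u' x - w' x" "\<lambda>x. - (x powr l * exp (u x)) + V x"])
      fix t assume t: "t \<in> {e..x}"
      show "((\<lambda>x. u x - w x) has_real_derivative u' t - w' t) (at t)"
        using t e by (intro DERIV_diff du DERIV_w) auto
      show "((\<lambda>x. u' x - w' x) has_real_derivative - (t powr l * exp (u t)) + V t) (at t)"
        using DERIV_diff[OF du'[of t] DERIV_w'_V[of t]] t e by simp
      have "\<bar>- (t powr l * exp (u t)) + V t\<bar> = \<bar>t powr l * (exp (w t) - exp (u t))\<bar>"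
        using t e by (simp add: V_def algebra_simps)
      also have "\<dots> = t powr l * \<bar>exp (u t) - exp (w t)\<bar>"
        by (simp add: abs_mult abs_minus_commute)
      also have "\<dots> \<le> x powr l * (exp M * \<bar>u t - w t\<bar>)"
        using t e M(2)[of t] l_pos w_le_0[of t] M(1) by (intro mult_mono exp_lipschitz powr_mono2) auto
      finally show "\<bar>- (t powr l * exp (u t)) + V t\<bar> \<le> K * \<bar>u t - w t\<bar> + 0"
        by (simp add: K_def mult.assoc)
    qed (use e in \<open>auto simp: K_def\<close>)
    also have "\<dots> \<le> E e * exp ((2 + K) * x)"
      using e by (auto simp: E_def K_def intro!: mult_left_mono)
    finally show ?thesis by (simp add: E_def)
  qed
  then have "\<forall>\<^sub>F e in at_right 0. E x \<le> E e * exp ((2 + K) * x)"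
    using x by (auto simp: eventually_at_right_field)
  moreover have "((\<lambda>e. E e * exp ((2 + K) * x)) \<longlongrightarrow> 0) (at_right 0)"
    unfolding E_def by (auto intro!: tendsto_eq_intros lim_u lim_u' lim_w)
  ultimately have "E x \<le> 0"
    by (intro tendsto_lowerbound[OF _ _ trivial_limit_at_right_real]) auto
  then show ?thesis by (simp add: E_def sum_power2_le_zero_iff)
qed

lemma korman_w_eq: "x \<ge> 0 \<Longrightarrow> korman_w l x = w x"
proof -
  let ?P = "\<lambda>u. u \<in> extensional {0..} \<and> korman_ivp l u"
  let ?w = "restrict w {0..}"
  have "korman_ivp l ?w"
    unfolding korman_ivp_def
  proof (intro exI[of _ w'] conjI allI impI)
    show "(?w has_real_derivative w' x) (at x within {0..})" if "x \<ge> 0" for x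
      by (rule has_field_derivative_transform_within[OF has_field_derivative_at_within[OF DERIV_w], of 1])
         (use that in auto)
    show "(w' has_real_derivative - (x powr l * exp (?w x))) (at x)" if "x > 0" for x
      using DERIV_w'[of x] that by simp
  qed (auto simp: w_0 w'_0)
  then have "?P ?w" by auto
  moreover have "u = ?w" if "?P u" for u
    using that korman_ivp_unique[of u] by (intro extensionalityI[of u "{0..}"]) auto
  ultimately have "korman_w l = ?w"
    unfolding korman_w_def by (rule the_equality)
  then show "x \<ge> 0 \<Longrightarrow> korman_w l x = w x" by simp
qed

text \<open>\<open>\<bar>t\<bar> powr l\<close> need not be differentiable at 0, but its product
  with \<open>t\<close> is; this makes \<open>v'\<close> differentiable there.\<close>

lemma DERIV_self_mult_abs_powr: "((\<lambda>t. t * \<bar>t\<bar> powr l) has_real_derivative (l + 1) * \<bar>t\<bar> powr l) (at t)"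
proof -
  let ?g = "\<lambda>t. t * \<bar>t\<bar> powr l"
  have pos: "(?g has_real_derivative (l + 1) * \<bar>t\<bar> powr l) (at t)" if t: "t > 0" for t
  proof -
    have "((\<lambda>t. t powr (l + 1)) has_real_derivative (l + 1) * \<bar>t\<bar> powr l) (at t)"
      using has_real_derivative_powr[OF t, of "l + 1"] t by simp
    then show ?thesis
      by (rule has_field_derivative_transform_within_open[of _ _ _ "{0<..}"])
         (use t in \<open>auto simp: powr_add mult.commute\<close>)
  qed
  show ?thesis
  proof (cases t "0::real" rule: linorder_cases)
    case greater then show ?thesis by (rule pos)
  next
    case less
    have "(?g has_real_derivative (l + 1) * \<bar>- t\<bar> powr l) (at (- t))" using pos[of "- t"] less by simp
    from DERIV_minus[OF this[unfolded DERIV_mirror]] show ?thesis by simp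
  next
    case equal
    have "((\<lambda>y. \<bar>y\<bar> powr l) \<longlongrightarrow> \<bar>0\<bar> powr l) (at (0::real))"
      using continuous_on_abs_powr[OF l_pos, of UNIV] unfolding continuous_on_def by blast
    then have "((\<lambda>y. \<bar>y\<bar> powr l) \<longlongrightarrow> 0) (at (0::real))" by simp
    then have "((\<lambda>y. (?g y - ?g 0) / (y - 0)) \<longlongrightarrow> 0) (at 0)"
      by (rule Lim_transform_eventually) (auto simp: eventually_at intro!: exI[of _ 1])
    then show ?thesis using equal by (simp add: has_field_derivative_iff)
  qed
qed

text \<open>The solution of the linearized equation generated by the scaling invariance
  \<open>w(c t) + (l + 2) ln c\<close> of the Liouville equation\<close>

definition v :: "real \<Rightarrow> real" where "v t = 1 + t * w' t / (l + 2)"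
definition v' :: "real \<Rightarrow> real" where "v' t = (w' t - t * V t) / (l + 2)"

lemma solves_linear_v: "solves_linear V v v' S"
  unfolding solves_linear_def
proof (intro ballI conjI)
  fix t
  show "(v has_real_derivative v' t) (at t)"
    unfolding v_def[abs_def] v'_def
    by (auto intro!: derivative_eq_intros DERIV_w'_V) (use l_pos in \<open>simp add: field_simps\<close>)
  have "((\<lambda>t. t * V t) has_real_derivative V t * (l + 1 + t * w' t)) (at t)"
    using DERIV_mult[OF DERIV_self_mult_abs_powr[of t] DERIV_chain2[OF DERIV_exp DERIV_w[of t]]]
    by (simp add: V_def algebra_simps)
  from DERIV_cdivide[OF DERIV_diff[OF DERIV_w'_V[of t] this], of "l + 2"]
  have "(v' has_real_derivative (- V t - V t * (l + 1 + t * w' t)) / (l + 2)) (at t)"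
    by (simp add: v'_def[abs_def])
  moreover have "(- V t - V t * (l + 1 + t * w' t)) / (l + 2) = - (V t * v t)"
    using l_pos by (simp add: v_def field_simps)
  ultimately show "(v' has_real_derivative - (V t * v t)) (at t)" by simp
qed

lemmas DERIV_v = solves_linearD(1)[OF solves_linear_v UNIV_I]
  and DERIV_v' = solves_linearD(2)[OF solves_linear_v UNIV_I]

lemma v_0: "v 0 = 1" and v'_0: "v' 0 = 0"
  by (auto simp: v_def v'_def w'_0)

lemma v'_neg: "t > 0 \<Longrightarrow> v' t < 0"
proof -
  assume "t > 0"
  then have "w' t - t * V t < 0" using w'_neg[of t] mult_pos_pos[of t "V t"] V_pos[of t] by linarith
  then show "v' t < 0" using l_pos by (simp add: v'_def divide_neg_pos)
qed

lemma v_less: "0 \<le> a \<Longrightarrow> a < b \<Longrightarrow> v b < v a"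
proof -
  assume ab: "0 \<le> a" "a < b"
  then obtain x where "a < x" "x < b" "v b - v a = (b - a) * v' x"
    using MVT2[of a b v v'] DERIV_v by blast
  then show ?thesis using v'_neg[of x] mult_pos_neg[of "b - a" "v' x"] ab by auto
qed

lemma v_zero_exists: "\<exists>t>0. v t = 0"
proof -
  \<comment> \<open>At this point \<open>T * (- w' 1) \<ge> l + 2\<close>, and
    \<open>w' T \<le> w' 1\<close> because \<open>T \<ge> 1\<close>, so \<open>v T\<close> is no
    longer positive.\<close>
  define T where "T = max 1 ((l + 2) / (- w' 1))"
  have w1: "w' 1 < 0" by (rule w'_neg) simp
  have T: "T \<ge> 1" "T \<ge> (l + 2) / (- w' 1)" by (auto simp: T_def)
  have "w' T \<le> w' 1" using w'_less[of 1 T] T by (cases "T = 1") auto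
  then have "T * w' T \<le> T * w' 1" using T by (intro mult_left_mono) auto
  also have "\<dots> \<le> (l + 2) / (- w' 1) * w' 1" using T w1 by (intro mult_right_mono_neg) auto
  also have "\<dots> = - (l + 2)" using w1 by simp
  finally have "v T \<le> 0" using l_pos by (simp add: v_def field_simps)
  then obtain t where "0 \<le> t" "t \<le> T" "v t = 0"
    using IVT2'[of v T 0 0] T v_0 solves_linear_continuous(1)[OF solves_linear_v] by auto
  then show ?thesis using v_0 by (intro exI[of _ t]) (cases "t = 0", auto)
qed

definition \<tau> :: real where "\<tau> = (SOME t. t > 0 \<and> v t = 0)"

lemma \<tau>_pos: "\<tau> > 0" and v_\<tau>: "v \<tau> = 0"
  using someI_ex[OF v_zero_exists] by (auto simp: \<tau>_def)

lemma v_pos: "0 \<le> t \<Longrightarrow> t < \<tau> \<Longrightarrow> v t > 0" and v_neg: "\<tau> < t \<Longrightarrow> v t < 0"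
  using v_less[of t \<tau>] v_less[of \<tau> t] v_\<tau> \<tau>_pos by auto

section \<open>The odd solution \<open>z\<close> and its zero\<close>

definition z :: "real \<Rightarrow> real" where "z = fst (linear_ivp V 0 1)"
definition z' :: "real \<Rightarrow> real" where "z' = snd (linear_ivp V 0 1)"

lemma solves_linear_z: "solves_linear V z z' S" and z_0: "z 0 = 0" and z'_0: "z' 0 = 1"
  using linear_ivp[OF continuous_on_V, of 0 1] by (auto simp: z_def z'_def intro: solves_linear_subset)

lemmas DERIV_z = solves_linearD(1)[OF solves_linear_z UNIV_I]
  and DERIV_z' = solves_linearD(2)[OF solves_linear_z UNIV_I]

lemma linear_ivp_V_1_0: "fst (linear_ivp V 1 0) = v"
proof
  show "fst (linear_ivp V 1 0) t = v t" for t
    using solves_linear_unique(1)[OF solves_linear_subset[OF linear_ivp(1)[OF continuous_on_V, of 1 0] subset_UNIV]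
        solves_linear_v continuous_on_V, of 0 t] linear_ivp(2,3)[OF continuous_on_V, of 1 0] v_0 v'_0
    by simp
qed

lemma wronskian: "v t * z' t - v' t * z t = 1"
proof -
  have "((\<lambda>t. v t * z' t - v' t * z t) has_real_derivative 0) (at t)" for t
    by (rule derivative_eq_intros DERIV_v DERIV_v' DERIV_z DERIV_z' refl)+ (simp add: algebra_simps)
  then have "v t * z' t - v' t * z t = v 0 * z' 0 - v' 0 * z 0"
    using DERIV_isconst_all[of "\<lambda>t. v t * z' t - v' t * z t" t 0] by blast
  then show ?thesis by (simp add: v_0 v'_0 z_0 z'_0)
qed

text \<open>By the Wronskian, \<open>z / v\<close> has derivative \<open>1 / v^2\<close>. Hence
  \<open>z\<close> has at most one zero on an interval where \<open>v\<close> does not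
  vanish.\<close>

lemma z_div_v_less:
  assumes "a < b" "\<And>t. a \<le> t \<Longrightarrow> t \<le> b \<Longrightarrow> v t \<noteq> 0"
  shows "z a / v a < z b / v b"
proof (rule DERIV_pos_imp_increasing[OF assms(1)])
  fix t assume "a \<le> t" "t \<le> b"
  then have nz: "v t \<noteq> 0" by (rule assms)
  have "((\<lambda>t. z t / v t) has_real_derivative (z' t * v t - z t * v' t) / (v t * v t)) (at t)"
    by (rule DERIV_divide[OF DERIV_z DERIV_v nz])
  moreover have "z' t * v t - z t * v' t = 1" using wronskian[of t] by (simp add: mult.commute)
  ultimately show "\<exists>y. ((\<lambda>t. z t / v t) has_real_derivative y) (at t) \<and> 0 < y"
    using nz by (intro exI[of _ "1 / (v t * v t)"]) (auto simp: zero_less_mult_iff)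
qed

text \<open>\<open>z / v\<close> rises from 0 as long as \<open>v > 0\<close>; at
  \<open>\<tau>\<close>, where the quotient breaks down, the Wronskian reads
  \<open>- v' \<tau> * z \<tau> = 1\<close>.\<close>

lemma z_pos_upto_\<tau>: "0 < t \<Longrightarrow> t \<le> \<tau> \<Longrightarrow> z t > 0"
proof (cases "t = \<tau>")
  case True
  then have "- v' t * z t = 1" "- v' t > 0" using wronskian[of t] v_\<tau> v'_neg \<tau>_pos by auto
  then show ?thesis by (metis zero_less_mult_pos zero_less_one)
next
  case False
  assume t: "0 < t" "t \<le> \<tau>"
  have "z 0 / v 0 < z t / v t"
    using t False by (intro z_div_v_less) (auto dest: v_pos)
  then show ?thesis using v_pos[of t] t False by (simp add: z_0 zero_less_divide_iff)
qed

lemma DERIV_V: "t > 0 \<Longrightarrow> (V has_real_derivative l * V t / t + V t * w' t) (at t)"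
proof -
  assume t: "t > 0"
  have "((\<lambda>t. t powr l) has_real_derivative l * t powr (l - 1)) (at t)"
    by (rule has_real_derivative_powr[OF t])
  from DERIV_mult[OF this DERIV_chain2[OF DERIV_exp DERIV_w[of t]]]
  have "((\<lambda>t. t powr l * exp (w t)) has_real_derivative l * V t / t + V t * w' t) (at t)"
    using t by (simp add: V_def powr_diff algebra_simps)
  then show ?thesis
    by (rule has_field_derivative_transform_within_open[of _ _ _ "{0<..}"])
       (use t in \<open>auto simp: V_def\<close>)
qed

text \<open>An almost conserved energy: since \<open>V' = l V / t + V w'\<close>, the sum
  \<open>V + w'^2 / 2\<close> has derivative \<open>l V / t\<close>. Adding \<open>l w'\<close>,
  with derivative \<open>- l V\<close>, makes it nonincreasing for \<open>t \<ge> 1\<close>, and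
  \<open>V > 0\<close> then bounds a quadratic in \<open>w'\<close>.\<close>

lemma w'_bounded_below: "\<exists>Y>0. \<forall>t\<ge>1. - w' t \<le> Y"
proof -
  define H where "H t = V t + (w' t)\<^sup>2 / 2 + l * w' t" for t
  \<comment> \<open>Chosen so that \<open>- w' t > Y\<close> would give
    \<open>- w' t \<ge> 2\<close> and
    \<open>(- w' t) / 2 - l \<ge> (\<bar>H 1\<bar> + 2) / 2\<close>, with a product exceeding
    \<open>H 1\<close>.\<close>
  define Y where "Y = 2 * l + \<bar>H 1\<bar> + 2"
  have "- w' t \<le> Y" if t: "t \<ge> 1" for t
  proof -
    have "H t \<le> H 1"
    proof (rule DERIV_nonpos_imp_nonincreasing[OF t])
      fix s :: real assume s: "1 \<le> s" "s \<le> t"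
      have "(H has_real_derivative l * V s / s - l * V s) (at s)"
        unfolding H_def[abs_def]
        by (rule derivative_eq_intros DERIV_V DERIV_w'_V refl | use s in simp)+
      moreover have "l * V s / s \<le> l * V s / 1"
        using s l_pos V_pos[of s] by (intro divide_left_mono) auto
      ultimately show "\<exists>y. (H has_real_derivative y) (at s) \<and> y \<le> 0" by force
    qed
    then have h: "(w' t)\<^sup>2 / 2 + l * w' t \<le> H 1" using V_pos[of t] t by (simp add: H_def)
    show ?thesis
    proof (rule ccontr)
      assume "\<not> - w' t \<le> Y"
      then have y: "- w' t > Y" by simp
      have "2 * ((\<bar>H 1\<bar> + 2) / 2) \<le> (- w' t) * ((- w' t) / 2 - l)"
        using y l_pos by (intro mult_mono) (auto simp: Y_def)
      also have "\<dots> = (w' t)\<^sup>2 / 2 + l * w' t" by (simp add: power2_eq_square algebra_simps)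
      finally show False using h by simp
    qed
  qed
  moreover have "Y > 0" using l_pos by (simp add: Y_def)
  ultimately show ?thesis by blast
qed

text \<open>For \<open>l = 0\<close> the derivative of \<open>w\<close> would be an odd solution without zeros; for \<open>l > 0\<close> it is a strict
  supersolution, which forces \<open>z\<close> to vanish.\<close>

lemma z_zero_exists: "\<exists>t>0. z t = 0"
proof (rule ccontr)
  assume "\<not> (\<exists>t>0. z t = 0)"
  then have nz: "\<And>t. t > 0 \<Longrightarrow> z t \<noteq> 0" by auto
  obtain \<delta> where \<delta>: "\<delta> > 0" "\<And>t. 0 < t \<Longrightarrow> t < \<delta> \<Longrightarrow> z t > 0"
    using pos_near_zero[of z "z' 0" 0] DERIV_z[of 0] z_0 z'_0 by auto
  have zpos: "z t > 0" if "t > 0" for t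
    using pos_until_nonzero[OF solves_linear_continuous(1)[OF solves_linear_z] \<delta>, of "t + 1" t t] nz that by auto
  obtain Y where Y: "Y > 0" "\<And>t. t \<ge> 1 \<Longrightarrow> - w' t \<le> Y" using w'_bounded_below by blast
  \<comment> \<open>Wronskian of \<open>z\<close> with \<open>p = - w'\<close>, positive for
    \<open>t > 0\<close>, for which \<open>p'' + V p = l V / t\<close>. Hence
    \<open>W' = - l z V / t < 0\<close>, starting from \<open>W 0 = 0\<close>.\<close>
  define W where "W t = - (z' t * w' t) - z t * V t" for t
  have dW: "(W has_real_derivative - (l * z t * V t / t)) (at t)" if t: "t > 0" for t
    unfolding W_def[abs_def]
    by (rule derivative_eq_intros DERIV_z DERIV_z' DERIV_w'_V DERIV_V refl t)+ (use t in \<open>simp add: field_simps\<close>)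
  have neg: "- (l * z t * V t / t) < 0" if t: "t > 0" for t
    using t l_pos zpos[OF t] V_pos[of t] by simp
  have "W 1 < W 0"
  proof (rule DERIV_neg_imp_decreasing_open[of 0 1 W])
    show "\<exists>y. (W has_real_derivative y) (at x) \<and> y < 0" if "0 < x" "x < 1" for x
      using dW neg that by blast
    show "continuous_on {0..1} W"
      unfolding W_def[abs_def]
      by (intro continuous_intros continuous_on_w' continuous_on_V solves_linear_continuous[OF solves_linear_z])
  qed simp
  then have W1: "W 1 < 0" by (simp add: W_def w'_0 V_0 z_0)
  define c where "c = - W 1"
  have c: "c > 0" using W1 by (simp add: c_def)
  have W: "W t \<le> - c" if "t \<ge> 1" for t
    using DERIV_nonpos_imp_nonincreasing[OF that, of W] dW neg unfolding c_def
    by (metis less_eq_real_def less_le_trans minus_minus zero_less_one)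
  \<comment> \<open>\<open>z / (- w')\<close> has derivative \<open>W / w'^2\<close>, at most
    \<open>- c / Y^2\<close> for \<open>t \<ge> 1\<close>; so it falls at least linearly and is
    negative at \<open>T\<close> below, against \<open>z > 0\<close>.\<close>
  define h where "h t = z t / (- w' t) + c / Y\<^sup>2 * t" for t
  have dh: "\<exists>y. (h has_real_derivative y) (at t) \<and> y \<le> 0" if t: "t \<ge> 1" for t
  proof (intro exI conjI)
    have wn: "w' t < 0" using t w'_neg by simp
    have "((\<lambda>t. z t / (- w' t)) has_real_derivative W t / (w' t)\<^sup>2) (at t)"
      using DERIV_divide[OF DERIV_z DERIV_minus[OF DERIV_w'_V], of t] wn
      by (simp add: W_def power2_eq_square)
    from DERIV_add[OF this DERIV_cmult_Id[of "c / Y\<^sup>2"]]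
    show "(h has_real_derivative W t / (w' t)\<^sup>2 + c / Y\<^sup>2) (at t)"
      by (simp add: h_def[abs_def])
    have "(w' t)\<^sup>2 \<le> Y\<^sup>2" using Y(2)[OF t] Y(1) wn by (intro abs_le_square_iff[THEN iffD1]) auto
    then have "c / Y\<^sup>2 \<le> c / (w' t)\<^sup>2" using c wn Y(1) by (intro divide_left_mono mult_pos_pos) auto
    moreover have "W t / (w' t)\<^sup>2 \<le> - c / (w' t)\<^sup>2" using W[OF t] by (intro divide_right_mono) auto
    ultimately show "W t / (w' t)\<^sup>2 + c / Y\<^sup>2 \<le> 0" by simp
  qed
  define T where "T = 1 + \<bar>h 1\<bar> / (c / Y\<^sup>2)"
  have cY: "c / Y\<^sup>2 > 0" using c Y by simp
  have T: "T \<ge> 1" unfolding T_def using divide_nonneg_pos[OF abs_ge_zero[of "h 1"] cY] by linarith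
  have "h T \<le> h 1" using DERIV_nonpos_imp_nonincreasing[OF T] dh by blast
  moreover have "k * (1 + a / k) = k + a" if "k > 0" for k a :: real using that by (simp add: field_simps)
  from this[OF cY, of "\<bar>h 1\<bar>"] have "c / Y\<^sup>2 * T = c / Y\<^sup>2 + \<bar>h 1\<bar>" by (simp only: T_def)
  ultimately have "z T / (- w' T) < 0" using cY by (simp add: h_def)
  moreover have "z T / (- w' T) > 0" using zpos[of T] w'_neg[of T] T by (intro divide_pos_pos) auto
  ultimately show False by simp
qed

definition \<zeta> :: real where "\<zeta> = (SOME t. t > 0 \<and> z t = 0)"

lemma \<zeta>_pos: "\<zeta> > 0" and z_\<zeta>: "z \<zeta> = 0"
  using someI_ex[OF z_zero_exists] by (auto simp: \<zeta>_def)

lemma \<tau>_less_\<zeta>: "\<tau> < \<zeta>"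
  using z_pos_upto_\<tau>[of \<zeta>] \<zeta>_pos z_\<zeta> by force

text \<open>Past \<open>\<tau>\<close> the quotient \<open>z / v\<close> increases and
  \<open>v < 0\<close>, so \<open>z\<close> changes sign at \<open>\<zeta>\<close>. With
  \<open>z_pos\<close> this makes the arbitrarily chosen \<open>\<zeta>\<close> the only positive
  zero.\<close>

lemma z_neg: "\<zeta> < t \<Longrightarrow> z t < 0"
proof -
  assume t: "\<zeta> < t"
  have "z \<zeta> / v \<zeta> < z t / v t"
    using t \<tau>_less_\<zeta> by (intro z_div_v_less) (auto intro!: less_imp_neq v_neg)
  then show ?thesis using v_neg[of t] t \<tau>_less_\<zeta> by (simp add: z_\<zeta> zero_less_divide_iff)
qed

lemma z_pos: "0 < t \<Longrightarrow> t < \<zeta> \<Longrightarrow> z t > 0"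
proof (cases "t \<le> \<tau>")
  case False
  assume t: "t < \<zeta>"
  have "z t / v t < z \<zeta> / v \<zeta>"
    using t False by (intro z_div_v_less) (auto intro!: less_imp_neq v_neg)
  then show ?thesis using v_neg[of t] False by (simp add: z_\<zeta> divide_less_0_iff)
qed (use z_pos_upto_\<tau> in auto)

end

section \<open>Turning parameter and Morse index\<close>

lemma solves_linear_reflect:
  assumes "solves_linear q y y' UNIV" and "\<And>t. q (- t) = q t"
  shows "solves_linear q (\<lambda>t. y (- t)) (\<lambda>t. - y' (- t)) S"
  unfolding solves_linear_def
proof (intro ballI conjI)
  fix t
  show "((\<lambda>t. y (- t)) has_real_derivative - y' (- t)) (at t)"
    using solves_linearD(1)[OF assms(1), of "- t"] by (simp add: DERIV_mirror)
  show "((\<lambda>t. - y' (- t)) has_real_derivative - (q t * y (- t))) (at t)"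
    using DERIV_minus[OF solves_linearD(2)[OF assms(1), of "- t", unfolded DERIV_mirror]] assms(2) by simp
qed

lemma linear_ivp_reflect:
  assumes "continuous_on UNIV q" and "\<And>t. q (- t) = q t"
  shows "fst (linear_ivp q A B) (- t) = fst (linear_ivp q A (- B)) t"
  using solves_linear_unique(1)[OF solves_linear_reflect[OF linear_ivp(1)[OF assms(1), of A B] assms(2)]
      solves_linear_subset[OF linear_ivp(1)[OF assms(1), of A "- B"] subset_UNIV] assms(1), of 0 t]
  by (simp add: linear_ivp(2,3)[OF assms(1)])

lemma linear_ivp_uminus:
  assumes "continuous_on UNIV q"
  shows "fst (linear_ivp q (- A) (- B)) t = - fst (linear_ivp q A B) t"
  using solves_linear_unique(1)[OF
      solves_linear_subset[OF linear_ivp(1)[OF assms, of "- A" "- B"] subset_UNIV]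
      solves_linear_lincomb[OF solves_linear_subset[OF linear_ivp(1)[OF assms, of A B] subset_UNIV]
        solves_linear_subset[OF linear_ivp(1)[OF assms, of A B] subset_UNIV], of "- 1" 0] assms, of 0 t]
  by (simp add: linear_ivp(2,3)[OF assms])

text \<open>The Wronskian is 1. So no parameter is even and odd at once, and the two counts add up
  in \<open>morse_index_eq\<close>.\<close>

lemma linear_ivp_no_common_zero:
  assumes "continuous_on UNIV q"
  shows "\<not> (fst (linear_ivp q 1 0) t = 0 \<and> fst (linear_ivp q 0 1) t = 0)"
proof -
  define y y' where "y = fst (linear_ivp q 1 0)" and "y' = snd (linear_ivp q 1 0)"
  define x x' where "x = fst (linear_ivp q 0 1)" and "x' = snd (linear_ivp q 0 1)"
  note dy = solves_linearD[OF linear_ivp(1)[OF assms, of 1 0] UNIV_I, folded y_def y'_def]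
  note dx = solves_linearD[OF linear_ivp(1)[OF assms, of 0 1] UNIV_I, folded x_def x'_def]
  have "((\<lambda>t. y t * x' t - y' t * x t) has_real_derivative 0) (at t)" for t
    by (rule derivative_eq_intros dx dy refl)+ (simp add: algebra_simps)
  then have "y t * x' t - y' t * x t = y 0 * x' 0 - y' 0 * x 0"
    using DERIV_isconst_all[of "\<lambda>t. y t * x' t - y' t * x t" t 0] by blast
  also have "\<dots> = 1" by (simp add: y_def y'_def x_def x'_def linear_ivp(2,3)[OF assms])
  finally show ?thesis unfolding y_def[symmetric] x_def[symmetric] by auto
qed

context korman
begin

section \<open>The parameter \<open>\<eta>\<close> in place of \<open>\<alpha>\<close>\<close>

lemma w_less_iff: "0 \<le> a \<Longrightarrow> 0 \<le> b \<Longrightarrow> w a < w b \<longleftrightarrow> b < a"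
  using w_less[of a b] w_less[of b a] by (cases a b rule: linorder_cases) auto

text \<open>\<open>w\<close> is concave with \<open>w 1 \<le> 0\<close>, and the bound is its
  tangent slope at 1. It gives both the unboundedness of \<open>w\<close> and the exponential decay
  of \<open>\<Lambda>\<close>.\<close>

lemma w_le_linear: "t \<ge> 1 \<Longrightarrow> w t \<le> w' 1 * (t - 1)"
proof (cases "t = 1")
  case False
  assume "t \<ge> 1"
  with False obtain x where x: "1 < x" "x < t" "w t - w 1 = (t - 1) * w' x"
    using MVT2[of 1 t w w'] DERIV_w by force
  have "(t - 1) * w' x \<le> (t - 1) * w' 1" using x w'_less[of 1 x] by (intro mult_left_mono) auto
  then show ?thesis using x(3) w_le_0[of 1] mult.commute[of "w' 1" "t - 1"] by linarith
qed (use w_le_0 in auto)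

lemma w_surj: "\<alpha> > 0 \<Longrightarrow> \<exists>t>0. \<alpha> = - w t"
proof -
  assume \<alpha>: "\<alpha> > 0"
  define T where "T = 1 + \<alpha> / (- w' 1)"
  have w1: "w' 1 < 0" by (rule w'_neg) simp
  have T: "T \<ge> 1" unfolding T_def using divide_pos_pos[of \<alpha> "- w' 1"] w1 \<alpha> by linarith
  have "w' 1 * (T - 1) = - \<alpha>" using w1 by (simp add: T_def)
  then have "w T \<le> - \<alpha>" using w_le_linear[OF T] by simp
  then obtain t where "0 \<le> t" "t \<le> T" "w t = - \<alpha>"
    using IVT2'[of w T "- \<alpha>" 0] T w_0 continuous_on_w \<alpha> by auto
  then show ?thesis using \<alpha> w_0 by (intro exI[of _ t]) (cases "t = 0", auto)
qed

lemma korman_eta_eq: "t \<ge> 0 \<Longrightarrow> korman_eta l (- w t) = t"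
  unfolding korman_eta_def
proof (rule the_inv_into_f_eq)
  show "inj_on (\<lambda>x. - korman_w l x) {0..}"
  proof (rule inj_onI)
    fix a b :: real assume "a \<in> {0..}" "b \<in> {0..}" "- korman_w l a = - korman_w l b"
    then show "a = b"
      using w_less[of a b] w_less[of b a] by (cases a b rule: linorder_cases) (auto simp: korman_w_eq)
  qed
qed (auto simp: korman_w_eq)

lemma w_korman_eta: "\<alpha> > 0 \<Longrightarrow> w (korman_eta l \<alpha>) = - \<alpha>"
  using w_surj[of \<alpha>] korman_eta_eq by force

definition \<Lambda> :: "real \<Rightarrow> real" where "\<Lambda> t = t powr (l + 2) * exp (w t)"

lemma korman_lambda_eq: "t \<ge> 0 \<Longrightarrow> korman_lambda l (- w t) = \<Lambda> t"
  by (simp add: korman_lambda_def korman_eta_eq \<Lambda>_def)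

lemma korman_U_eq: "t \<ge> 0 \<Longrightarrow> korman_U l (- w t) x = w (t * x) - w t"
  using w_abs[of "t * x"] by (simp add: korman_U_def korman_eta_eq korman_w_eq abs_mult)

lemma \<Lambda>_pos: "t > 0 \<Longrightarrow> \<Lambda> t > 0"
  by (simp add: \<Lambda>_def)

text \<open>The logarithmic derivative is \<open>(l + 2) / t + w' t\<close>, that is
  \<open>(l + 2) * v t / t\<close>: the scaling solution \<open>v\<close> also governs where the
  branch turns.\<close>

lemma DERIV_\<Lambda>:
  "t > 0 \<Longrightarrow> (\<Lambda> has_real_derivative (l + 2) * t powr (l + 1) * exp (w t) * v t) (at t)"
proof -
  assume t: "t > 0"
  have "((\<lambda>t. t powr (l + 2)) has_real_derivative (l + 2) * t powr (l + 2 - 1)) (at t)"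
    by (rule has_real_derivative_powr[OF t])
  from DERIV_mult[OF this DERIV_chain2[OF DERIV_exp DERIV_w[of t]]]
  have "(\<Lambda> has_real_derivative
      (l + 2) * t powr (l + 2 - 1) * exp (w t) + exp (w t) * w' t * t powr (l + 2)) (at t)"
    by (simp add: \<Lambda>_def[abs_def])
  moreover have "t powr (l + 2) = t * t powr (l + 1)"
    using powr_mult_base[of t "l + 1"] t by (simp add: add.commute)
  moreover have "l + 2 - 1 = l + 1" by simp
  moreover have "(l + 2) * v t = l + 2 + t * w' t" using l_pos by (simp add: v_def field_simps)
  then have "(l + 2) * t powr (l + 1) * exp (w t) * v t = t powr (l + 1) * exp (w t) * (l + 2 + t * w' t)"
    by (metis mult.assoc mult.commute)
  ultimately show ?thesis by (simp add: algebra_simps)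
qed

lemma DERIV_korman_lambda:
  assumes t: "t > 0"
  shows "(korman_lambda l has_real_derivative
    (l + 2) * t powr (l + 1) * exp (w t) * v t / (- w' t)) (at (- w t))"
proof -
  have wt: "- w t > 0" using w_neg t by simp
  have "isCont (korman_eta l) (- w t)"
    by (rule isCont_inverse_function[of t t "korman_eta l" "\<lambda>x. - w x", OF t])
       (auto simp: korman_eta_eq isCont_w)
  then have "(korman_eta l has_real_derivative inverse (- w' t)) (at (- w t))"
    using w'_neg[OF t] wt t
    by (intro DERIV_inverse_function[where f = "\<lambda>x. - w x" and a = 0 and b = "- w t + 1"])
       (auto simp: korman_eta_eq w_korman_eta intro!: DERIV_minus DERIV_w)
  then have "((\<lambda>\<alpha>. \<Lambda> (korman_eta l \<alpha>)) has_real_derivative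
      ((l + 2) * t powr (l + 1) * exp (w t) * v t) * inverse (- w' t)) (at (- w t))"
    using DERIV_chain2[of \<Lambda> _ "korman_eta l" "- w t", unfolded korman_eta_eq[OF less_imp_le[OF t]], OF DERIV_\<Lambda>[OF t]] by blast
  then have "(korman_lambda l has_real_derivative
      ((l + 2) * t powr (l + 1) * exp (w t) * v t) * inverse (- w' t)) (at (- w t))"
    by (rule has_field_derivative_transform_within_open[of _ _ _ "{0<..}"])
       (use wt in \<open>auto simp: \<Lambda>_def korman_lambda_def w_korman_eta\<close>)
  then show ?thesis by (simp only: divide_inverse)
qed

lemma turning_parameter_eq: "turning_parameter l = - w \<tau>"
proof -
  define c where "c t = (l + 2) * t powr (l + 1) * exp (w t) / (- w' t)" for t
  have c: "c t > 0" if "t > 0" for t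
    unfolding c_def using that l_pos w'_neg[OF that] by (intro divide_pos_pos mult_pos_pos) auto
  have d: "(korman_lambda l has_real_derivative c t * v t) (at (- w t))" if "t > 0" for t
    using DERIV_korman_lambda[OF that] by (simp add: c_def)
  have less: "\<exists>D>0. (korman_lambda l has_real_derivative D) (at \<alpha>)" if \<alpha>: "0 < \<alpha>" "\<alpha> < - w \<tau>" for \<alpha>
  proof -
    obtain t where t: "t > 0" "\<alpha> = - w t" using w_surj \<alpha> by blast
    then have "t < \<tau>" using \<alpha> w_less_iff[of \<tau> t] \<tau>_pos by simp
    then show ?thesis using d[OF t(1)] c[OF t(1)] v_pos[of t] t by (intro exI[of _ "c t * v t"]) auto
  qed
  have greater: "\<exists>D<0. (korman_lambda l has_real_derivative D) (at \<alpha>)" if "\<alpha> > - w \<tau>" for \<alpha>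
  proof -
    have "\<alpha> > 0" using that w_neg[OF \<tau>_pos] by simp
    then obtain t where t: "t > 0" "\<alpha> = - w t" using w_surj by blast
    then have "\<tau> < t" using that w_less_iff[of t \<tau>] \<tau>_pos by simp
    then show ?thesis using d[OF t(1)] c[OF t(1)] v_neg[of t] t
      by (intro exI[of _ "c t * v t"]) (auto intro: mult_pos_neg)
  qed
  show ?thesis
    unfolding turning_parameter_def
  proof (rule the_equality)
    show "- w \<tau> > 0 \<and>
     (\<forall>\<alpha>. 0 < \<alpha> \<and> \<alpha> < - w \<tau> \<longrightarrow> (\<exists>D>0. (korman_lambda l has_real_derivative D) (at \<alpha>))) \<and>
     (korman_lambda l has_real_derivative 0) (at (- w \<tau>)) \<and>
     (\<forall>\<alpha>>- w \<tau>. \<exists>D<0. (korman_lambda l has_real_derivative D) (at \<alpha>))"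
      using less greater d[OF \<tau>_pos] w_neg[OF \<tau>_pos] by (simp add: v_\<tau>)
  next
    fix a assume a: "a > 0 \<and>
     (\<forall>\<alpha>. 0 < \<alpha> \<and> \<alpha> < a \<longrightarrow> (\<exists>D>0. (korman_lambda l has_real_derivative D) (at \<alpha>))) \<and>
     (korman_lambda l has_real_derivative 0) (at a) \<and>
     (\<forall>\<alpha>>a. \<exists>D<0. (korman_lambda l has_real_derivative D) (at \<alpha>))"
    then have "(korman_lambda l has_real_derivative 0) (at a)" by blast
    then show "a = - w \<tau>"
      using less[of a] greater[of a] a
      by (metis DERIV_unique linorder_less_linear order_less_irrefl)
  qed
qed

section \<open>Eigenvalues by parity and the Morse index\<close>

definition even_sol :: "real \<Rightarrow> real \<Rightarrow> real" where
  "even_sol \<nu> = fst (linear_ivp (\<lambda>t. V t + \<nu>) 1 0)"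
definition odd_sol :: "real \<Rightarrow> real \<Rightarrow> real" where
  "odd_sol \<nu> = fst (linear_ivp (\<lambda>t. V t + \<nu>) 0 1)"

lemmas continuous_on_V_add = continuous_add_const[OF continuous_on_V]

lemma even_sol_minus: "even_sol \<nu> (- t) = even_sol \<nu> t"
  unfolding even_sol_def by (subst linear_ivp_reflect[OF continuous_on_V_add]) (auto simp: V_minus)

lemma odd_sol_minus: "odd_sol \<nu> (- t) = - odd_sol \<nu> t"
  unfolding odd_sol_def
  using linear_ivp_reflect[OF continuous_on_V_add, of \<nu> 0 1 t] linear_ivp_uminus[OF continuous_on_V_add, of \<nu> 0 1 t]
  by (simp add: V_minus)

lemma even_sol_0: "even_sol 0 = v" and odd_sol_0: "odd_sol 0 = z"
  by (simp_all add: even_sol_def odd_sol_def linear_ivp_V_1_0 z_def)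

text \<open>The summand \<open>- w \<eta>\<close> of the even solution cancels the factor
  \<open>exp (w \<eta>)\<close> of \<open>\<Lambda>\<close>, so a single potential serves all
  \<open>\<eta>\<close>.\<close>

lemma linearized_potential:
  assumes "\<eta> > 0"
  shows "korman_lambda l (- w \<eta>) * \<bar>x\<bar> powr l * exp (korman_U l (- w \<eta>) x) = \<eta>\<^sup>2 * V (\<eta> * x)"
proof -
  have "exp (w (\<eta> * x) - w \<eta>) = exp (w (\<eta> * x)) * exp (- w \<eta>)" by (simp add: exp_diff exp_minus divide_inverse)
  moreover have "exp (w \<eta>) * exp (- w \<eta>) = 1" by (simp add: exp_minus)
  moreover have "\<eta> powr (l + 2) = \<eta> powr l * \<eta>\<^sup>2" using assms by (simp add: powr_add)
  moreover have "\<bar>\<eta> * x\<bar> powr l = \<eta> powr l * \<bar>x\<bar> powr l" using assms by (simp add: abs_mult powr_mult)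
  ultimately show ?thesis
    using assms by (simp add: korman_lambda_eq korman_U_eq \<Lambda>_def V_def algebra_simps)
qed

lemma dirichlet_of_linear_ivp:
  assumes \<eta>: "\<eta> > 0" and AB: "A \<ge> 0" "B \<ge> 0" "A + B > 0"
    and zero: "fst (linear_ivp (\<lambda>t. V t + \<nu>) A B) \<eta> = 0" "fst (linear_ivp (\<lambda>t. V t + \<nu>) A B) (- \<eta>) = 0"
  shows "linearized_eigenvalue l (- w \<eta>) (\<eta>\<^sup>2 * \<nu>)"
proof -
  define y y' where "y = fst (linear_ivp (\<lambda>t. V t + \<nu>) A B)" and "y' = snd (linear_ivp (\<lambda>t. V t + \<nu>) A B)"
  have sol: "solves_linear (\<lambda>t. V t + \<nu>) y y' S" for S
    unfolding y_def y'_def by (rule solves_linear_subset[OF linear_ivp(1)[OF continuous_on_V_add] subset_UNIV])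
  note s = solves_linear_scale[OF sol, of \<eta>]
  obtain \<delta> where \<delta>: "\<delta> > 0" "\<And>t. 0 < t \<Longrightarrow> t < \<delta> \<Longrightarrow> y t > 0"
    using pos_near_zero[of y B A] solves_linearD(1)[OF sol UNIV_I, of 0] AB linear_ivp(2,3)[OF continuous_on_V_add, of \<nu> A B]
    by (metis y'_def y_def)
  show ?thesis
    unfolding linearized_eigenvalue_def dirichlet_solution_def
  proof (rule exI[of _ "\<lambda>x. y (\<eta> * x)"], intro conjI)
    show "\<exists>u'. \<forall>x\<in>{-1<..<1}. ((\<lambda>x. y (\<eta> * x)) has_real_derivative u' x) (at x) \<and>
      (u' has_real_derivative
        - (korman_lambda l (- w \<eta>) * \<bar>x\<bar> powr l * exp (korman_U l (- w \<eta>) x) * y (\<eta> * x) + \<eta>\<^sup>2 * \<nu> * y (\<eta> * x))) (at x)"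
      using s[of "{-1<..<1}"] unfolding solves_linear_def linearized_potential[OF \<eta>]
      by (intro exI[of _ "\<lambda>x. \<eta> * y' (\<eta> * x)"]) (simp add: algebra_simps)
    show "continuous_on {-1..1} (\<lambda>x. y (\<eta> * x))" by (rule solves_linear_continuous(1)[OF s])
    show "\<exists>x\<in>{-1..1}. y (\<eta> * x) \<noteq> 0"
    proof (intro bexI)
      define r where "r = min (\<delta> / 2) \<eta>"
      have r: "0 < r" "r < \<delta>" "r \<le> \<eta>" using \<delta> \<eta> by (auto simp: r_def)
      show "y (\<eta> * (r / \<eta>)) \<noteq> 0" using \<delta>(2)[OF r(1,2)] \<eta> by simp
      show "r / \<eta> \<in> {-1..1}" using r \<eta> by (auto intro: order_trans[of _ 0])
    qed
  qed (use zero in \<open>auto simp: y_def\<close>)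
qed

text \<open>By uniqueness from 0, an eigenfunction is a combination of the rescaled even and odd
  solutions; sum and difference of its boundary conditions separate the two. The factor
  \<open>\<eta>\<^sup>2\<close> comes from the change of length.\<close>

lemma linearized_eigenvalue_iff:
  assumes \<eta>: "\<eta> > 0"
  shows "linearized_eigenvalue l (- w \<eta>) (\<eta>\<^sup>2 * \<nu>) \<longleftrightarrow> even_sol \<nu> \<eta> = 0 \<or> odd_sol \<nu> \<eta> = 0"
proof
  assume "even_sol \<nu> \<eta> = 0 \<or> odd_sol \<nu> \<eta> = 0"
  then show "linearized_eigenvalue l (- w \<eta>) (\<eta>\<^sup>2 * \<nu>)"
    using dirichlet_of_linear_ivp[OF \<eta>, of 1 0 \<nu>] dirichlet_of_linear_ivp[OF \<eta>, of 0 1 \<nu>]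
      even_sol_minus[of \<nu> \<eta>] odd_sol_minus[of \<nu> \<eta>]
    by (auto simp: even_sol_def odd_sol_def)
next
  let ?q = "\<lambda>t. V t + \<nu>"
  let ?r = "\<lambda>x. \<eta>\<^sup>2 * (V (\<eta> * x) + \<nu>)"
  assume "linearized_eigenvalue l (- w \<eta>) (\<eta>\<^sup>2 * \<nu>)"
  then obtain \<phi> \<phi>' x0 where c\<phi>: "continuous_on {-1..1} \<phi>" and \<phi>0: "\<phi> (-1) = 0" "\<phi> 1 = 0"
    and d: "\<And>x. x \<in> {-1<..<1} \<Longrightarrow> (\<phi> has_real_derivative \<phi>' x) (at x) \<and>
      (\<phi>' has_real_derivative - (\<eta>\<^sup>2 * V (\<eta> * x) * \<phi> x + \<eta>\<^sup>2 * \<nu> * \<phi> x)) (at x)"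
    and x0: "x0 \<in> {-1..1}" "\<phi> x0 \<noteq> 0"
    unfolding linearized_eigenvalue_def dirichlet_solution_def linearized_potential[OF \<eta>] by blast
  have sol: "solves_linear ?r \<phi> \<phi>' {-1<..<1}"
    unfolding solves_linear_def using d by (simp add: algebra_simps)
  have cr: "continuous_on UNIV ?r"
    by (intro continuous_intros continuous_on_compose2[OF continuous_on_V[of UNIV]]) auto
  define E E' where "E = even_sol \<nu>" and "E' = snd (linear_ivp ?q 1 0)"
  define D D' where "D = odd_sol \<nu>" and "D' = snd (linear_ivp ?q 0 1)"
  have data: "E 0 = 1" "E' 0 = 0" "D 0 = 0" "D' 0 = 1"
    by (auto simp: E_def E'_def D_def D'_def even_sol_def odd_sol_def linear_ivp(2,3)[OF continuous_on_V_add])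
  have solE: "solves_linear ?q E E' S" and solD: "solves_linear ?q D D' S" for S
    by (auto simp: E_def E'_def D_def D'_def even_sol_def odd_sol_def
        intro!: solves_linear_subset[OF linear_ivp(1)[OF continuous_on_V_add] subset_UNIV])
  \<comment> \<open>The coefficients match value and slope of \<open>\<phi>\<close> at 0; dividing
    by \<open>\<eta>\<close> undoes the inner derivative of \<open>D (\<eta> * x)\<close>.\<close>
  define \<psi> where "\<psi> x = \<phi> 0 * E (\<eta> * x) + \<phi>' 0 / \<eta> * D (\<eta> * x)" for x
  have sol\<psi>: "solves_linear ?r \<psi> (\<lambda>x. \<phi> 0 * (\<eta> * E' (\<eta> * x)) + \<phi>' 0 / \<eta> * (\<eta> * D' (\<eta> * x))) S" for S
    unfolding \<psi>_def[abs_def] by (intro solves_linear_lincomb solves_linear_scale solE solD)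
  have eq: "\<phi> x - \<psi> x = 0" if x: "x \<in> {-1<..<1}" for x
  proof -
    have sub: "closed_segment 0 x \<subseteq> {-1<..<1}"
      using x by (auto simp: closed_segment_eq_real_ivl split: if_splits)
    show ?thesis
      using solves_linear_unique(1)[OF solves_linear_subset[OF sol sub] sol\<psi> cr]
      by (simp add: \<psi>_def data \<eta> less_imp_neq[OF \<eta>, symmetric])
  qed
  \<comment> \<open>\<open>\<phi>\<close> satisfies the equation only inside, so the boundary values
    are reached by continuity.\<close>
  have eq': "\<phi> x - \<psi> x = 0" if x: "x \<in> {-1..1}" for x
    by (rule continuous_constant_on_closure[of "{-1<..<1}", OF _ eq])
       (use x c\<phi> solves_linear_continuous(1)[OF sol\<psi>] in \<open>auto intro!: continuous_intros\<close>)
  have "\<phi> 0 * E \<eta> + \<phi>' 0 / \<eta> * D \<eta> = 0" "\<phi> 0 * E \<eta> - \<phi>' 0 / \<eta> * D \<eta> = 0"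
    using eq'[of 1] eq'[of "-1"] \<phi>0 by (auto simp: \<psi>_def E_def D_def even_sol_minus odd_sol_minus)
  then have "\<phi> 0 * E \<eta> = 0" "\<phi>' 0 / \<eta> * D \<eta> = 0" by linarith+
  moreover have "\<phi> 0 \<noteq> 0 \<or> \<phi>' 0 / \<eta> \<noteq> 0"
    using eq'[OF x0(1)] x0(2) by (auto simp: \<psi>_def)
  ultimately show "even_sol \<nu> \<eta> = 0 \<or> odd_sol \<nu> \<eta> = 0" by (auto simp: E_def D_def)
qed

lemma degenerate_iff: "\<eta> > 0 \<Longrightarrow> degenerate l (- w \<eta>) \<longleftrightarrow> v \<eta> = 0 \<or> z \<eta> = 0"
  using linearized_eigenvalue_iff[of \<eta> 0] by (simp add: degenerate_def even_sol_0 odd_sol_0)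

lemma even_negative_parameters:
  assumes \<eta>: "\<eta> > 0"
  shows "\<eta> \<le> \<tau> \<Longrightarrow> {\<nu>. \<nu> < 0 \<and> even_sol \<nu> \<eta> = 0} = {}"
    and "\<tau> < \<eta> \<Longrightarrow> \<exists>\<nu>. {\<nu>. \<nu> < 0 \<and> even_sol \<nu> \<eta> = 0} = {\<nu>}"
proof -
  assume "\<eta> \<le> \<tau>"
  then have "v t \<noteq> 0" if "0 < t" "t < \<eta>" for t
    using v_pos[of t] that by simp
  then show "{\<nu>. \<nu> < 0 \<and> even_sol \<nu> \<eta> = 0} = {}"
    using no_zero_of_smaller_parameter[OF continuous_on_V, of 1 0 _ \<eta>] \<eta>
    by (auto simp: even_sol_def linear_ivp_V_1_0)
next
  assume "\<tau> < \<eta>"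
  then obtain \<nu> where \<nu>: "\<nu> < 0" "even_sol \<nu> \<eta> = 0"
    using zero_parameter_exists[OF continuous_on_V, of 1 0 \<eta>] v_neg[of \<eta>] \<eta>
    by (auto simp: even_sol_def linear_ivp_V_1_0)
  have nz: "v t \<noteq> 0" if "0 < t" "t \<noteq> \<tau>" for t
    using v_pos[of t] v_neg[of t] that by (cases t \<tau> rule: linorder_cases) auto
  have F: False if "a < b" "b < 0" "even_sol a \<eta> = 0" "even_sol b \<eta> = 0" for a b
    using zero_parameter_unique[OF continuous_on_V, of 1 0 a b \<eta> \<tau>] that \<eta> nz
    by (auto simp: even_sol_def linear_ivp_V_1_0)
  have "{\<nu>. \<nu> < 0 \<and> even_sol \<nu> \<eta> = 0} = {\<nu>}"
    using \<nu> F[of _ \<nu>] F[of \<nu>] by (auto intro: linorder_cases)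
  then show "\<exists>\<nu>. {\<nu>. \<nu> < 0 \<and> even_sol \<nu> \<eta> = 0} = {\<nu>}" by blast
qed

lemma odd_negative_parameters:
  assumes \<eta>: "\<eta> > 0"
  shows "\<eta> \<le> \<zeta> \<Longrightarrow> {\<nu>. \<nu> < 0 \<and> odd_sol \<nu> \<eta> = 0} = {}"
    and "\<zeta> < \<eta> \<Longrightarrow> \<exists>\<nu>. {\<nu>. \<nu> < 0 \<and> odd_sol \<nu> \<eta> = 0} = {\<nu>}"
proof -
  assume "\<eta> \<le> \<zeta>"
  then have "z t \<noteq> 0" if "0 < t" "t < \<eta>" for t
    using z_pos[of t] that by simp
  then show "{\<nu>. \<nu> < 0 \<and> odd_sol \<nu> \<eta> = 0} = {}"
    using no_zero_of_smaller_parameter[OF continuous_on_V, of 0 1 _ \<eta>] \<eta>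
    by (auto simp: odd_sol_def z_def)
next
  assume "\<zeta> < \<eta>"
  then obtain \<nu> where \<nu>: "\<nu> < 0" "odd_sol \<nu> \<eta> = 0"
    using zero_parameter_exists[OF continuous_on_V, of 0 1 \<eta>] z_neg[of \<eta>] \<eta>
    by (auto simp: odd_sol_def z_def)
  have nz: "z t \<noteq> 0" if "0 < t" "t \<noteq> \<zeta>" for t
    using z_pos[of t] z_neg[of t] that by (cases t \<zeta> rule: linorder_cases) auto
  have F: False if "a < b" "b < 0" "odd_sol a \<eta> = 0" "odd_sol b \<eta> = 0" for a b
    using zero_parameter_unique[OF continuous_on_V, of 0 1 a b \<eta> \<zeta>] that \<eta> nz
    by (auto simp: odd_sol_def z_def)
  have "{\<nu>. \<nu> < 0 \<and> odd_sol \<nu> \<eta> = 0} = {\<nu>}"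
    using \<nu> F[of _ \<nu>] F[of \<nu>] by (auto intro: linorder_cases)
  then show "\<exists>\<nu>. {\<nu>. \<nu> < 0 \<and> odd_sol \<nu> \<eta> = 0} = {\<nu>}" by blast
qed

lemma morse_index_eq:
  assumes \<eta>: "\<eta> > 0"
  shows "morse_index l (- w \<eta>) = enat ((if \<tau> < \<eta> then 1 else 0) + (if \<zeta> < \<eta> then 1 else 0))"
proof -
  let ?E = "{\<nu>. \<nu> < 0 \<and> even_sol \<nu> \<eta> = 0}" and ?O = "{\<nu>. \<nu> < 0 \<and> odd_sol \<nu> \<eta> = 0}"
  have N: "{\<mu>. \<mu> < 0 \<and> linearized_eigenvalue l (- w \<eta>) \<mu>} = (\<lambda>\<nu>. \<eta>\<^sup>2 * \<nu>) ` (?E \<union> ?O)" (is "?N = _")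
  proof (intro equalityI subsetI)
    fix \<mu> assume "\<mu> \<in> ?N"
    moreover have "\<mu> = \<eta>\<^sup>2 * (\<mu> / \<eta>\<^sup>2)" using \<eta> by simp
    ultimately show "\<mu> \<in> (\<lambda>\<nu>. \<eta>\<^sup>2 * \<nu>) ` (?E \<union> ?O)"
      using linearized_eigenvalue_iff[OF \<eta>, of "\<mu> / \<eta>\<^sup>2"] \<eta>
      by (intro image_eqI[of _ _ "\<mu> / \<eta>\<^sup>2"]) (auto simp: divide_neg_pos)
  qed (use \<eta> in \<open>auto simp: linearized_eigenvalue_iff mult_pos_neg\<close>)
  have E: "finite ?E \<and> card ?E = (if \<tau> < \<eta> then 1 else 0)"
  proof (cases "\<tau> < \<eta>")
    case True
    then obtain \<nu> where "?E = {\<nu>}" using even_negative_parameters(2)[OF \<eta>] by blast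
    then show ?thesis using True by simp
  next
    case False
    then have empty: "?E = {}" by (intro even_negative_parameters(1)[OF \<eta>]) simp
    show ?thesis unfolding empty using False by simp
  qed
  have O: "finite ?O \<and> card ?O = (if \<zeta> < \<eta> then 1 else 0)"
  proof (cases "\<zeta> < \<eta>")
    case True
    then obtain \<nu> where "?O = {\<nu>}" using odd_negative_parameters(2)[OF \<eta>] by blast
    then show ?thesis using True by simp
  next
    case False
    then have empty: "?O = {}" by (intro odd_negative_parameters(1)[OF \<eta>]) simp
    show ?thesis unfolding empty using False by simp
  qed
  have "?E \<inter> ?O = {}"
    using linear_ivp_no_common_zero[OF continuous_on_V_add, of _ \<eta>] by (auto simp: even_sol_def odd_sol_def)
  then have "card (?E \<union> ?O) = card ?E + card ?O" using E O by (intro card_Un_disjoint) auto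
  moreover have "card ?N = card (?E \<union> ?O)"
    unfolding N using \<eta> by (intro card_image inj_onI) auto
  moreover have "finite ?N" unfolding N using E O by simp
  ultimately show ?thesis using E O by (simp add: morse_index_def)
qed

end

section \<open>Shooting and non-even solutions\<close>

context korman
begin

section \<open>Shape of \<open>\<Lambda>\<close>\<close>

lemma continuous_on_\<Lambda>: "S \<subseteq> {0..} \<Longrightarrow> continuous_on S \<Lambda>"
  unfolding \<Lambda>_def[abs_def]
  by (intro continuous_intros continuous_on_powr' continuous_on_w) (use l_pos in auto)

lemma \<Lambda>_less_left: "0 \<le> a \<Longrightarrow> a < b \<Longrightarrow> b \<le> \<tau> \<Longrightarrow> \<Lambda> a < \<Lambda> b"
proof (rule DERIV_pos_imp_increasing_open[of a b \<Lambda>])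
  assume ab: "0 \<le> a" "a < b" "b \<le> \<tau>"
  show "\<exists>y. (\<Lambda> has_real_derivative y) (at x) \<and> 0 < y" if "a < x" "x < b" for x
    using DERIV_\<Lambda>[of x] v_pos[of x] that ab l_pos
    by (intro exI[of _ "(l + 2) * x powr (l + 1) * exp (w x) * v x"]) auto
  show "continuous_on {a..b} \<Lambda>" using ab by (intro continuous_on_\<Lambda>) auto
qed

lemma \<Lambda>_less_right: "\<tau> \<le> a \<Longrightarrow> a < b \<Longrightarrow> \<Lambda> b < \<Lambda> a"
proof (rule DERIV_neg_imp_decreasing_open[of a b \<Lambda>])
  assume ab: "\<tau> \<le> a" "a < b"
  show "\<exists>y. (\<Lambda> has_real_derivative y) (at x) \<and> y < 0" if "a < x" "x < b" for x
    using DERIV_\<Lambda>[of x] v_neg[of x] that ab \<tau>_pos l_pos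
    by (intro exI[of _ "(l + 2) * x powr (l + 1) * exp (w x) * v x"]) (auto intro!: mult_pos_neg)
  show "continuous_on {a..b} \<Lambda>" using ab \<tau>_pos by (intro continuous_on_\<Lambda>) auto
qed

lemma \<Lambda>_le_max: "0 \<le> a \<Longrightarrow> \<Lambda> a \<le> \<Lambda> \<tau>"
  using \<Lambda>_less_left[of a \<tau>] \<Lambda>_less_right[of \<tau> a] by (cases a \<tau> rule: linorder_cases) auto

text \<open>With \<open>k = - w' 1\<close>, the tangent bound reads
  \<open>w t \<le> k - k * t\<close>; its exponential beats the power, whose exponent is rounded up
  to an integer \<open>n\<close>.\<close>

lemma \<Lambda>_tendsto_0: "(\<Lambda> \<longlongrightarrow> 0) at_top"
proof -
  define k where "k = - w' 1"
  have k: "k > 0" using w'_neg[of 1] by (simp add: k_def)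
  obtain n :: nat where n: "l + 2 \<le> real n" using real_arch_simple by blast
  have lim: "((\<lambda>t. exp k / k ^ n * ((k * t) ^ n / exp (k * t))) \<longlongrightarrow> exp k / k ^ n * 0) at_top"
    by (intro tendsto_mult tendsto_const filterlim_compose[OF tendsto_power_div_exp_0]
        filterlim_tendsto_pos_mult_at_top[OF tendsto_const k] filterlim_ident)
  show ?thesis
  proof (rule Lim_null_comparison)
    show "\<forall>\<^sub>F t in at_top. norm (\<Lambda> t) \<le> exp k / k ^ n * ((k * t) ^ n / exp (k * t))"
      using eventually_ge_at_top[of 1]
    proof eventually_elim
      case (elim t)
      have "t powr (l + 2) \<le> t powr real n" using elim n by (intro powr_mono) auto
      moreover have "exp (w t) \<le> exp (k - k * t)"
        using w_le_linear[OF elim] by (simp add: k_def algebra_simps)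
      ultimately have "\<Lambda> t \<le> t ^ n * exp (k - k * t)"
        using elim unfolding \<Lambda>_def by (intro mult_mono) (auto simp: powr_realpow)
      also have "\<dots> = exp k / k ^ n * ((k * t) ^ n / exp (k * t))"
        using k by (simp add: exp_diff power_mult_distrib)
      finally show ?case using \<Lambda>_pos[of t] elim by simp
    qed
    show "((\<lambda>t. exp k / k ^ n * ((k * t) ^ n / exp (k * t))) \<longlongrightarrow> 0) at_top" using lim by simp
  qed
qed

text \<open>\<open>\<Lambda>\<close> rises from 0 to its maximum at \<open>\<tau>\<close> and decays
  to 0. Because \<open>lam < \<Lambda> \<zeta>\<close>, the right preimage lies beyond
  \<open>\<zeta>\<close> and not merely beyond \<open>\<tau>\<close>, so that \<open>z\<close> is
  negative there as well as \<open>v\<close>.\<close>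

lemma \<Lambda>_preimages:
  assumes lam: "0 < lam" "lam < \<Lambda> \<zeta>"
  obtains \<eta>1 \<eta>2 where "0 < \<eta>1" "\<eta>1 < \<tau>" "\<zeta> < \<eta>2" "\<Lambda> \<eta>1 = lam" "\<Lambda> \<eta>2 = lam"
proof -
  have \<Lambda>0: "\<Lambda> 0 = 0" using l_pos by (simp add: \<Lambda>_def)
  have less: "lam < \<Lambda> \<tau>" using lam \<Lambda>_less_right[OF order_refl \<tau>_less_\<zeta>] by simp
  obtain \<eta>1 where e1: "0 \<le> \<eta>1" "\<eta>1 \<le> \<tau>" "\<Lambda> \<eta>1 = lam"
    using IVT'[of \<Lambda> 0 lam \<tau>] continuous_on_\<Lambda>[of "{0..\<tau>}"] \<tau>_pos less lam \<Lambda>0 by auto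
  have "\<forall>\<^sub>F t in at_top. \<Lambda> t < lam \<and> t \<ge> \<zeta>"
    using order_tendstoD(2)[OF \<Lambda>_tendsto_0 lam(1)] eventually_ge_at_top by (rule eventually_conj)
  then obtain T where T: "\<Lambda> T < lam" "T \<ge> \<zeta>" by (auto dest: eventually_happens)
  obtain \<eta>2 where e2: "\<zeta> \<le> \<eta>2" "\<eta>2 \<le> T" "\<Lambda> \<eta>2 = lam"
    using IVT2'[of \<Lambda> T lam \<zeta>] continuous_on_\<Lambda>[of "{\<zeta>..T}"] \<zeta>_pos T lam by auto
  show ?thesis
    using that[of \<eta>1 \<eta>2] e1 e2 less lam \<Lambda>0 by (cases "\<eta>1 = 0"; cases "\<eta>1 = \<tau>"; cases "\<eta>2 = \<zeta>") auto
qed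

text \<open>The slope \<open>\<eta> * w' (- \<eta>)\<close> of the even solution at -1, which is its
  shooting parameter. Being strictly increasing, it identifies \<open>\<eta>\<close>.\<close>

definition \<sigma> :: "real \<Rightarrow> real" where "\<sigma> \<eta> = - \<eta> * w' \<eta>"

lemma \<sigma>_pos: "\<eta> > 0 \<Longrightarrow> \<sigma> \<eta> > 0"
  using w'_neg[of \<eta>] by (simp add: \<sigma>_def mult_pos_neg)

lemma \<sigma>_less: "0 < a \<Longrightarrow> a < b \<Longrightarrow> \<sigma> a < \<sigma> b"
  unfolding \<sigma>_def using w'_less[of a b] w'_neg[of a] mult_strict_mono[of a b "- w' a" "- w' b"] by simp

lemma \<sigma>_less_iff: "0 < a \<Longrightarrow> 0 < b \<Longrightarrow> \<sigma> a < \<sigma> b \<longleftrightarrow> a < b"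
  using \<sigma>_less[of a b] \<sigma>_less[of b a] by (cases a b rule: linorder_cases) auto

lemma continuous_on_\<sigma>: "continuous_on S \<sigma>"
  unfolding \<sigma>_def[abs_def] by (intro continuous_intros continuous_on_w')

section \<open>Shooting from -1 with a truncated nonlinearity\<close>

definition truncated_sol :: "real \<Rightarrow> real \<Rightarrow> (real \<Rightarrow> real) \<Rightarrow> (real \<Rightarrow> real) \<Rightarrow> bool" where
  "truncated_sol M lam u u' \<longleftrightarrow>
     (\<forall>x. (u has_real_derivative u' x) (at x) \<and>
          (u' has_real_derivative - (lam * \<bar>x\<bar> powr l * exp (min (u x) M))) (at x))"

lemma truncated_solD:
  assumes "truncated_sol M lam u u'"
  shows "(u has_real_derivative u' x) (at x)"
    "(u' has_real_derivative - (lam * \<bar>x\<bar> powr l * exp (min (u x) M))) (at x)"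
  using assms by (auto simp: truncated_sol_def)

text \<open>The difference of the right-hand sides splits into \<open>lam1\<close> times a
  difference of exponentials, controlled by \<open>K\<close>, and \<open>lam1 - lam2\<close> times
  one exponential, which becomes the inhomogeneity in Gronwall's estimate.\<close>

lemma truncated_sol_dependence:
  assumes u: "truncated_sol M lam1 u u'" and y: "truncated_sol M lam2 y y'"
    and lam: "0 \<le> lam1" "lam1 \<le> K" and ax: "a \<in> {-1..1}" "x \<in> {-1..1}"
  shows "(u x - y x)\<^sup>2 + (u' x - y' x)\<^sup>2 \<le>
    ((u a - y a)\<^sup>2 + (u' a - y' a)\<^sup>2 + (\<bar>lam1 - lam2\<bar> * exp M)\<^sup>2 * \<bar>x - a\<bar>) * exp ((2 + K * exp M) * \<bar>x - a\<bar>)"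
proof (rule second_order_gronwall[where d = "\<lambda>x. u x - y x" and p = "\<lambda>x. u' x - y' x" and
      r = "\<lambda>x. - (lam1 * \<bar>x\<bar> powr l * exp (min (u x) M)) + lam2 * \<bar>x\<bar> powr l * exp (min (y x) M)"])
  show "0 \<le> K * exp M" using lam by simp
  fix t assume "t \<in> closed_segment a x"
  then have t: "t \<in> {-1..1}" using ax by (auto simp: closed_segment_eq_real_ivl split: if_splits)
  show "((\<lambda>x. u x - y x) has_real_derivative u' t - y' t) (at t)"
    by (intro DERIV_diff truncated_solD[OF u] truncated_solD[OF y])
  show "((\<lambda>x. u' x - y' x) has_real_derivative
      - (lam1 * \<bar>t\<bar> powr l * exp (min (u t) M)) + lam2 * \<bar>t\<bar> powr l * exp (min (y t) M)) (at t)"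
    using DERIV_diff[OF truncated_solD(2)[OF u, of t] truncated_solD(2)[OF y, of t]] by simp
  have p1: "\<bar>t\<bar> powr l \<le> 1" using t l_pos by (rule abs_powr_le_1)
  have "- (lam1 * \<bar>t\<bar> powr l * exp (min (u t) M)) + lam2 * \<bar>t\<bar> powr l * exp (min (y t) M)
      = - (lam1 * \<bar>t\<bar> powr l * (exp (min (u t) M) - exp (min (y t) M))) - (lam1 - lam2) * (\<bar>t\<bar> powr l * exp (min (y t) M))"
    by (simp add: algebra_simps)
  also have "\<bar>\<dots>\<bar> \<le> \<bar>lam1 * \<bar>t\<bar> powr l * (exp (min (u t) M) - exp (min (y t) M))\<bar>
      + \<bar>(lam1 - lam2) * (\<bar>t\<bar> powr l * exp (min (y t) M))\<bar>"
    by linarith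
  also have "\<dots> = lam1 * \<bar>t\<bar> powr l * \<bar>exp (min (u t) M) - exp (min (y t) M)\<bar>
      + \<bar>lam1 - lam2\<bar> * (\<bar>t\<bar> powr l * exp (min (y t) M))"
    using lam by (simp add: abs_mult)
  also have "\<dots> \<le> K * 1 * (exp M * \<bar>u t - y t\<bar>) + \<bar>lam1 - lam2\<bar> * (1 * exp M)"
    using lam p1 by (intro add_mono mult_mono mult_left_mono exp_min_lipschitz) auto
  finally show "\<bar>- (lam1 * \<bar>t\<bar> powr l * exp (min (u t) M)) + lam2 * \<bar>t\<bar> powr l * exp (min (y t) M)\<bar>
      \<le> K * exp M * \<bar>u t - y t\<bar> + \<bar>lam1 - lam2\<bar> * exp M"
    by simp
qed

lemma truncated_sol_unique:
  assumes u: "truncated_sol M lam u u'" and y: "truncated_sol M lam y y'"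
    and lam: "0 \<le> lam" and ax: "a \<in> {-1..1}" "x \<in> {-1..1}" and eq: "u a = y a" "u' a = y' a"
  shows "u x = y x" "u' x = y' x"
proof -
  have "(u x - y x)\<^sup>2 + (u' x - y' x)\<^sup>2 \<le> 0"
    using truncated_sol_dependence[OF u y lam order_refl ax] eq by simp
  then show "u x = y x" "u' x = y' x" by (auto simp: sum_power2_le_zero_iff)
qed

definition shoot_pair :: "real \<Rightarrow> real \<Rightarrow> real \<Rightarrow> (real \<Rightarrow> real) \<times> (real \<Rightarrow> real)" where
  "shoot_pair M lam s =
     (SOME Y. truncated_sol M lam (fst Y) (snd Y) \<and> fst Y (-1) = 0 \<and> snd Y (-1) = s)"

definition shoot :: "real \<Rightarrow> real \<Rightarrow> real \<Rightarrow> real \<Rightarrow> real" where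
  "shoot M lam s = fst (shoot_pair M lam s)"

definition shoot' :: "real \<Rightarrow> real \<Rightarrow> real \<Rightarrow> real \<Rightarrow> real" where
  "shoot' M lam s = snd (shoot_pair M lam s)"

lemma shoot:
  assumes "lam \<ge> 0"
  shows "truncated_sol M lam (shoot M lam s) (shoot' M lam s)" "shoot M lam s (-1) = 0" "shoot' M lam s (-1) = s"
proof -
  obtain u u' where "u (-1) = 0" "u' (-1) = s" "truncated_sol M lam u u'"
    using truncated_liouville_exists[OF l_pos assms, of "-1" 0 s M] unfolding truncated_sol_def by metis
  then have "\<exists>Y. truncated_sol M lam (fst Y) (snd Y) \<and> fst Y (-1) = 0 \<and> snd Y (-1) = s"
    by (intro exI[of _ "(u, u')"]) simp
  from someI_ex[OF this]
  show "truncated_sol M lam (shoot M lam s) (shoot' M lam s)" "shoot M lam s (-1) = 0" "shoot' M lam s (-1) = s"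
    by (auto simp: shoot_def shoot'_def shoot_pair_def)
qed

lemma shoot_lipschitz:
  obtains C where "C \<ge> 0"
    "\<forall>lam1 lam2 s1 s2. \<forall>x\<in>{-1..1}. 0 \<le> lam1 \<and> lam1 \<le> K \<and> 0 \<le> lam2 \<longrightarrow>
      \<bar>shoot M lam1 s1 x - shoot M lam2 s2 x\<bar> \<le> C * (\<bar>s1 - s2\<bar> + \<bar>lam1 - lam2\<bar>)"
proof -
  \<comment> \<open>The factors 2 bound \<open>\<bar>x + 1\<bar>\<close> on \<open>[-1, 1]\<close>;
    \<open>\<bar>K\<bar>\<close> keeps the Gronwall constant nonnegative for every
    \<open>K\<close>.\<close>
  define C where "C = sqrt ((1 + (exp M)\<^sup>2 * 2) * exp ((2 + \<bar>K\<bar> * exp M) * 2))"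
  have "\<bar>shoot M lam1 s1 x - shoot M lam2 s2 x\<bar> \<le> C * (\<bar>s1 - s2\<bar> + \<bar>lam1 - lam2\<bar>)"
    if lam: "0 \<le> lam1" "lam1 \<le> K" "0 \<le> lam2" and x: "x \<in> {-1..1}" for lam1 lam2 s1 s2 x
  proof -
    let ?a = "\<bar>s1 - s2\<bar>" and ?b = "\<bar>lam1 - lam2\<bar>"
    let ?d = "shoot M lam1 s1 x - shoot M lam2 s2 x"
    have "?d\<^sup>2 + (shoot' M lam1 s1 x - shoot' M lam2 s2 x)\<^sup>2
        \<le> (?a\<^sup>2 + (?b * exp M)\<^sup>2 * \<bar>x + 1\<bar>) * exp ((2 + \<bar>K\<bar> * exp M) * \<bar>x + 1\<bar>)"
      using truncated_sol_dependence[OF shoot(1)[OF lam(1), of M s1] shoot(1)[OF lam(3), of M s2] lam(1), of "\<bar>K\<bar>" "-1" x]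
        lam x by (simp add: shoot(2,3) power2_commute)
    also have "\<dots> \<le> (?a\<^sup>2 + (?b * exp M)\<^sup>2 * 2) * exp ((2 + \<bar>K\<bar> * exp M) * 2)"
    proof (rule mult_mono)
      show "exp ((2 + \<bar>K\<bar> * exp M) * \<bar>x + 1\<bar>) \<le> exp ((2 + \<bar>K\<bar> * exp M) * 2)"
        unfolding exp_le_cancel_iff using x by (intro mult_left_mono) auto
    qed (use x in \<open>auto intro!: add_left_mono mult_left_mono\<close>)
    also have "?a\<^sup>2 + (?b * exp M)\<^sup>2 * 2 \<le> (1 + (exp M)\<^sup>2 * 2) * (?a + ?b)\<^sup>2"
    proof -
      have "?a\<^sup>2 \<le> (?a + ?b)\<^sup>2" "?b\<^sup>2 \<le> (?a + ?b)\<^sup>2" by (rule power_mono; simp)+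
      then have "?a\<^sup>2 + (exp M)\<^sup>2 * 2 * ?b\<^sup>2 \<le> (?a + ?b)\<^sup>2 + (exp M)\<^sup>2 * 2 * (?a + ?b)\<^sup>2"
        by (intro add_mono mult_left_mono) auto
      then show ?thesis by (simp add: power_mult_distrib algebra_simps)
    qed
    finally have "?d\<^sup>2 \<le> (1 + (exp M)\<^sup>2 * 2) * (?a + ?b)\<^sup>2 * exp ((2 + \<bar>K\<bar> * exp M) * 2)"
      by (rule order_trans[rotated]) simp_all
    also have "\<dots> = (C * (?a + ?b))\<^sup>2"
      by (simp add: C_def power_mult_distrib mult_ac add_nonneg_nonneg)
    finally show ?thesis
      by (subst (asm) abs_le_square_iff[symmetric]) (simp add: abs_mult C_def add_nonneg_nonneg)
  qed
  moreover have "C \<ge> 0" by (simp add: C_def add_nonneg_nonneg)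
  ultimately show ?thesis using that by blast
qed

lemma continuous_on_shoot:
  assumes f: "continuous_on S f" and g: "continuous_on S g" and nn: "\<And>t. t \<in> S \<Longrightarrow> 0 \<le> f t" "\<And>t. t \<in> S \<Longrightarrow> f t \<le> K"
    and x: "x \<in> {-1..1}"
  shows "continuous_on S (\<lambda>t. shoot M (f t) (g t) x)"
proof -
  obtain C where C:
    "\<forall>lam1 lam2 s1 s2. \<forall>x\<in>{-1..1}. 0 \<le> lam1 \<and> lam1 \<le> K \<and> 0 \<le> lam2 \<longrightarrow>
      \<bar>shoot M lam1 s1 x - shoot M lam2 s2 x\<bar> \<le> C * (\<bar>s1 - s2\<bar> + \<bar>lam1 - lam2\<bar>)"
    using shoot_lipschitz[of K M] by metis
  show ?thesis
    unfolding continuous_on_def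
  proof
    fix t0 assume t0: "t0 \<in> S"
    have "((\<lambda>t. shoot M (f t) (g t) x - shoot M (f t0) (g t0) x) \<longlongrightarrow> 0) (at t0 within S)"
    proof (rule Lim_null_comparison)
      show "\<forall>\<^sub>F t in at t0 within S. norm (shoot M (f t) (g t) x - shoot M (f t0) (g t0) x)
          \<le> C * (\<bar>g t - g t0\<bar> + \<bar>f t - f t0\<bar>)"
        unfolding eventually_at_filter by (rule always_eventually) (use C nn x t0 in auto)
      have "((\<lambda>t. C * (\<bar>g t - g t0\<bar> + \<bar>f t - f t0\<bar>)) \<longlongrightarrow> C * (\<bar>g t0 - g t0\<bar> + \<bar>f t0 - f t0\<bar>)) (at t0 within S)"
        using f g t0 by (intro tendsto_intros) (auto simp: continuous_on_def)
      then show "((\<lambda>t. C * (\<bar>g t - g t0\<bar> + \<bar>f t - f t0\<bar>)) \<longlongrightarrow> 0) (at t0 within S)" by simp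
    qed
    then show "((\<lambda>t. shoot M (f t) (g t) x) \<longlongrightarrow> shoot M (f t0) (g t0) x) (at t0 within S)"
      by (simp add: LIM_zero_iff)
  qed
qed

text \<open>\<open>a\<close> is kept free instead of being \<open>- w \<eta>\<close>: an even
  solution is matched with this family by its value at 0, before its boundary value is used. As
  \<open>w \<le> 0\<close>, \<open>a \<le> M\<close> makes the truncation inactive.\<close>

lemma truncated_sol_w:
  assumes "\<eta> > 0" "a \<le> M"
  shows "truncated_sol M (\<eta> powr (l + 2) * exp (- a)) (\<lambda>x. w (\<eta> * x) + a) (\<lambda>x. \<eta> * w' (\<eta> * x))"
  unfolding truncated_sol_def
proof (intro allI conjI)
  fix x
  have c: "((\<lambda>x. \<eta> * x) has_real_derivative \<eta>) (at x)" by (auto intro!: derivative_eq_intros)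
  show "((\<lambda>x. w (\<eta> * x) + a) has_real_derivative \<eta> * w' (\<eta> * x)) (at x)"
    using DERIV_add[OF DERIV_chain2[OF DERIV_w c] DERIV_const[of a]] by (simp add: mult.commute)
  have m: "min (w (\<eta> * x) + a) M = w (\<eta> * x) + a" using w_le_0[of "\<eta> * x"] assms by simp
  have "\<eta> * (- V (\<eta> * x) * \<eta>) = - (\<eta> powr (l + 2) * exp (- a) * \<bar>x\<bar> powr l * exp (min (w (\<eta> * x) + a) M))"
  proof -
    have "\<eta> powr (l + 2) = \<eta> powr l * \<eta>\<^sup>2" using assms by (simp add: powr_add)
    moreover have "\<bar>\<eta> * x\<bar> powr l = \<eta> powr l * \<bar>x\<bar> powr l" using assms by (simp add: abs_mult powr_mult)
    moreover have "exp (- a) * exp (w (\<eta> * x) + a) = exp (w (\<eta> * x))" by (simp add: exp_add exp_minus)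
    ultimately show ?thesis
      unfolding m V_def by (simp add: power2_eq_square mult.assoc mult.left_commute)
  qed
  then show "((\<lambda>x. \<eta> * w' (\<eta> * x)) has_real_derivative
      - (\<eta> powr (l + 2) * exp (- a) * \<bar>x\<bar> powr l * exp (min (w (\<eta> * x) + a) M))) (at x)"
    using DERIV_cmult[OF DERIV_chain2[OF DERIV_w'_V c], of \<eta>] by simp
qed

text \<open>Concavity: the maximum of the even solution is attained at distance 1 from -1, hence is
  at most the slope there. So \<open>\<sigma> \<eta> \<le> M\<close> keeps it below the truncation
  level.\<close>

lemma minus_w_le_\<sigma>: "\<eta> > 0 \<Longrightarrow> - w \<eta> \<le> \<sigma> \<eta>"
proof -
  assume \<eta>: "\<eta> > 0"
  obtain x where x: "0 < x" "x < \<eta>" "w \<eta> - w 0 = (\<eta> - 0) * w' x"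
    using MVT2[OF \<eta>, of w w'] DERIV_w by blast
  have "\<eta> * - w' x \<le> \<eta> * - w' \<eta>" using x w'_less[of x \<eta>] \<eta> by (intro mult_left_mono) auto
  then show ?thesis using x by (simp add: \<sigma>_def w_0)
qed

lemma shoot_korman:
  assumes "\<eta> > 0" "\<sigma> \<eta> \<le> M" "x \<in> {-1..1}"
  shows "shoot M (\<Lambda> \<eta>) (\<sigma> \<eta>) x = w (\<eta> * x) - w \<eta>"
proof -
  have "truncated_sol M (\<Lambda> \<eta>) (\<lambda>x. w (\<eta> * x) + - w \<eta>) (\<lambda>x. \<eta> * w' (\<eta> * x))"
    using truncated_sol_w[OF assms(1), of "- w \<eta>" M] minus_w_le_\<sigma>[OF assms(1)] assms(2) by (simp add: \<Lambda>_def)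
  from truncated_sol_unique(1)[OF shoot(1) this, of "-1" x "\<sigma> \<eta>"] show ?thesis
    using assms \<Lambda>_pos[OF assms(1)] by (simp add: shoot(2,3) w_minus w'_minus \<sigma>_def)
qed

text \<open>Strict concavity, with the weight vanishing only at 0. It replaces any maximum principle
  in what follows.\<close>

lemma shoot'_less: "lam > 0 \<Longrightarrow> a < b \<Longrightarrow> shoot' M lam s b < shoot' M lam s a"
  by (rule strict_decreasing_if_DERIV_neg_except_zero[OF truncated_solD(2)[OF shoot(1)]]) auto

lemma shoot_le:
  assumes "lam > 0" "2 * s \<le> M" "0 \<le> M" "x \<in> {-1..1}"
  shows "shoot M lam s x \<le> M"
proof (cases "x = -1")
  case True
  then show ?thesis using assms by (simp add: shoot)
next
  case False
  then obtain y where y: "-1 < y" "shoot M lam s x - shoot M lam s (-1) = (x - (-1)) * shoot' M lam s y"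
    using MVT2[of "-1" x "shoot M lam s" "shoot' M lam s"] truncated_solD(1)[OF shoot(1)] assms by force
  have "(x + 1) * shoot' M lam s y \<le> (x + 1) * s"
    using shoot'_less[OF assms(1) y(1), of M s] shoot(3)[of lam M s] assms by (intro mult_left_mono) auto
  also have "\<dots> \<le> (x + 1) * (M / 2)" using assms by (intro mult_left_mono) auto
  also have "\<dots> \<le> 2 * (M / 2)" using assms by (intro mult_right_mono) auto
  finally show ?thesis using y assms by (simp add: shoot)
qed

text \<open>The truncation is inactive by \<open>shoot_le\<close>. Positivity is strict concavity:
  an interior value at most 0 would give, by mean values, a slope at most 0 to its left and one at
  least 0 to its right.\<close>

lemma shoot_solution:
  assumes lam: "lam > 0" and s: "s > 0" "2 * s \<le> M" and zero: "shoot M lam s 1 = 0"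
  shows "liouville_solution l lam (shoot M lam s)" "positive_fun (shoot M lam s)"
proof -
  note d = truncated_solD[OF shoot(1)[of lam M s]]
  have m: "min (shoot M lam s x) M = shoot M lam s x" if "x \<in> {-1..1}" for x
    using shoot_le[OF lam s(2) _ that] s by simp
  show "liouville_solution l lam (shoot M lam s)"
    unfolding liouville_solution_def dirichlet_solution_def
  proof (intro conjI)
    show "continuous_on {- 1..1} (shoot M lam s)"
      using d(1) lam by (intro continuous_at_imp_continuous_on ballI DERIV_isCont) auto
    show "\<exists>u'. \<forall>x\<in>{- 1<..<1}. (shoot M lam s has_real_derivative u' x) (at x) \<and>
      (u' has_real_derivative - (lam * \<bar>x\<bar> powr l * exp (shoot M lam s x))) (at x)"
    proof (intro exI[of _ "shoot' M lam s"] ballI conjI)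
      fix x :: real assume x: "x \<in> {-1<..<1}"
      show "(shoot M lam s has_real_derivative shoot' M lam s x) (at x)" using d(1) lam by simp
      show "(shoot' M lam s has_real_derivative - (lam * \<bar>x\<bar> powr l * exp (shoot M lam s x))) (at x)"
        using d(2)[of x] m[of x] x lam by simp
    qed
  qed (use lam zero in \<open>auto simp: shoot\<close>)
  show "positive_fun (shoot M lam s)"
    unfolding positive_fun_def
  proof (intro ballI, rule ccontr)
    fix x :: real assume x: "x \<in> {-1<..<1}" and neg: "\<not> shoot M lam s x > 0"
    obtain a where a: "-1 < a" "a < x" "shoot M lam s x - shoot M lam s (-1) = (x - (-1)) * shoot' M lam s a"
      using MVT2[of "-1" x "shoot M lam s" "shoot' M lam s"] d(1) lam x by force
    obtain b where b: "x < b" "b < 1" "shoot M lam s 1 - shoot M lam s x = (1 - x) * shoot' M lam s b"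
      using MVT2[of x 1 "shoot M lam s" "shoot' M lam s"] d(1) lam x by force
    have "(x + 1) * shoot' M lam s a \<le> 0" using a neg lam by (simp add: shoot)
    then have "shoot' M lam s a \<le> 0" using x by (simp add: mult_le_0_iff)
    moreover have "(1 - x) * shoot' M lam s b \<ge> 0" using b neg zero by simp
    then have "shoot' M lam s b \<ge> 0" using x by (simp add: zero_le_mult_iff)
    ultimately show False using shoot'_less[OF lam, of a b M s] a b by simp
  qed
qed

text \<open>Evenness gives slope 0 at the centre, so uniqueness from 0 yields
  \<open>w (\<eta> * x) + a\<close>. Used contrapositively: if no \<open>\<eta>\<close> has both
  this \<open>\<Lambda>\<close> and this \<open>\<sigma>\<close>, the solution is non-even.\<close>

lemma even_shoot_is_korman:
  assumes lam: "lam > 0" and s: "s > 0" "2 * s \<le> M" and zero: "shoot M lam s 1 = 0"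
    and even: "even_fun (shoot M lam s)"
  obtains \<eta> where "\<eta> > 0" "\<Lambda> \<eta> = lam" "\<sigma> \<eta> = s"
proof -
  define y y' where "y = shoot M lam s" and "y' = shoot' M lam s"
  have sol: "truncated_sol M lam y y'" using shoot(1) lam by (simp add: y_def y'_def)
  define a where "a = y 0"
  \<comment> \<open>Solves \<open>\<eta> powr (l + 2) * exp (- a) = lam\<close>, the relation under
    which the rescaled \<open>w\<close> solves the problem for \<open>lam\<close>.\<close>
  define \<eta> where "\<eta> = (lam * exp a) powr (1 / (l + 2))"
  have \<eta>: "\<eta> > 0" "\<eta> powr (l + 2) = lam * exp a" using lam l_pos by (auto simp: \<eta>_def powr_powr)
  have aM: "a \<le> M" using shoot_le[OF lam s(2), of 0] s by (simp add: a_def y_def)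
  have "((\<lambda>x. y (- x)) has_real_derivative - y' 0) (at 0)"
    using truncated_solD(1)[OF sol, of "- 0", unfolded DERIV_mirror] by simp
  then have "(y has_real_derivative - y' 0) (at 0)"
    by (rule has_field_derivative_transform_within_open[of _ _ _ "{-1<..<1}"])
       (use even in \<open>auto simp: even_fun_def y_def\<close>)
  from DERIV_unique[OF this truncated_solD(1)[OF sol]] have y'0: "y' 0 = 0" by simp
  have "\<eta> powr (l + 2) * exp (- a) = lam" using \<eta> by (simp add: exp_minus)
  then have sol2: "truncated_sol M lam (\<lambda>x. w (\<eta> * x) + a) (\<lambda>x. \<eta> * w' (\<eta> * x))"
    using truncated_sol_w[OF \<eta>(1) aM] by simp
  have eq: "y x = w (\<eta> * x) + a" "y' x = \<eta> * w' (\<eta> * x)" if "x \<in> {-1..1}" for x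
    using truncated_sol_unique[OF sol sol2, of 0 x] lam that y'0 by (auto simp: w_0 w'_0 a_def)
  have "w \<eta> = - a" using eq(1)[of 1] zero by (simp add: y_def)
  then have "\<Lambda> \<eta> = lam" using \<eta> by (simp add: \<Lambda>_def exp_minus)
  moreover have "\<sigma> \<eta> = s" using eq(2)[of "-1"] lam by (simp add: y'_def shoot \<sigma>_def w'_minus)
  ultimately show ?thesis using that \<eta> by blast
qed

end

section \<open>Derivative of the right end value\<close>

lemma exp_second_order:
  fixes y u M :: real
  assumes "y \<le> M" "u \<le> M"
  shows "\<bar>exp y - exp u - exp u * (y - u)\<bar> \<le> exp M * (y - u)\<^sup>2"
proof -
  obtain c where c: "exp y - exp u = exp c * (y - u)" "c \<le> M" "\<bar>c - u\<bar> \<le> \<bar>y - u\<bar>"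
  proof (cases y u rule: linorder_cases)
    case less
    obtain c where "y < c" "c < u" "exp u - exp y = (u - y) * exp c"
      using MVT2[OF less, of exp exp] DERIV_exp by blast
    then show ?thesis using assms by (intro that[of c]) (auto simp: algebra_simps)
  next
    case greater
    obtain c where "u < c" "c < y" "exp y - exp u = (y - u) * exp c"
      using MVT2[OF greater, of exp exp] DERIV_exp by blast
    then show ?thesis using assms by (intro that[of c]) (auto simp: algebra_simps)
  qed (use assms that[of u] in auto)
  have "exp y - exp u - exp u * (y - u) = (exp c - exp u) * (y - u)" using c(1) by (simp add: algebra_simps)
  then have "\<bar>exp y - exp u - exp u * (y - u)\<bar> = \<bar>exp c - exp u\<bar> * \<bar>y - u\<bar>" by (simp add: abs_mult)
  also have "\<dots> \<le> (exp M * \<bar>y - u\<bar>) * \<bar>y - u\<bar>"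
    using order_trans[OF exp_lipschitz[OF c(2) assms(2)] mult_left_mono[OF c(3)]] by (intro mult_right_mono) auto
  finally show ?thesis by (simp add: power2_eq_square)
qed

context korman
begin

lemma v_minus: "v (- t) = v t" and v'_minus: "v' (- t) = - v' t"
  by (simp_all add: v_def v'_def w'_minus V_minus minus_divide_left)

lemma z_minus: "z (- t) = - z t"
  using odd_sol_minus[of 0 t] by (simp add: odd_sol_0)

text \<open>The derivative in \<open>s\<close> is the solution \<open>\<phi>\<close> of the
  linearized equation with value 0 and slope 1 at -1. The remainder
  \<open>y - U - h * \<phi>\<close> has zero data and an inhomogeneity of order \<open>h^2\<close>,
  so Gronwall bounds it by a multiple of \<open>h^2\<close>. The margin 1 in \<open>M\<close> leaves
  room for all slopes within distance 1.\<close>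

lemma DERIV_shoot_korman:
  assumes \<eta>: "\<eta> > 0" and M: "2 * (\<sigma> \<eta> + 1) \<le> M"
  shows "((\<lambda>s. shoot M (\<Lambda> \<eta>) s 1) has_real_derivative 2 * v \<eta> * z \<eta> / \<eta>) (at (\<sigma> \<eta>))"
proof -
  let ?lam = "\<Lambda> \<eta>" and ?s0 = "\<sigma> \<eta>"
  have lam: "?lam > 0" by (rule \<Lambda>_pos[OF \<eta>])
  have M0: "M \<ge> 0" "?s0 \<le> M" using M \<sigma>_pos[OF \<eta>] by auto
  define U where "U x = w (\<eta> * x) + - w \<eta>" for x
  have U: "truncated_sol M ?lam U (\<lambda>x. \<eta> * w' (\<eta> * x))"
    using truncated_sol_w[OF \<eta>, of "- w \<eta>" M] minus_w_le_\<sigma>[OF \<eta>] M0 by (simp add: \<Lambda>_def U_def[abs_def])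
  have UM: "U x \<le> M" for x using w_le_0[of "\<eta> * x"] minus_w_le_\<sigma>[OF \<eta>] M0 by (simp add: U_def)
  have U_eq: "U x = shoot M ?lam ?s0 x" if "x \<in> {-1..1}" for x
    using shoot_korman[OF \<eta> M0(2) that] by (simp add: U_def)
  have pot: "\<eta>\<^sup>2 * V (\<eta> * x) = ?lam * \<bar>x\<bar> powr l * exp (U x)" for x
    using linearized_potential[OF \<eta>, of x] \<eta> by (simp add: korman_lambda_eq korman_U_eq U_def)
  \<comment> \<open>By parity the two summands cancel at -1 and agree at 1; the slope at -1 is the
    Wronskian of \<open>v\<close> and \<open>z\<close>, hence 1.\<close>
  define \<phi> where "\<phi> x = z \<eta> / \<eta> * v (\<eta> * x) + v \<eta> / \<eta> * z (\<eta> * x)" for x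
  define \<phi>' where "\<phi>' x = z \<eta> / \<eta> * (\<eta> * v' (\<eta> * x)) + v \<eta> / \<eta> * (\<eta> * z' (\<eta> * x))" for x
  have \<phi>: "solves_linear (\<lambda>x. \<eta>\<^sup>2 * V (\<eta> * x)) \<phi> \<phi>' S" for S
    unfolding \<phi>_def[abs_def] \<phi>'_def[abs_def]
    by (intro solves_linear_lincomb solves_linear_scale solves_linear_v solves_linear_z)
  have \<phi>_left: "\<phi> (-1) = 0" "\<phi>' (-1) = 1"
  proof -
    show "\<phi> (-1) = 0" by (simp add: \<phi>_def v_minus z_minus)
    have "\<phi>' (-1) = v (- \<eta>) * z' (- \<eta>) - v' (- \<eta>) * z (- \<eta>)"
      using \<eta> by (simp add: \<phi>'_def v_minus v'_minus z_minus algebra_simps)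
    then show "\<phi>' (-1) = 1" by (simp only: wronskian)
  qed
  have \<phi>_1: "\<phi> 1 = 2 * v \<eta> * z \<eta> / \<eta>" by (simp add: \<phi>_def add_divide_distrib[symmetric])
  obtain C where C: "\<forall>lam1 lam2 s1 s2. \<forall>x\<in>{-1..1}. 0 \<le> lam1 \<and> lam1 \<le> ?lam \<and> 0 \<le> lam2 \<longrightarrow>
      \<bar>shoot M lam1 s1 x - shoot M lam2 s2 x\<bar> \<le> C * (\<bar>s1 - s2\<bar> + \<bar>lam1 - lam2\<bar>)"
    using shoot_lipschitz[of ?lam M] by metis
  define D where "D = ?lam * exp M * C\<^sup>2"
  define B where "B = sqrt (D\<^sup>2 * 2 * exp ((2 + ?lam * exp M) * 2))"
  have main: "\<bar>shoot M ?lam s 1 - shoot M ?lam ?s0 1 - (s - ?s0) * \<phi> 1\<bar> \<le> B * (s - ?s0)\<^sup>2"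
    if s: "\<bar>s - ?s0\<bar> < 1" for s
  proof -
    define h where "h = s - ?s0"
    define y y' where "y = shoot M ?lam s" and "y' = shoot' M ?lam s"
    have y: "truncated_sol M ?lam y y'" "y (-1) = 0" "y' (-1) = s"
      using shoot[of ?lam M s] lam by (auto simp: y_def y'_def)
    have yM: "y x \<le> M" if "x \<in> {-1..1}" for x
      unfolding y_def using s M M0 lam that by (intro shoot_le) auto
    define r where "r x = - (?lam * \<bar>x\<bar> powr l * (exp (min (y x) M) - exp (U x) - exp (U x) * (h * \<phi> x)))" for x
    have "(y 1 - U 1 - h * \<phi> 1)\<^sup>2 + (y' 1 - \<eta> * w' (\<eta> * 1) - h * \<phi>' 1)\<^sup>2
        \<le> ((y (-1) - U (-1) - h * \<phi> (-1))\<^sup>2 + (y' (-1) - \<eta> * w' (\<eta> * (-1)) - h * \<phi>' (-1))\<^sup>2 + (D * h\<^sup>2)\<^sup>2 * (1 - (-1)))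
          * exp ((2 + ?lam * exp M) * (1 - (-1)))"
    proof (rule second_order_gronwall_forward[where r = r])
      fix x :: real assume x: "x \<in> {-1..1}"
      show "((\<lambda>x. y x - U x - h * \<phi> x) has_real_derivative y' x - \<eta> * w' (\<eta> * x) - h * \<phi>' x) (at x)"
        by (intro DERIV_diff DERIV_cmult truncated_solD(1)[OF y(1)] truncated_solD(1)[OF U] solves_linearD(1)[OF \<phi> UNIV_I])
      have mU: "min (U x) M = U x" for x using UM[of x] by simp
      have "((\<lambda>x. y' x - \<eta> * w' (\<eta> * x) - h * \<phi>' x) has_real_derivative
          - (?lam * \<bar>x\<bar> powr l * exp (min (y x) M)) - - (?lam * \<bar>x\<bar> powr l * exp (min (U x) M)) - h * - (\<eta>\<^sup>2 * V (\<eta> * x) * \<phi> x)) (at x)"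
        by (intro DERIV_diff DERIV_cmult truncated_solD(2)[OF y(1)] truncated_solD(2)[OF U] solves_linearD(2)[OF \<phi> UNIV_I])
      then show "((\<lambda>x. y' x - \<eta> * w' (\<eta> * x) - h * \<phi>' x) has_real_derivative r x) (at x)"
        unfolding r_def mU pot by (simp add: algebra_simps)
      have yU: "\<bar>y x - U x\<bar> \<le> C * \<bar>h\<bar>"
        using C[rule_format, of x ?lam ?lam s ?s0] x lam by (simp add: U_eq y_def h_def)
      have k: "0 \<le> ?lam * \<bar>x\<bar> powr l" "?lam * \<bar>x\<bar> powr l \<le> ?lam"
        using lam abs_powr_le_1[OF x l_pos] by (auto intro: mult_left_le)
      \<comment> \<open>Regrouped so that the linear part acts on the remainder itself and only the
        quadratic Taylor error of \<open>exp\<close> is left over.\<close>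
      have "r x = - (?lam * \<bar>x\<bar> powr l * (exp (U x) * (y x - U x - h * \<phi> x) + (exp (y x) - exp (U x) - exp (U x) * (y x - U x))))"
        using yM[OF x] by (simp add: r_def algebra_simps)
      then have "\<bar>r x\<bar> = ?lam * \<bar>x\<bar> powr l * \<bar>exp (U x) * (y x - U x - h * \<phi> x) + (exp (y x) - exp (U x) - exp (U x) * (y x - U x))\<bar>"
        using k(1) lam by (simp add: abs_mult)
      also have "\<dots> \<le> ?lam * (exp M * \<bar>y x - U x - h * \<phi> x\<bar> + exp M * (C * \<bar>h\<bar>)\<^sup>2)"
      proof (intro mult_mono k)
        have "\<bar>exp (U x) * (y x - U x - h * \<phi> x)\<bar> \<le> exp M * \<bar>y x - U x - h * \<phi> x\<bar>"
          using UM[of x] by (simp add: abs_mult mult_right_mono)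
        moreover have "\<bar>exp (y x) - exp (U x) - exp (U x) * (y x - U x)\<bar> \<le> exp M * (C * \<bar>h\<bar>)\<^sup>2"
          using exp_second_order[OF yM[OF x] UM[of x]] power_mono[OF yU, of 2]
          by (auto intro: order_trans mult_left_mono)
        ultimately show "\<bar>exp (U x) * (y x - U x - h * \<phi> x) + (exp (y x) - exp (U x) - exp (U x) * (y x - U x))\<bar>
            \<le> exp M * \<bar>y x - U x - h * \<phi> x\<bar> + exp M * (C * \<bar>h\<bar>)\<^sup>2"
          by linarith
      qed (use lam in auto)
      also have "\<dots> = ?lam * exp M * \<bar>y x - U x - h * \<phi> x\<bar> + D * h\<^sup>2"
        by (simp add: D_def power_mult_distrib algebra_simps)
      finally show "\<bar>r x\<bar> \<le> ?lam * exp M * \<bar>y x - U x - h * \<phi> x\<bar> + D * h\<^sup>2" .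
    qed (use lam in auto)
    also have "\<dots> = (B * h\<^sup>2)\<^sup>2"
      using y(2,3) by (simp add: \<phi>_left B_def power_mult_distrib U_def w_minus w'_minus \<sigma>_def h_def)
    finally have "(y 1 - U 1 - h * \<phi> 1)\<^sup>2 \<le> (B * h\<^sup>2)\<^sup>2"
      by (rule order_trans[rotated]) simp
    then have "\<bar>y 1 - U 1 - h * \<phi> 1\<bar> \<le> B * h\<^sup>2"
      by (subst (asm) abs_le_square_iff[symmetric]) (simp add: abs_mult B_def)
    then show ?thesis by (simp add: y_def U_eq h_def)
  qed
  have "((\<lambda>s. (shoot M ?lam s 1 - shoot M ?lam ?s0 1) / (s - ?s0) - \<phi> 1) \<longlongrightarrow> 0) (at ?s0)"
  proof (rule Lim_null_comparison)
    have "norm ((shoot M ?lam s 1 - shoot M ?lam ?s0 1) / (s - ?s0) - \<phi> 1) \<le> B * \<bar>s - ?s0\<bar>"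
      if s: "s \<noteq> ?s0" "\<bar>s - ?s0\<bar> < 1" for s
    proof -
      have "(shoot M ?lam s 1 - shoot M ?lam ?s0 1) / (s - ?s0) - \<phi> 1
          = (shoot M ?lam s 1 - shoot M ?lam ?s0 1 - (s - ?s0) * \<phi> 1) / (s - ?s0)"
        using s by (simp add: diff_divide_distrib)
      also have "\<bar>\<dots>\<bar> \<le> B * (s - ?s0)\<^sup>2 / \<bar>s - ?s0\<bar>"
        unfolding abs_divide by (intro divide_right_mono main s) auto
      also have "B * a\<^sup>2 / \<bar>a\<bar> = B * \<bar>a\<bar>" for a :: real
        by (cases "a \<ge> 0") (simp_all add: power2_eq_square)
      finally show ?thesis by simp
    qed
    then show "\<forall>\<^sub>F s in at ?s0. norm ((shoot M ?lam s 1 - shoot M ?lam ?s0 1) / (s - ?s0) - \<phi> 1) \<le> B * \<bar>s - ?s0\<bar>"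
      by (auto simp: eventually_at dist_real_def intro!: exI[of _ 1])
    have "((\<lambda>s. B * \<bar>s - ?s0\<bar>) \<longlongrightarrow> B * \<bar>?s0 - ?s0\<bar>) (at ?s0)" by (intro tendsto_intros)
    then show "((\<lambda>s. B * \<bar>s - ?s0\<bar>) \<longlongrightarrow> 0) (at ?s0)" by simp
  qed
  then show ?thesis unfolding \<phi>_1[symmetric] has_field_derivative_iff by (simp add: LIM_zero_iff)
qed

section \<open>Existence of non-even solutions and bifurcation\<close>

lemma shoot_korman_right_end: "\<eta> > 0 \<Longrightarrow> \<sigma> \<eta> \<le> M \<Longrightarrow> shoot M (\<Lambda> \<eta>) (\<sigma> \<eta>) 1 = 0"
  using shoot_korman[of \<eta> M 1] by simp

text \<open>\<open>\<Lambda>\<close> is unimodal. This rules out a third even solution for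
  \<open>lam\<close> whose slope lies between those of the two known ones.\<close>

lemma \<Lambda>_between:
  assumes "0 < \<eta>1" "\<eta>1 < \<tau>" "\<tau> < \<eta>2" "\<Lambda> \<eta>1 = lam" "\<Lambda> \<eta>2 = lam" "\<eta>1 < \<eta>" "\<eta> < \<eta>2"
  shows "\<Lambda> \<eta> > lam"
  using assms \<Lambda>_less_left[of \<eta>1 \<eta>] \<Lambda>_less_right[of \<eta> \<eta>2] by (cases "\<eta> \<le> \<tau>") auto

text \<open>The right end value of the shooting solution crosses zero upwards at both even solutions, so it
  vanishes once more in between.\<close>

lemma positive_noneven_solution_exists:
  assumes lam: "0 < lam" "lam < \<Lambda> \<zeta>"
  shows "\<exists>u. positive_noneven_solution l lam u"
proof -
  obtain \<eta>1 \<eta>2 where \<eta>: "0 < \<eta>1" "\<eta>1 < \<tau>" "\<zeta> < \<eta>2" and \<Lambda>: "\<Lambda> \<eta>1 = lam" "\<Lambda> \<eta>2 = lam"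
    using \<Lambda>_preimages[OF lam] by metis
  have \<eta>': "\<tau> < \<eta>2" "\<eta>1 < \<zeta>" "0 < \<eta>2" "\<eta>1 < \<eta>2" using \<eta> \<tau>_less_\<zeta> \<tau>_pos by auto
  let ?s1 = "\<sigma> \<eta>1" and ?s2 = "\<sigma> \<eta>2"
  have s: "0 < ?s1" "?s1 < ?s2" using \<sigma>_pos \<sigma>_less \<eta> \<eta>' by auto
  \<comment> \<open>Large enough for slopes up to \<open>?s2 + 1\<close>, as
    \<open>DERIV_shoot_korman\<close> demands at both even solutions.\<close>
  define M where "M = 2 * (?s2 + 1)"
  define F where "F s = shoot M lam s 1" for s
  have d1: "(F has_real_derivative 2 * v \<eta>1 * z \<eta>1 / \<eta>1) (at ?s1)"
    using DERIV_shoot_korman[OF \<eta>(1), of M] s unfolding F_def[abs_def] M_def \<Lambda> by simp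
  have d2: "(F has_real_derivative 2 * v \<eta>2 * z \<eta>2 / \<eta>2) (at ?s2)"
    using DERIV_shoot_korman[OF \<eta>'(3), of M] s unfolding F_def[abs_def] M_def \<Lambda> by simp
  have F0: "F ?s1 = 0" "F ?s2 = 0"
    using shoot_korman_right_end[OF \<eta>(1), of M] shoot_korman_right_end[OF \<eta>'(3), of M] s
    unfolding F_def M_def \<Lambda> by simp_all
  have p1: "0 < 2 * v \<eta>1 * z \<eta>1 / \<eta>1" using v_pos[of \<eta>1] z_pos[of \<eta>1] \<eta> \<eta>' by simp
  have p2: "0 < 2 * v \<eta>2 * z \<eta>2 / \<eta>2" using v_neg[of \<eta>2] z_neg[of \<eta>2] \<eta> \<eta>' by (simp add: mult_neg_neg)
  obtain e1 where e1: "e1 > 0" "\<forall>h>0. h < e1 \<longrightarrow> F ?s1 < F (?s1 + h)"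
    using DERIV_pos_inc_right[OF d1 p1] by blast
  obtain e2 where e2: "e2 > 0" "\<forall>h>0. h < e2 \<longrightarrow> F (?s2 - h) < F ?s2"
    using DERIV_pos_inc_left[OF d2 p2] by blast
  define h where "h = min (min (e1 / 2) (e2 / 2)) ((?s2 - ?s1) / 3)"
  have h: "0 < h" "h < e1" "h < e2" "h \<le> (?s2 - ?s1) / 3"
    using e1 e2 s min.cobounded2[of "min (e1 / 2) (e2 / 2)" "(?s2 - ?s1) / 3", folded h_def] by (auto simp: h_def)
  have "F (?s2 - h) \<le> 0" "0 \<le> F (?s1 + h)" using e1(2)[rule_format, of h] e2(2)[rule_format, of h] h F0 by auto
  moreover have "continuous_on {?s1 + h..?s2 - h} F"
    unfolding F_def[abs_def] using lam
    by (intro continuous_on_shoot[where K = lam] continuous_intros) auto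
  moreover have "?s1 + h \<le> ?s2 - h" using h s by simp
  ultimately obtain c where c: "?s1 + h \<le> c" "c \<le> ?s2 - h" "F c = 0"
    using IVT2'[of F "?s2 - h" 0 "?s1 + h"] by blast
  have c': "?s1 < c" "c < ?s2" "0 < c" "2 * c \<le> M" using c h s by (auto simp: M_def)
  have zero: "shoot M lam c 1 = 0" using c by (simp add: F_def)
  have "\<not> even_fun (shoot M lam c)"
  proof
    assume "even_fun (shoot M lam c)"
    then obtain \<eta> where e: "\<eta> > 0" "\<Lambda> \<eta> = lam" "\<sigma> \<eta> = c"
      using even_shoot_is_korman[OF lam(1) c'(3,4) zero] by blast
    then have "\<eta>1 < \<eta>" "\<eta> < \<eta>2" using c' \<sigma>_less_iff \<eta> \<eta>' by auto
    from \<Lambda>_between[OF \<eta>(1,2) \<eta>'(1) \<Lambda> this] e show False by simp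
  qed
  then show ?thesis
    using shoot_solution[OF lam(1) c'(3,4) zero] lam unfolding positive_noneven_solution_def by blast
qed

text \<open>Moving the initial slope slightly above that of the even solution, the right end value changes sign
  as \<open>\<eta>\<close> crosses \<open>\<zeta>\<close>, because its derivative \<open>2 v z / \<eta>\<close> does.\<close>

lemma noneven_bifurcation_point_\<zeta>: "noneven_bifurcation_point l (- w \<zeta>)"
  unfolding noneven_bifurcation_point_def
proof (intro allI impI)
  fix \<epsilon> :: real assume \<epsilon>: "\<epsilon> > 0"
  \<comment> \<open>Admits every positive \<open>\<eta> < 2 * \<zeta>\<close>, a neighbourhood of
    \<open>\<zeta>\<close>, with margin 1 for the slope.\<close>
  define M where "M = 2 * (\<sigma> (2 * \<zeta>) + 1)"
  obtain C where C0: "C \<ge> 0" and C: "\<forall>lam1 lam2 s1 s2. \<forall>x\<in>{-1..1}. 0 \<le> lam1 \<and> lam1 \<le> \<Lambda> \<tau> \<and> 0 \<le> lam2 \<longrightarrow>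
      \<bar>shoot M lam1 s1 x - shoot M lam2 s2 x\<bar> \<le> C * (\<bar>s1 - s2\<bar> + \<bar>lam1 - lam2\<bar>)"
    using shoot_lipschitz[of "\<Lambda> \<tau>" M] by metis
  \<comment> \<open>The final distance is below \<open>e + C * (3 * e)\<close>: one \<open>e\<close>
    for \<open>lam\<close>, and in the Lipschitz bound one each for \<open>lam\<close>,
    \<open>\<sigma>\<close> and \<open>\<delta>\<close>.\<close>
  define e where "e = \<epsilon> / (2 * (1 + 3 * C))"
  have "1 + 3 * C > 0" using C0 by simp
  then have e: "e > 0" "e * (1 + 3 * C) = \<epsilon> / 2" using \<epsilon> unfolding e_def by (auto simp: field_simps)
  have "isCont \<Lambda> \<zeta>" using DERIV_\<Lambda>[OF \<zeta>_pos] by (rule DERIV_isCont)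
  then obtain r1 where r1: "r1 > 0" "\<And>\<eta>. \<bar>\<eta> - \<zeta>\<bar> < r1 \<Longrightarrow> \<bar>\<Lambda> \<eta> - \<Lambda> \<zeta>\<bar> < e"
    unfolding continuous_at_eps_delta dist_real_def using e(1) by meson
  have "isCont \<sigma> \<zeta>" using continuous_on_\<sigma>[of UNIV] by (simp add: continuous_on_eq_continuous_at)
  then obtain r2 where r2: "r2 > 0" "\<And>\<eta>. \<bar>\<eta> - \<zeta>\<bar> < r2 \<Longrightarrow> \<bar>\<sigma> \<eta> - \<sigma> \<zeta>\<bar> < e"
    unfolding continuous_at_eps_delta dist_real_def using e(1) by meson
  \<comment> \<open>\<open>r < \<zeta> - \<tau>\<close> keeps the whole interval to the right of
    \<open>\<tau>\<close>, where \<open>v < 0\<close> and \<open>\<Lambda>\<close> is strictly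
    decreasing.\<close>
  define r where "r = min (min r1 r2) (\<zeta> - \<tau>) / 2"
  have r: "0 < r" "r < r1" "r < r2" "r < \<zeta> - \<tau>" "r < \<zeta>"
    using r1 r2 \<tau>_less_\<zeta> \<tau>_pos by (auto simp: r_def min_def)
  define \<eta>1 \<eta>2 where "\<eta>1 = \<zeta> - r" and "\<eta>2 = \<zeta> + r"
  have \<eta>: "\<tau> < \<eta>1" "\<eta>1 < \<zeta>" "\<zeta> < \<eta>2" "\<eta>2 < 2 * \<zeta>" "0 < \<eta>1" "0 < \<eta>2"
    using r \<tau>_pos by (auto simp: \<eta>1_def \<eta>2_def)
  have M\<eta>: "2 * (\<sigma> \<eta> + 1) \<le> M" if "0 < \<eta>" "\<eta> < 2 * \<zeta>" for \<eta>
    using \<sigma>_less[of \<eta> "2 * \<zeta>"] that by (simp add: M_def)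
  have n1: "2 * v \<eta>1 * z \<eta>1 / \<eta>1 < 0"
    using v_neg[of \<eta>1] z_pos[of \<eta>1] \<eta> by (simp add: divide_neg_pos mult_neg_pos)
  have p2: "0 < 2 * v \<eta>2 * z \<eta>2 / \<eta>2"
    using v_neg[of \<eta>2] z_neg[of \<eta>2] \<eta> by (simp add: mult_neg_neg)
  have M1: "2 * (\<sigma> \<eta>1 + 1) \<le> M" and M2: "2 * (\<sigma> \<eta>2 + 1) \<le> M"
    using M\<eta> \<eta> by auto
  obtain d1 where d1: "d1 > 0" "\<forall>h>0. h < d1 \<longrightarrow> shoot M (\<Lambda> \<eta>1) (\<sigma> \<eta>1 + h) 1 < shoot M (\<Lambda> \<eta>1) (\<sigma> \<eta>1) 1"
    using DERIV_neg_dec_right[OF DERIV_shoot_korman[OF \<eta>(5) M1] n1] by blast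
  obtain d2 where d2: "d2 > 0" "\<forall>h>0. h < d2 \<longrightarrow> shoot M (\<Lambda> \<eta>2) (\<sigma> \<eta>2) 1 < shoot M (\<Lambda> \<eta>2) (\<sigma> \<eta>2 + h) 1"
    using DERIV_pos_inc_right[OF DERIV_shoot_korman[OF \<eta>(6) M2] p2] by blast
  define \<delta> where "\<delta> = min (min (d1 / 2) (d2 / 2)) (min e 1)"
  have \<delta>: "0 < \<delta>" "\<delta> < d1" "\<delta> < d2" "\<delta> \<le> e" "\<delta> \<le> 1" using d1 d2 e by (auto simp: \<delta>_def)
  \<comment> \<open>The slope stays at the fixed distance \<open>\<delta>\<close> above the even
    curve, so a zero of \<open>G\<close> cannot be the even solution with the same
    \<open>\<eta>\<close>.\<close>
  define G where "G \<eta> = shoot M (\<Lambda> \<eta>) (\<sigma> \<eta> + \<delta>) 1" for \<eta>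
  have "G \<eta>1 \<le> 0" "0 \<le> G \<eta>2"
    using d1(2)[rule_format, of \<delta>] d2(2)[rule_format, of \<delta>] \<delta> \<eta> M\<eta>[of \<eta>1] M\<eta>[of \<eta>2]
      \<sigma>_pos[of \<eta>1] \<sigma>_pos[of \<eta>2] shoot_korman_right_end[of \<eta>1 M] shoot_korman_right_end[of \<eta>2 M]
    by (auto simp: G_def)
  moreover have "continuous_on {\<eta>1..\<eta>2} G"
    unfolding G_def[abs_def] using \<eta> \<Lambda>_le_max
    by (intro continuous_on_shoot[where K = "\<Lambda> \<tau>"] continuous_intros continuous_on_\<Lambda> continuous_on_\<sigma>)
       (auto intro!: less_imp_le[OF \<Lambda>_pos])
  moreover have "\<eta>1 \<le> \<eta>2" using \<eta> by simp
  ultimately obtain \<eta>0 where \<eta>0: "\<eta>1 \<le> \<eta>0" "\<eta>0 \<le> \<eta>2" "G \<eta>0 = 0"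
    using IVT'[of G \<eta>1 0 \<eta>2] by blast
  have near: "\<bar>\<eta>0 - \<zeta>\<bar> < r1" "\<bar>\<eta>0 - \<zeta>\<bar> < r2" using \<eta>0 r by (auto simp: \<eta>1_def \<eta>2_def)
  have \<eta>0': "\<tau> < \<eta>0" "0 < \<eta>0" "\<eta>0 < 2 * \<zeta>" using \<eta>0 \<eta> by auto
  define lam s where "lam = \<Lambda> \<eta>0" and "s = \<sigma> \<eta>0 + \<delta>"
  have lam: "lam > 0" using \<Lambda>_pos \<eta>0' by (simp add: lam_def)
  have s: "s > 0" "2 * s \<le> M" using \<sigma>_pos[OF \<eta>0'(2)] M\<eta>[OF \<eta>0'(2,3)] \<delta> by (auto simp: s_def)
  have zero: "shoot M lam s 1 = 0" using \<eta>0 by (simp add: G_def lam_def s_def)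
  \<comment> \<open>An even solution with this slope would have \<open>\<eta> > \<eta>0\<close>; as
    \<open>\<Lambda>\<close> decreases there, it would belong to a smaller
    \<open>lam\<close>.\<close>
  have "\<not> even_fun (shoot M lam s)"
  proof
    assume "even_fun (shoot M lam s)"
    then obtain \<eta> where h: "\<eta> > 0" "\<Lambda> \<eta> = lam" "\<sigma> \<eta> = s"
      using even_shoot_is_korman[OF lam s zero] by blast
    then have "\<eta>0 < \<eta>" using \<sigma>_less_iff[OF \<eta>0'(2) h(1)] \<delta> by (simp add: s_def)
    then show False using \<Lambda>_less_right[of \<eta>0 \<eta>] \<eta>0' h by (simp add: lam_def)
  qed
  then have sol: "positive_noneven_solution l lam (shoot M lam s)"
    using shoot_solution[OF lam s zero] lam unfolding positive_noneven_solution_def by blast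
  have "sup_norm (\<lambda>x. shoot M lam s x - korman_U l (- w \<zeta>) x) \<le> C * (3 * e)"
    unfolding sup_norm_def
  proof (rule cSUP_least)
    fix x :: real assume x: "x \<in> {-1..1}"
    have "korman_U l (- w \<zeta>) x = shoot M (\<Lambda> \<zeta>) (\<sigma> \<zeta>) x"
      using shoot_korman[OF \<zeta>_pos _ x, of M] M\<eta>[of \<zeta>] \<zeta>_pos \<sigma>_pos[OF \<zeta>_pos] by (simp add: korman_U_eq)
    then have "\<bar>shoot M lam s x - korman_U l (- w \<zeta>) x\<bar> \<le> C * (\<bar>s - \<sigma> \<zeta>\<bar> + \<bar>lam - \<Lambda> \<zeta>\<bar>)"
      using C x lam \<Lambda>_le_max[of \<eta>0] \<Lambda>_pos[OF \<zeta>_pos] \<eta>0' by (simp add: lam_def)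
    also have "\<dots> \<le> C * (3 * e)"
      using r1(2)[OF near(1)] r2(2)[OF near(2)] \<delta> C0
      by (intro mult_left_mono) (auto simp: lam_def s_def)
    finally show "\<bar>shoot M lam s x - korman_U l (- w \<zeta>) x\<bar> \<le> C * (3 * e)" .
  qed simp
  moreover have "\<bar>lam - korman_lambda l (- w \<zeta>)\<bar> < e"
    using r1(2)[OF near(1)] \<zeta>_pos by (simp add: korman_lambda_eq lam_def)
  ultimately have "\<bar>lam - korman_lambda l (- w \<zeta>)\<bar> + sup_norm (\<lambda>x. shoot M lam s x - korman_U l (- w \<zeta>) x)
      < e + C * (3 * e)" by linarith
  also have "\<dots> = \<epsilon> / 2" using e(2) by (simp add: algebra_simps)
  also have "\<dots> < \<epsilon>" using \<epsilon> by simp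
  finally show "\<exists>lam u. positive_noneven_solution l lam u \<and>
      \<bar>lam - korman_lambda l (- w \<zeta>)\<bar> + sup_norm (\<lambda>x. u x - korman_U l (- w \<zeta>) x) < \<epsilon>"
    using sol by blast
qed

end

text \<open>The difference of \<open>u\<close> and its reflection vanishes at \<open>0\<close> and \<open>1\<close>; at an interior maximum of its
  modulus the equation bounds it by \<open>lam * exp (sup_norm u)\<close> times itself.\<close>

lemma positive_noneven_solution_norm:
  assumes l: "l > 0" and sol: "positive_noneven_solution l lam u"
  shows "1 < lam * exp (sup_norm u)"
proof -
  from sol obtain u' where lam: "lam > 0" and cu: "continuous_on {-1..1} u" and u0: "u (-1) = 0" "u 1 = 0"
    and du: "\<And>x. x \<in> {-1<..<1} \<Longrightarrow> (u has_real_derivative u' x) (at x)"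
      "\<And>x. x \<in> {-1<..<1} \<Longrightarrow> (u' has_real_derivative - (lam * \<bar>x\<bar> powr l * exp (u x))) (at x)"
    and ne: "\<not> even_fun u"
    unfolding positive_noneven_solution_def liouville_solution_def dirichlet_solution_def by blast
  define N where "N = sup_norm u"
  have uN: "u x \<le> N" if "x \<in> {-1..1}" for x
  proof -
    obtain B where "\<And>x. x \<in> {-1..1} \<Longrightarrow> \<bar>u x\<bar> \<le> B"
      using continuous_on_Icc_bounded[OF cu] by blast
    then have "bdd_above ((\<lambda>x. \<bar>u x\<bar>) ` {-1..1})" by (intro bdd_aboveI[of _ B]) auto
    then have "\<bar>u x\<bar> \<le> N" unfolding N_def sup_norm_def using that by (intro cSUP_upper)
    then show ?thesis by simp
  qed
  define d where "d x = u x - u (- x)" for x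
  define d' where "d' x = u' x + u' (- x)" for x
  have dd: "(d has_real_derivative d' x) (at x)"
    "(d' has_real_derivative - (lam * \<bar>x\<bar> powr l * (exp (u x) - exp (u (- x))))) (at x)"
    if x: "x \<in> {-1<..<1}" for x
  proof -
    have mx: "- x \<in> {-1<..<1}" using x by auto
    show "(d has_real_derivative d' x) (at x)"
      unfolding d_def[abs_def] d'_def
      using DERIV_diff[OF du(1)[OF x] du(1)[OF mx, unfolded DERIV_mirror]] by simp
    show "(d' has_real_derivative - (lam * \<bar>x\<bar> powr l * (exp (u x) - exp (u (- x))))) (at x)"
      unfolding d'_def[abs_def]
      using DERIV_add[OF du(2)[OF x] du(2)[OF mx, unfolded DERIV_mirror]] by (simp add: algebra_simps)
  qed
  have cd: "continuous_on {-1..1} (\<lambda>x. \<bar>d x\<bar>)"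
    unfolding d_def by (intro continuous_intros cu continuous_on_compose2[OF cu]) auto
  obtain x0 where x0: "x0 \<in> {0..1}" "\<And>x. x \<in> {0..1} \<Longrightarrow> \<bar>d x\<bar> \<le> \<bar>d x0\<bar>"
    using continuous_attains_sup[of "{0..1::real}" "\<lambda>x. \<bar>d x\<bar>"] continuous_on_subset[OF cd, of "{0..1}"] by auto
  have odd: "d (- x) = - d x" for x by (simp add: d_def)
  define m where "m = \<bar>d x0\<bar>"
  have dm: "\<bar>d x\<bar> \<le> m" if "x \<in> {-1..1}" for x
    using x0(2)[of "\<bar>x\<bar>"] that odd[of x] by (cases "x \<ge> 0") (auto simp: m_def)
  obtain xn where "xn \<in> {-1..1}" "u (- xn) \<noteq> u xn" using ne by (auto simp: even_fun_def)
  then have m: "m > 0" using dm[of xn] by (auto simp: d_def)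
  have "d 0 = 0" "d 1 = 0" using u0 by (auto simp: d_def)
  then have x0': "0 < x0" "x0 < 1" using x0(1) m by (auto simp: m_def less_le)
  have d'0: "d' x0 = 0"
  proof -
    \<comment> \<open>The sign turns a maximum of \<open>\<bar>d\<bar>\<close> into one of a
      differentiable function; the bound \<open>m\<close> holds on all of \<open>[-1, 1]\<close>, so
      this maximum is two-sided around \<open>x0\<close>.\<close>
    define sg where "sg = sgn (d x0)"
    have sg: "sg * d x0 = m" "\<bar>sg\<bar> = 1" using m by (auto simp: sg_def m_def sgn_if)
    have "((\<lambda>x. sg * d x) has_real_derivative sg * d' x0) (at x0)"
      using dd(1)[of x0] x0' by (intro DERIV_cmult) auto
    moreover have "\<forall>y. \<bar>x0 - y\<bar> < 1 - x0 \<longrightarrow> sg * d y \<le> sg * d x0"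
    proof (intro allI impI)
      fix y assume "\<bar>x0 - y\<bar> < 1 - x0"
      then have "\<bar>d y\<bar> \<le> m" using x0' by (intro dm) auto
      then have "\<bar>sg * d y\<bar> \<le> m" using sg(2) by (simp add: abs_mult)
      then show "sg * d y \<le> sg * d x0" using sg(1) by linarith
    qed
    ultimately have "sg * d' x0 = 0"
      using DERIV_local_max[of "\<lambda>x. sg * d x" "sg * d' x0" x0 "1 - x0"] x0' by simp
    then show ?thesis using sg(2) by auto
  qed
  \<comment> \<open>Two mean values: \<open>m = x0 * \<bar>d' y\<bar>\<close>, and
    \<open>\<bar>d' y\<bar> \<le> (x0 - y) * K < K\<close> because \<open>d' x0 = 0\<close>; with
    \<open>x0 < 1\<close> this gives \<open>m < K\<close>.\<close>
  define K where "K = lam * exp N * m"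
  have K: "\<bar>- (lam * \<bar>x\<bar> powr l * (exp (u x) - exp (u (- x))))\<bar> \<le> K" if x: "x \<in> {-1..1}" for x
  proof -
    have "\<bar>- (lam * \<bar>x\<bar> powr l * (exp (u x) - exp (u (- x))))\<bar> = lam * \<bar>x\<bar> powr l * \<bar>exp (u x) - exp (u (- x))\<bar>"
      using lam by (simp add: abs_mult)
    also have "\<dots> \<le> lam * 1 * (exp N * \<bar>u x - u (- x)\<bar>)"
      using lam x by (intro mult_mono mult_left_mono abs_powr_le_1 exp_lipschitz uN l) auto
    also have "\<dots> \<le> lam * 1 * (exp N * m)"
      using lam dm[OF x] by (intro mult_left_mono) (auto simp: d_def)
    finally show ?thesis by (simp add: K_def)
  qed
  obtain y where y: "0 < y" "y < x0" "d x0 - d 0 = (x0 - 0) * d' y"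
    using MVT2[OF x0'(1), of d d'] dd(1) x0' by force
  define r where "r x = - (lam * \<bar>x\<bar> powr l * (exp (u x) - exp (u (- x))))" for x
  have "(d' has_real_derivative r x) (at x)" if "y \<le> x" "x \<le> x0" for x
    using dd(2)[of x] that y x0' by (simp add: r_def)
  from MVT2[OF y(2) this] obtain t where t: "y < t" "t < x0" "d' x0 - d' y = (x0 - y) * r t"
    by blast
  have K0: "K > 0" using lam m by (simp add: K_def)
  have "d' y = - ((x0 - y) * r t)" using t(3) d'0 by simp
  then have "\<bar>d' y\<bar> = (x0 - y) * \<bar>r t\<bar>" using y(2) by (simp add: abs_mult)
  also have "\<dots> \<le> (x0 - y) * K" using t y x0' unfolding r_def by (intro mult_left_mono K) auto
  also have "\<dots> < 1 * K" using K0 x0' y by (intro mult_strict_right_mono) auto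
  finally have "\<bar>d' y\<bar> < K" by simp
  moreover have "m = x0 * \<bar>d' y\<bar>" using y(3) x0' \<open>d 0 = 0\<close> by (simp add: m_def abs_mult)
  moreover have "x0 * \<bar>d' y\<bar> \<le> 1 * \<bar>d' y\<bar>" using x0' by (intro mult_right_mono) auto
  ultimately have "m < lam * exp N * m" by (simp add: K_def)
  then show ?thesis using m by (simp add: N_def)
qed

text \<open>The norm bound rearranges to \<open>sup_norm u > - ln lam\<close>. It holds for every
  positive non-even solution, so the blow-up is independent of how \<open>u\<close> is
  selected.\<close>

lemma sup_norm_positive_noneven_solution_at_top:
  assumes l: "l > 0" and b: "b > 0" and u: "\<And>lam. 0 < lam \<Longrightarrow> lam < b \<Longrightarrow> positive_noneven_solution l lam (u lam)"
  shows "filterlim (\<lambda>lam. sup_norm (u lam)) at_top (at_right 0)"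
  unfolding filterlim_at_top
proof
  fix Z :: real
  define c where "c = min b (exp (- Z))"
  have "Z \<le> sup_norm (u lam)" if "0 < lam" "lam < c" for lam
  proof -
    have "1 < lam * exp (sup_norm (u lam))"
      using positive_noneven_solution_norm[OF l u] that by (simp add: c_def)
    also have "\<dots> \<le> exp (- Z) * exp (sup_norm (u lam))"
      using that by (intro mult_right_mono) (auto simp: c_def)
    also have "\<dots> = exp (sup_norm (u lam) - Z)" by (simp add: exp_add[symmetric])
    finally show ?thesis by simp
  qed
  moreover have "c > 0" using b by (simp add: c_def)
  ultimately show "\<forall>\<^sub>F lam in at_right 0. Z \<le> sup_norm (u lam)"
    unfolding eventually_at_right_field by blast
qed

theorem theorem1p1:
  fixes l :: real
  assumes "l > 0"
  shows "\<exists>\<alpha>1 \<alpha>2 \<alpha>3 :: real.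
    turning_parameter l < \<alpha>1 \<and> \<alpha>1 \<le> \<alpha>2 \<and> \<alpha>2 \<le> \<alpha>3 \<and>
    (\<forall>\<alpha>. 0 < \<alpha> \<and> \<alpha> < turning_parameter l \<longrightarrow> morse_index l \<alpha> = 0 \<and> \<not> degenerate l \<alpha>) \<and>
    (morse_index l (turning_parameter l) = 0 \<and> degenerate l (turning_parameter l)) \<and>
    (\<forall>\<alpha>. turning_parameter l < \<alpha> \<and> \<alpha> < \<alpha>1 \<longrightarrow> morse_index l \<alpha> = 1 \<and> \<not> degenerate l \<alpha>) \<and>
    (morse_index l \<alpha>1 = 1 \<and> degenerate l \<alpha>1) \<and>
    (morse_index l \<alpha>2 = 1 \<and> degenerate l \<alpha>2 \<and> noneven_bifurcation_point l \<alpha>2) \<and>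
    (morse_index l \<alpha>3 = 1 \<and> degenerate l \<alpha>3) \<and>
    (\<forall>\<alpha>>\<alpha>3. morse_index l \<alpha> = 2 \<and> \<not> degenerate l \<alpha>) \<and>
    (\<exists>u :: real \<Rightarrow> real \<Rightarrow> real.
       (\<forall>lam. 0 < lam \<and> lam < korman_lambda l \<alpha>3 \<longrightarrow> positive_noneven_solution l lam (u lam)) \<and>
       filterlim (\<lambda>lam. sup_norm (u lam)) at_top (at_right 0))"
proof -
  obtain w w' where "korman l w w'" using korman_exists[OF assms] by blast
  then interpret korman l w w' .
  \<comment> \<open>\<open>- w\<close> is strictly increasing on the positive axis, so comparing
    \<open>\<alpha>\<close> with \<open>- w \<tau>\<close> or \<open>- w \<zeta>\<close> amounts to
    comparing \<open>\<eta>\<close> with the zero.\<close>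
  have param: "\<exists>\<eta>>0. \<alpha> = - w \<eta> \<and> (\<forall>t>0. (\<alpha> < - w t \<longleftrightarrow> \<eta> < t) \<and> (- w t < \<alpha> \<longleftrightarrow> t < \<eta>))"
    if \<alpha>: "\<alpha> > 0" for \<alpha>
  proof -
    obtain \<eta> where "\<eta> > 0" "\<alpha> = - w \<eta>" using w_surj[OF \<alpha>] by blast
    then show ?thesis using w_less_iff by (intro exI[of _ \<eta>]) auto
  qed
  have nz: "v \<eta> \<noteq> 0" if "\<eta> > 0" "\<eta> \<noteq> \<tau>" for \<eta>
    using v_pos[of \<eta>] v_neg[of \<eta>] that by (cases \<eta> \<tau> rule: linorder_cases) auto
  have nz': "z \<eta> \<noteq> 0" if "\<eta> > 0" "\<eta> \<noteq> \<zeta>" for \<eta>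
    using z_pos[of \<eta>] z_neg[of \<eta>] that by (cases \<eta> \<zeta> rule: linorder_cases) auto
  have zero: "morse_index l \<alpha> = 0 \<and> \<not> degenerate l \<alpha>" if \<alpha>: "0 < \<alpha>" "\<alpha> < - w \<tau>" for \<alpha>
  proof -
    obtain \<eta> where \<eta>: "\<eta> > 0" "\<alpha> = - w \<eta>" "\<eta> < \<tau>" using param[OF \<alpha>(1)] \<alpha>(2) \<tau>_pos by auto
    then show ?thesis
      using nz[of \<eta>] nz'[of \<eta>] \<tau>_less_\<zeta> by (simp add: morse_index_eq degenerate_iff zero_enat_def)
  qed
  have one: "morse_index l \<alpha> = 1 \<and> \<not> degenerate l \<alpha>" if \<alpha>: "- w \<tau> < \<alpha>" "\<alpha> < - w \<zeta>" for \<alpha>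
  proof -
    have "\<alpha> > 0" using \<alpha>(1) w_neg[OF \<tau>_pos] by simp
    then obtain \<eta> where \<eta>: "\<eta> > 0" "\<alpha> = - w \<eta>" "\<tau> < \<eta>" "\<eta> < \<zeta>" using param \<alpha> \<tau>_pos \<zeta>_pos by metis
    then show ?thesis
      using nz[of \<eta>] nz'[of \<eta>] by (simp add: morse_index_eq degenerate_iff one_enat_def)
  qed
  have two: "morse_index l \<alpha> = 2 \<and> \<not> degenerate l \<alpha>" if \<alpha>: "- w \<zeta> < \<alpha>" for \<alpha>
  proof -
    have "\<alpha> > 0" using \<alpha> w_neg[OF \<zeta>_pos] by simp
    then obtain \<eta> where \<eta>: "\<eta> > 0" "\<alpha> = - w \<eta>" "\<zeta> < \<eta>" using param \<alpha> \<zeta>_pos by metis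
    then show ?thesis
      using nz[of \<eta>] nz'[of \<eta>] \<tau>_less_\<zeta> by (simp add: morse_index_eq degenerate_iff numeral_eq_enat)
  qed
  have at_\<tau>: "morse_index l (- w \<tau>) = 0 \<and> degenerate l (- w \<tau>)"
    using \<tau>_pos \<tau>_less_\<zeta> v_\<tau> by (simp add: morse_index_eq degenerate_iff zero_enat_def)
  have at_\<zeta>: "morse_index l (- w \<zeta>) = 1 \<and> degenerate l (- w \<zeta>)"
    using \<zeta>_pos \<tau>_less_\<zeta> z_\<zeta> by (simp add: morse_index_eq degenerate_iff one_enat_def)
  have less: "- w \<tau> < - w \<zeta>" using w_less[of \<tau> \<zeta>] \<tau>_pos \<tau>_less_\<zeta> by simp
  \<comment> \<open>An arbitrary choice for each \<open>lam\<close>, without continuity; the limit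
    holds for every selection.\<close>
  define u where "u lam = (SOME u. positive_noneven_solution l lam u)" for lam
  have u: "positive_noneven_solution l lam (u lam)" if "0 < lam" "lam < korman_lambda l (- w \<zeta>)" for lam
    using someI_ex[OF positive_noneven_solution_exists[of lam]] that \<zeta>_pos
    by (simp add: u_def korman_lambda_eq)
  have "korman_lambda l (- w \<zeta>) > 0" using \<Lambda>_pos[OF \<zeta>_pos] \<zeta>_pos by (simp add: korman_lambda_eq)
  from sup_norm_positive_noneven_solution_at_top[OF assms this u]
  have lim: "filterlim (\<lambda>lam. sup_norm (u lam)) at_top (at_right 0)" .
  show ?thesis
    unfolding turning_parameter_eq
    using less zero at_\<tau> one at_\<zeta> noneven_bifurcation_point_\<zeta> two u lim
    by (intro exI[of _ "- w \<zeta>"] conjI exI[of _ u]) auto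
qed

end
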